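(* Let $\mu$ be a rational-valued directed metric on a finite set $T$. If the underlying graph $H_\mu$ is a star and there exists no biased non-collinear triple for $\mu$, then $\overrightarrow{\mathbf{0}}\textbf{-Ext}[\mu]$ is solvable in polynomial time.
   Context: A directed metric on a finite set $T$ is a function $\mu:T\times T\to\mathbb{R}_+$ with $\mu(x,x)=0$, $\mu(x,y)+\mu(y,z)\ge\mu(x,z)$ for all $x,y,z\in T$, and $\mu(x,y)+\mu(y,x)>0$ for all $x\ne y$; rational-valued means values in $\mathbb{Q}_+$. The problem $\overrightarrow{\mathbf{0}}\textbf{-Ext}[\mu]$: given a finite set $V\supseteq T$ and $c:V\times V\to\mathbb{Q}_+$, minimize $\sum_{(x,y)\in V\times V}c(x,y)\mu(\gamma(x),\gamma(y))$ over maps $\gamma:V\to T$ with $\gamma(t)=t$ for all $t\in T$. The underlying graph $H_\mu=(T,U)$ is the undirected graph whose edges are the unordered pairs $xy$ of distinct elements such that either $\mu(x,y)<\mu(x,z)+\mu(z,y)$ for all $z\in T\setminus\{x,y\}$, or $\mu(y,x)<\mu(y,z)+\mu(z,x)$ for all $z\in T\setminus\{x,y\}$. For $x,y\in T$, $I(x,y)=\{z\in T:\mu(x,y)=\mu(x,z)+\mu(z,y)\}$ and $R_\mu(x,y)=\mu(x,y)/\mu(y,x)$ (with $R_\mu(x,y)=\infty$ if $\mu(y,x)=0$). A pair of distinct $x,y\in T$ is a biased pair if either $R_\mu(x,z)>R_\mu(z,y)$ for every $z\in I(x,y)\cap I(y,x)\setminus\{x,y\}$, or $R_\mu(x,z)<R_\mu(z,y)$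 for every such $z$. A triple $(s_0,s_1,s_2)$ is non-collinear if $s_i\notin I(s_{i-1},s_{i+1})\cap I(s_{i+1},s_{i-1})$ for each $i\in\{0,1,2\}$ (indices mod 3), and a biased non-collinear triple if moreover $(s_i,s_j)$ is a biased pair for all $i\ne j$. *)

theory Defs
  imports
    Complex_Main
    "HOL-Library.Extended_Real"
    "HOL-Library.Log_Nat"
    "HOL-Computational_Algebra.Polynomial"
begin

section \<open>Directed metrics\<close>

definition directed_metric_on :: "'a set \<Rightarrow> ('a \<Rightarrow> 'a \<Rightarrow> real) \<Rightarrow> bool" where
  "directed_metric_on T \<mu> \<longleftrightarrow>
     (\<forall>x\<in>T. \<forall>y\<in>T. \<mu> x y \<ge> 0) \<and>
     (\<forall>x\<in>T. \<mu> x x = 0) \<and>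
     (\<forall>x\<in>T. \<forall>y\<in>T. \<forall>z\<in>T. \<mu> x y + \<mu> y z \<ge> \<mu> x z) \<and>
     (\<forall>x\<in>T. \<forall>y\<in>T. x \<noteq> y \<longrightarrow> \<mu> x y + \<mu> y x > 0)"

definition rational_valued_on :: "'a set \<Rightarrow> ('a \<Rightarrow> 'a \<Rightarrow> real) \<Rightarrow> bool" where
  "rational_valued_on T \<mu> \<longleftrightarrow> (\<forall>x\<in>T. \<forall>y\<in>T. \<mu> x y \<in> \<rat>)"

definition underlying_edges :: "'a set \<Rightarrow> ('a \<Rightarrow> 'a \<Rightarrow> real) \<Rightarrow> 'a set set" where
  "underlying_edges T \<mu> =
     {{x, y} | x y. x \<in> T \<and> y \<in> T \<and> x \<noteq> y \<and>
        ((\<forall>z\<in>T - {x, y}. \<mu> x y < \<mu> x z + \<mu> z y) \<or>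
         (\<forall>z\<in>T - {x, y}. \<mu> y x < \<mu> y z + \<mu> z x))}"

text \<open>The one-vertex graph counts as a (degenerate) star.\<close>

definition star_graph :: "'a set \<Rightarrow> 'a set set \<Rightarrow> bool" where
  "star_graph V U \<longleftrightarrow> (\<exists>s\<in>V. U = {{s, x} | x. x \<in> V - {s}})"

definition metric_interval :: "'a set \<Rightarrow> ('a \<Rightarrow> 'a \<Rightarrow> real) \<Rightarrow> 'a \<Rightarrow> 'a \<Rightarrow> 'a set" where
  "metric_interval T \<mu> x y = {z \<in> T. \<mu> x y = \<mu> x z + \<mu> z y}"

definition metric_ratio :: "('a \<Rightarrow> 'a \<Rightarrow> real) \<Rightarrow> 'a \<Rightarrow> 'a \<Rightarrow> ereal" where
  "metric_ratio \<mu> x y = (if \<mu> y x = 0 then \<infinity> else ereal (\<mu> x y / \<mu> y x))"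

definition biased_pair :: "'a set \<Rightarrow> ('a \<Rightarrow> 'a \<Rightarrow> real) \<Rightarrow> 'a \<Rightarrow> 'a \<Rightarrow> bool" where
  "biased_pair T \<mu> x y \<longleftrightarrow> x \<noteq> y \<and>
     ((\<forall>z\<in>(metric_interval T \<mu> x y \<inter> metric_interval T \<mu> y x) - {x, y}.
         metric_ratio \<mu> x z > metric_ratio \<mu> z y) \<or>
      (\<forall>z\<in>(metric_interval T \<mu> x y \<inter> metric_interval T \<mu> y x) - {x, y}.
         metric_ratio \<mu> x z < metric_ratio \<mu> z y))"

definition non_collinear :: "'a set \<Rightarrow> ('a \<Rightarrow> 'a \<Rightarrow> real) \<Rightarrow> 'a \<Rightarrow> 'a \<Rightarrow> 'a \<Rightarrow> bool" where
  "non_collinear T \<mu> s0 s1 s2 \<longleftrightarrow>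
     s0 \<notin> metric_interval T \<mu> s2 s1 \<inter> metric_interval T \<mu> s1 s2 \<and>
     s1 \<notin> metric_interval T \<mu> s0 s2 \<inter> metric_interval T \<mu> s2 s0 \<and>
     s2 \<notin> metric_interval T \<mu> s1 s0 \<inter> metric_interval T \<mu> s0 s1"

definition biased_non_collinear_triple ::
    "'a set \<Rightarrow> ('a \<Rightarrow> 'a \<Rightarrow> real) \<Rightarrow> 'a \<Rightarrow> 'a \<Rightarrow> 'a \<Rightarrow> bool" where
  "biased_non_collinear_triple T \<mu> s0 s1 s2 \<longleftrightarrow>
     s0 \<in> T \<and> s1 \<in> T \<and> s2 \<in> T \<and> non_collinear T \<mu> s0 s1 s2 \<and>
     biased_pair T \<mu> s0 s1 \<and> biased_pair T \<mu> s1 s0 \<and>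
     biased_pair T \<mu> s1 s2 \<and> biased_pair T \<mu> s2 s1 \<and>
     biased_pair T \<mu> s0 s2 \<and> biased_pair T \<mu> s2 s0"

section \<open>Polynomial time\<close>

text \<open>
  The machine model is the random access machine of Aho, Hopcroft and Ullman
  (The Design and Analysis of Computer Algorithms, Sections 1.2 and 1.3) under the
  logarithmic cost criterion, which is polynomially equivalent to Turing machines:
  register 0 is the accumulator, and executing an instruction costs the total bit
  length of the integers and register addresses involved in it. Only halting at
  \<open>HALT\<close> counts as a successful run; a machine that jumps out of
  its program, reads past the end of the input, or uses a negative indirect address
  or a literal as a target register is stuck.
\<close>

datatype operand = Lit int | Reg nat | Ind nat

datatype arith_op = ADD | SUB | MULT | DIV

datatype instr =
    LOAD operand
  | STORE operand
  | ARITH arith_op operand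
  | READ operand
  | WRITE operand
  | JUMP nat
  | JGTZ nat
  | JZERO nat
  | HALT

type_synonym mem = "nat \<Rightarrow> int"

text \<open>Program counter, registers, unread part of the input, output written so far.\<close>

type_synonym config = "nat \<times> mem \<times> int list \<times> int list"

text \<open>The bit length of the absolute value, with length 1 for the integer 0.\<close>

definition int_len :: "int \<Rightarrow> nat" where
  "int_len i = max 1 (floorlog 2 (nat \<bar>i\<bar>))"

abbreviation nat_len :: "nat \<Rightarrow> nat" where
  "nat_len i \<equiv> int_len (int i)"

fun operand_loc :: "mem \<Rightarrow> operand \<Rightarrow> nat option" where
  "operand_loc M (Lit k) = None"
| "operand_loc M (Reg i) = Some i"
| "operand_loc M (Ind i) = (if M i \<ge> 0 then Some (nat (M i)) else None)"

fun operand_val :: "mem \<Rightarrow> operand \<Rightarrow> int option" where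
  "operand_val M (Lit k) = Some k"
| "operand_val M a = map_option M (operand_loc M a)"

fun loc_cost :: "mem \<Rightarrow> operand \<Rightarrow> nat" where
  "loc_cost M (Lit k) = 0"
| "loc_cost M (Reg i) = nat_len i"
| "loc_cost M (Ind i) = nat_len i + int_len (M i)"

fun val_cost :: "mem \<Rightarrow> operand \<Rightarrow> nat" where
  "val_cost M (Lit k) = int_len k"
| "val_cost M (Reg i) = nat_len i + int_len (M i)"
| "val_cost M (Ind i) = nat_len i + int_len (M i) + int_len (M (nat (M i)))"

text \<open>\<open>DIV\<close> rounds downwards, and division by 0 yields 0.\<close>

fun arith :: "arith_op \<Rightarrow> int \<Rightarrow> int \<Rightarrow> int" where
  "arith ADD x y = x + y"
| "arith SUB x y = x - y"
| "arith MULT x y = x * y"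
| "arith DIV x y = x div y"

inductive ram_step :: "instr list \<Rightarrow> config \<Rightarrow> nat \<Rightarrow> config \<Rightarrow> bool" for P where
  Load: "\<lbrakk>pc < length P; P ! pc = LOAD a; operand_val M a = Some v\<rbrakk> \<Longrightarrow>
    ram_step P (pc, M, xs, ys) (val_cost M a) (Suc pc, M(0 := v), xs, ys)"
| Store: "\<lbrakk>pc < length P; P ! pc = STORE a; operand_loc M a = Some i\<rbrakk> \<Longrightarrow>
    ram_step P (pc, M, xs, ys) (int_len (M 0) + loc_cost M a) (Suc pc, M(i := M 0), xs, ys)"
| Arith: "\<lbrakk>pc < length P; P ! pc = ARITH f a; operand_val M a = Some v\<rbrakk> \<Longrightarrow>
    ram_step P (pc, M, xs, ys) (int_len (M 0) + val_cost M a)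
      (Suc pc, M(0 := arith f (M 0) v), xs, ys)"
| Read: "\<lbrakk>pc < length P; P ! pc = READ a; operand_loc M a = Some i\<rbrakk> \<Longrightarrow>
    ram_step P (pc, M, x # xs, ys) (int_len x + loc_cost M a) (Suc pc, M(i := x), xs, ys)"
| Write: "\<lbrakk>pc < length P; P ! pc = WRITE a; operand_val M a = Some v\<rbrakk> \<Longrightarrow>
    ram_step P (pc, M, xs, ys) (val_cost M a) (Suc pc, M, xs, ys @ [v])"
| Jump: "\<lbrakk>pc < length P; P ! pc = JUMP j\<rbrakk> \<Longrightarrow>
    ram_step P (pc, M, xs, ys) 1 (j, M, xs, ys)"
| Jgtz: "\<lbrakk>pc < length P; P ! pc = JGTZ j\<rbrakk> \<Longrightarrow>
    ram_step P (pc, M, xs, ys) (int_len (M 0)) (if M 0 > 0 then j else Suc pc, M, xs, ys)"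
| Jzero: "\<lbrakk>pc < length P; P ! pc = JZERO j\<rbrakk> \<Longrightarrow>
    ram_step P (pc, M, xs, ys) (int_len (M 0)) (if M 0 = 0 then j else Suc pc, M, xs, ys)"

inductive ram_run :: "instr list \<Rightarrow> config \<Rightarrow> nat \<Rightarrow> int list \<Rightarrow> bool" for P where
  Halt: "\<lbrakk>pc < length P; P ! pc = HALT\<rbrakk> \<Longrightarrow> ram_run P (pc, M, xs, ys) 1 ys"
| Step: "\<lbrakk>ram_step P cf t cf'; ram_run P cf' t' zs\<rbrakk> \<Longrightarrow> ram_run P cf (t + t') zs"

lemma ram_step_deterministic:
  assumes "ram_step P cf t cf'" "ram_step P cf u cf''"
  shows "t = u \<and> cf' = cf''"
  using assms by (cases rule: ram_step.cases) (auto elim: ram_step.cases)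

lemma ram_run_deterministic:
  assumes "ram_run P cf t ys" "ram_run P cf u zs"
  shows "t = u \<and> ys = zs"
  using assms
proof (induction arbitrary: u zs rule: ram_run.induct)
  case (Halt pc M xs ys)
  from Halt.prems show ?case
  proof cases
    case Halt
    then show ?thesis by simp
  next
    case (Step s cf' s')
    with Halt.hyps show ?thesis by (auto elim: ram_step.cases)
  qed
next
  case (Step cf t cf' t' ys)
  from Step.prems show ?case
  proof cases
    case Halt
    with Step.hyps show ?thesis by (auto elim: ram_step.cases)
  next
    case (Step s cf'' s')
    with ram_step_deterministic[OF Step.hyps(1)] Step.IH show ?thesis by blast
  qed
qed

definition input_size :: "int list \<Rightarrow> nat" where
  "input_size xs = sum_list (map int_len xs)"

text \<open>
  A search problem is given by its set of instances, an encoding of the instances as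
  input tapes, and the relation telling which output tapes are correct answers.
\<close>

definition poly_time_solvable ::
    "'i set \<Rightarrow> ('i \<Rightarrow> int list) \<Rightarrow> ('i \<Rightarrow> int list \<Rightarrow> bool) \<Rightarrow> bool" where
  "poly_time_solvable Inst enc sol \<longleftrightarrow>
     (\<exists>(P :: instr list) (p :: nat poly). \<forall>i\<in>Inst. \<exists>t ys.
        ram_run P (0, \<lambda>_. 0, enc i, []) t ys \<and>
        t \<le> poly p (input_size (enc i)) \<and> sol i ys)"

section \<open>The directed minimum 0-extension problem\<close>

text \<open>
  The vertices of an instance are the terminals, tagged with \<open>Inl\<close>,
  and \<open>n\<close> further vertices numbered from 0 and tagged with
  \<open>Inr\<close>. Up to naming, every finite superset of the terminals is of
  this form, even if the type of the terminals is finite.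
\<close>

type_synonym 'a cost_fun = "'a + nat \<Rightarrow> 'a + nat \<Rightarrow> rat"

definition vertex_set :: "'a set \<Rightarrow> nat \<Rightarrow> ('a + nat) set" where
  "vertex_set T n = Inl ` T \<union> Inr ` {..<n}"

definition zero_ext_instances :: "'a set \<Rightarrow> (nat \<times> 'a cost_fun) set" where
  "zero_ext_instances T =
     {(n, c). \<forall>x\<in>vertex_set T n. \<forall>y\<in>vertex_set T n. c x y \<ge> 0}"

definition zero_ext_feasible :: "'a set \<Rightarrow> nat \<Rightarrow> ('a + nat \<Rightarrow> 'a) \<Rightarrow> bool" where
  "zero_ext_feasible T n \<gamma> \<longleftrightarrow>
     (\<forall>v\<in>vertex_set T n. \<gamma> v \<in> T) \<and> (\<forall>t\<in>T. \<gamma> (Inl t) = t)"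

definition zero_ext_cost ::
    "'a set \<Rightarrow> ('a \<Rightarrow> 'a \<Rightarrow> real) \<Rightarrow> nat \<times> 'a cost_fun \<Rightarrow> ('a + nat \<Rightarrow> 'a) \<Rightarrow> real" where
  "zero_ext_cost T \<mu> = (\<lambda>(n, c) \<gamma>.
     \<Sum>(x, y)\<in>vertex_set T n \<times> vertex_set T n. of_rat (c x y) * \<mu> (\<gamma> x) (\<gamma> y))"

definition zero_ext_optimal ::
    "'a set \<Rightarrow> ('a \<Rightarrow> 'a \<Rightarrow> real) \<Rightarrow> nat \<times> 'a cost_fun \<Rightarrow> ('a + nat \<Rightarrow> 'a) \<Rightarrow> bool" where
  "zero_ext_optimal T \<mu> I \<gamma> \<longleftrightarrow>
     zero_ext_feasible T (fst I) \<gamma> \<and>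
     (\<forall>\<gamma>'. zero_ext_feasible T (fst I) \<gamma>' \<longrightarrow> zero_ext_cost T \<mu> I \<gamma> \<le> zero_ext_cost T \<mu> I \<gamma>')"

text \<open>
  Tapes depend on an enumeration \<open>ts\<close> of the terminals. The input is
  \<open>n\<close> followed by the cost matrix in row-major order, each entry written as
  numerator and positive denominator in lowest terms. The output lists, for each
  vertex in turn, the index in \<open>ts\<close> of its image.
\<close>

definition vertex_list :: "'a list \<Rightarrow> nat \<Rightarrow> ('a + nat) list" where
  "vertex_list ts n = map Inl ts @ map Inr [0..<n]"

definition encode_rat :: "rat \<Rightarrow> int list" where
  "encode_rat q = [fst (quotient_of q), snd (quotient_of q)]"

definition encode_instance :: "'a list \<Rightarrow> nat \<times> 'a cost_fun \<Rightarrow> int list" where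
  "encode_instance ts = (\<lambda>(n, c).
     int n # concat (map (\<lambda>(x, y). encode_rat (c x y))
                         (List.product (vertex_list ts n) (vertex_list ts n))))"

definition encodes_map :: "'a list \<Rightarrow> nat \<Rightarrow> ('a + nat \<Rightarrow> 'a) \<Rightarrow> int list \<Rightarrow> bool" where
  "encodes_map ts n \<gamma> ys \<longleftrightarrow>
     list_all2 (\<lambda>v y. \<exists>i<length ts. y = int i \<and> \<gamma> v = ts ! i) (vertex_list ts n) ys"

text \<open>
  The metric is fixed, not part of the input, so the program and the polynomial may
  depend on it. Which enumeration of the terminals is used is immaterial; we ask for
  a program for each one.
\<close>

definition zero_ext_poly_time :: "'a set \<Rightarrow> ('a \<Rightarrow> 'a \<Rightarrow> real) \<Rightarrow> bool" where
  "zero_ext_poly_time T \<mu> \<longleftrightarrow>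
     (\<forall>ts. distinct ts \<and> set ts = T \<longrightarrow>
        poly_time_solvable (zero_ext_instances T) (encode_instance ts)
          (\<lambda>I ys. \<exists>\<gamma>. zero_ext_optimal T \<mu> I \<gamma> \<and> encodes_map ts (fst I) \<gamma> ys))"

end

theory Submission
  imports Defs "HOL-Library.Nat_Bijection" "HOL-Library.Countable"
begin

text \<open>
  If the underlying graph is a star with center \<open>s\<close>, then \<open>\<mu> x y = a x + b y\<close> for distinct
  \<open>x\<close> and \<open>y\<close>, where \<open>a x = \<mu> x s\<close> and \<open>b x = \<mu> s x\<close>, so the cost of a solution is the sum over the
  leaves \<open>l\<close> of the weighted directed cuts \<open>a l * d\<^sup>+(V l) + b l * d\<^sup>-(V l)\<close>, where \<open>V l\<close> is the set
  of vertices mapped to \<open>l\<close>. A pair of leaves is unbiased iff \<open>a l * a m = b l * b m\<close>, and any three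
  leaves contain an unbiased pair, so the leaves split into two sides such that all pairs inside
  a side are unbiased. Relax the problem by requiring disjointness of \<open>V l\<close> and
  \<open>V m\<close> only across the sides. Complementing the sets of one side turns the relaxation into a
  single minimum cut problem. For an unbiased pair, the two weighted cuts are
  posi-modular up to scaling, so subtracting \<open>V m\<close> from \<open>V l\<close> in an optimal solution of the relaxation
  keeps it optimal, and overlaps inside a side can be removed.

  The minimum cut is found by unit augmentations along residual paths, scaling the capacities
  bit by bit. Multiplications only occur with one factor of at most \<open>b\<close> bits, where \<open>b\<close> is linear in
  the input size. Hence every instruction lengthens the registers by at most \<open>b\<close> bits, and a
  polynomial number of steps already implies polynomial logarithmic cost.
\<close>
section \<open>A while language and its compilation\<close>

text \<open>The relaxation drops exactly the constraints that a cut cannot express. If two sets are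
  read off from a cut in opposite orientations, a common vertex appears as an arc leaving the source
  side, and a capacity above the sum of all other weights forbids it; in equal orientations a common
  vertex is not an arc of the cut. So overlaps inside a side must be harmless by themselves. With
  \<open>r x = a x / (a x + b x)\<close> a pair of leaves is unbiased iff
  \<open>r x + r y = 1\<close>, which turns the splitting into two sides into a statement about real
  numbers. The running time hides a circle: the number of scaling phases depends on the length of
  the capacities, but register lengths are bounded only through the number of steps. It is broken by
  regarding \<open>front\<close>, which computes the capacities in a number of iterations
  independent of them, as a program of its own. The bound on its registers then limits the phases of
  the rest.\<close>

datatype scal = Sn | Snv | SN | SD | Su | Sv | Sl | Sm | Sx | Sy | SZ | Sinf | Spow | SP
  | Si | Sp | Sq | Sa | Sj | St | Ss | Scnt

datatype arr = Num | Den | Nd | Wt | Res | Lab | Par | Al | Be | Cr | Ty | Lf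

instance scal :: countable
  by countable_datatype

fun arr_id :: "arr \<Rightarrow> nat" where
  "arr_id Num = 2" | "arr_id Den = 3" | "arr_id Nd = 4" | "arr_id Wt = 5" | "arr_id Res = 6"
| "arr_id Lab = 7" | "arr_id Par = 8" | "arr_id Al = 9" | "arr_id Be = 10" | "arr_id Cr = 11"
| "arr_id Ty = 12" | "arr_id Lf = 13"

lemma arr_id_inject [simp]: "arr_id a = arr_id b \<longleftrightarrow> a = b"
  by (cases a; cases b) simp_all

lemma arr_id_bounds: "2 \<le> arr_id a" "arr_id a < 16"
  by (cases a; simp)+

record state =
  sc :: "scal \<Rightarrow> int"
  ar :: "arr \<Rightarrow> nat \<Rightarrow> nat \<Rightarrow> int"
  inp :: "int list"
  outp :: "int list"

datatype exp = Cst int | V scal | Ix arr exp exp | Op arith_op exp exp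

abbreviation Plus (infixl "\<^bold>+" 65) where "Plus \<equiv> Op ADD"
abbreviation Minus (infixl "\<^bold>-" 65) where "Minus \<equiv> Op SUB"
abbreviation Times (infixl "\<^bold>*" 70) where "Times \<equiv> Op MULT"
abbreviation Quot (infixl "\<^bold>div" 70) where "Quot \<equiv> Op DIV"

fun ev :: "exp \<Rightarrow> state \<Rightarrow> int" where
  "ev (Cst k) s = k"
| "ev (V x) s = sc s x"
| "ev (Ix a e1 e2) s = ar s a (nat (ev e1 s)) (nat (ev e2 s))"
| "ev (Op f e1 e2) s = arith f (ev e1 s) (ev e2 s)"

text \<open>Array dimensions depend on the input, so addresses use the Cantor pairing. Its
  triangular number is computed as a product with right factor \<open>p + q\<close>, hence the bound
  on the sum.\<close>

definition ok_index :: "nat \<Rightarrow> int \<Rightarrow> int \<Rightarrow> bool" where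
  "ok_index b p q \<longleftrightarrow> 0 \<le> p \<and> 0 \<le> q \<and> p + q \<le> 2 ^ b"

text \<open>Only the right factor of a product is bounded. The left one is in the accumulator and
  may be as long as any number computed so far.\<close>

fun ok :: "nat \<Rightarrow> exp \<Rightarrow> state \<Rightarrow> bool" where
  "ok b (Cst k) s = True"
| "ok b (V x) s = True"
| "ok b (Ix a e1 e2) s = (ok b e1 s \<and> ok b e2 s \<and> ok_index b (ev e1 s) (ev e2 s))"
| "ok b (Op f e1 e2) s =
    (ok b e1 s \<and> ok b e2 s \<and> (f = MULT \<longrightarrow> \<bar>ev e2 s\<bar> \<le> 2 ^ b))"

datatype com =
    Skip
  | Asg scal exp
  | Put arr exp exp exp
  | Rd scal
  | Wr exp
  | Seq com com (infixr ";;" 60)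
  | IfP exp com com
  | Wh exp com

abbreviation set_sc :: "scal \<Rightarrow> int \<Rightarrow> state \<Rightarrow> state" where
  "set_sc x v s \<equiv> s\<lparr>sc := (sc s)(x := v)\<rparr>"

type_synonym matrix = "nat \<Rightarrow> nat \<Rightarrow> int"

definition upd2 :: "matrix \<Rightarrow> nat \<Rightarrow> nat \<Rightarrow> int \<Rightarrow> nat \<Rightarrow> nat \<Rightarrow> int" where
  "upd2 f p q v = (\<lambda>p' q'. if p' = p \<and> q' = q then v else f p' q')"

abbreviation set_ar :: "arr \<Rightarrow> nat \<Rightarrow> nat \<Rightarrow> int \<Rightarrow> state \<Rightarrow> state" where
  "set_ar a p q v s \<equiv> s\<lparr>ar := (ar s)(a := upd2 (ar s a) p q v)\<rparr>"

text \<open>Only loop iterations are counted: the compiled code of a loop body is run through at most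
  once between two of them.\<close>

inductive exec :: "nat \<Rightarrow> com \<Rightarrow> state \<Rightarrow> nat \<Rightarrow> state \<Rightarrow> bool" for b where
  Skip: "exec b Skip s 0 s"
| Asg: "ok b e s \<Longrightarrow> exec b (Asg x e) s 0 (set_sc x (ev e s) s)"
| Put: "\<lbrakk>ok b e1 s; ok b e2 s; ok b e s; ok_index b (ev e1 s) (ev e2 s)\<rbrakk> \<Longrightarrow>
    exec b (Put a e1 e2 e) s 0 (set_ar a (nat (ev e1 s)) (nat (ev e2 s)) (ev e s) s)"
| Rd: "inp s = v # xs \<Longrightarrow> exec b (Rd x) s 0 (set_sc x v s\<lparr>inp := xs\<rparr>)"
| Wr: "ok b e s \<Longrightarrow> exec b (Wr e) s 0 (s\<lparr>outp := outp s @ [ev e s]\<rparr>)"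
| Seq: "\<lbrakk>exec b c s m s'; exec b d s' n s''\<rbrakk> \<Longrightarrow> exec b (c ;; d) s (m + n) s''"
| IfT: "\<lbrakk>ok b e s; ev e s > 0; exec b c s n s'\<rbrakk> \<Longrightarrow> exec b (IfP e c d) s n s'"
| IfF: "\<lbrakk>ok b e s; \<not> ev e s > 0; exec b d s n s'\<rbrakk> \<Longrightarrow> exec b (IfP e c d) s n s'"
| WhT: "\<lbrakk>ok b e s; ev e s > 0; exec b c s m s'; exec b (Wh e c) s' n s''\<rbrakk> \<Longrightarrow>
    exec b (Wh e c) s (Suc (m + n)) s''"
| WhF: "\<lbrakk>ok b e s; \<not> ev e s > 0\<rbrakk> \<Longrightarrow> exec b (Wh e c) s 0 s"

inductive_cases exec_SkipE: "exec b Skip s n s'"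
inductive_cases exec_AsgE: "exec b (Asg x e) s n s'"
inductive_cases exec_PutE: "exec b (Put a e1 e2 e) s n s'"
inductive_cases exec_RdE: "exec b (Rd x) s n s'"
inductive_cases exec_WrE: "exec b (Wr e) s n s'"
inductive_cases exec_SeqE: "exec b (c ;; d) s n s'"
inductive_cases exec_IfE: "exec b (IfP e c d) s n s'"
inductive_cases exec_WhE: "exec b (Wh e c) s n s'"

text \<open>Memory layout: registers divisible by 16 are the accumulator and the scratch registers,
  registers congruent to 1 hold the scalars, and the other residues hold one array each.\<close>

definition scratch :: "nat \<Rightarrow> nat" where "scratch d = 16 * Suc d"
definition sc_reg :: "scal \<Rightarrow> nat" where "sc_reg x = 16 * to_nat x + 1"
definition ar_reg :: "arr \<Rightarrow> nat \<Rightarrow> nat \<Rightarrow> nat" where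
  "ar_reg a p q = 16 * prod_encode (p, q) + arr_id a"

lemma mod16: "(16 * m + i) mod 16 = i" "(16 * m + i) div 16 = m" if "i < 16" for i m :: nat
  using that by simp_all

lemma sc_reg_mod [simp]: "sc_reg x mod 16 = 1"
  and scratch_mod [simp]: "scratch d mod 16 = 0"
  and ar_reg_mod [simp]: "ar_reg a p q mod 16 = arr_id a"
  unfolding sc_reg_def scratch_def ar_reg_def using arr_id_bounds(2)[of a]
  by (simp_all add: mod16)

lemma sc_reg_inject [simp]: "sc_reg x = sc_reg y \<longleftrightarrow> x = y"
  by (simp add: sc_reg_def)

lemma scratch_inject [simp]: "scratch d = scratch e \<longleftrightarrow> d = e"
  by (simp add: scratch_def)

lemma ar_reg_inject [simp]: "ar_reg a p q = ar_reg b p' q' \<longleftrightarrow> a = b \<and> p = p' \<and> q = q'"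
proof
  assume *: "ar_reg a p q = ar_reg b p' q'"
  then have "arr_id a = arr_id b" by (metis ar_reg_mod)
  with * show "a = b \<and> p = p' \<and> q = q'" by (simp add: ar_reg_def)
qed simp

lemma reg_distinct [simp]:
  "scratch d \<noteq> 0" "sc_reg x \<noteq> 0" "ar_reg a p q \<noteq> 0"
  "0 \<noteq> scratch d" "0 \<noteq> sc_reg x" "0 \<noteq> ar_reg a p q"
  "sc_reg x \<noteq> scratch d" "scratch d \<noteq> sc_reg x"
  "ar_reg a p q \<noteq> scratch d" "scratch d \<noteq> ar_reg a p q"
  "ar_reg a p q \<noteq> sc_reg x" "sc_reg x \<noteq> ar_reg a p q"
proof -
  show *: "scratch d \<noteq> 0" "sc_reg x \<noteq> 0" "ar_reg a p q \<noteq> 0"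
    using arr_id_bounds(1)[of a] by (simp_all add: scratch_def sc_reg_def ar_reg_def)
  then show "0 \<noteq> scratch d" "0 \<noteq> sc_reg x" "0 \<noteq> ar_reg a p q" by metis+
  show **: "sc_reg x \<noteq> scratch d" "ar_reg a p q \<noteq> scratch d" "ar_reg a p q \<noteq> sc_reg x"
    using arr_id_bounds(1)[of a] sc_reg_mod[of x] scratch_mod[of d] ar_reg_mod[of a p q]
    by (metis zero_neq_one, metis not_numeral_le_zero, metis Suc_1 not_less_eq_eq order_refl)
  then show "scratch d \<noteq> sc_reg x" "scratch d \<noteq> ar_reg a p q" "sc_reg x \<noteq> ar_reg a p q" by metis+
qed

definition rel :: "state \<Rightarrow> mem \<Rightarrow> bool" where
  "rel s M \<longleftrightarrow> (\<forall>x. M (sc_reg x) = sc s x) \<and> (\<forall>a p q. M (ar_reg a p q) = ar s a p q)"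

text \<open>Expects the row in \<open>scratch d\<close> and the column in the accumulator, and
  leaves the address in \<open>scratch d\<close>, where indirect addressing finds it. Meanwhile
  \<open>scratch (Suc d)\<close> holds the sum of the two indices.\<close>

definition index_code :: "arr \<Rightarrow> nat \<Rightarrow> instr list" where
  "index_code a d = [ARITH ADD (Reg (scratch d)), STORE (Reg (scratch (Suc d))),
     ARITH ADD (Lit 1), ARITH MULT (Reg (scratch (Suc d))), ARITH DIV (Lit 2),
     ARITH ADD (Reg (scratch d)), ARITH MULT (Lit 16), ARITH ADD (Lit (int (arr_id a))),
     STORE (Reg (scratch d))]"

text \<open>The scratch registers form a stack: code at depth \<open>d\<close> leaves those below
  \<open>d\<close> alone. \<open>Op\<close> evaluates its right operand first, because machine
  arithmetic takes the left operand from the accumulator.\<close>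

fun cexp :: "exp \<Rightarrow> nat \<Rightarrow> instr list" where
  "cexp (Cst k) d = [LOAD (Lit k)]"
| "cexp (V x) d = [LOAD (Reg (sc_reg x))]"
| "cexp (Ix a e1 e2) d = cexp e1 d @ [STORE (Reg (scratch d))] @ cexp e2 (Suc d) @ index_code a d
     @ [LOAD (Ind (scratch d))]"
| "cexp (Op f e1 e2) d = cexp e2 d @ [STORE (Reg (scratch d))] @ cexp e1 (Suc d)
     @ [ARITH f (Reg (scratch d))]"

text \<open>Code lengths do not depend on the position of the code, so jump targets can point beyond
  code that is still to be generated.\<close>

fun clen :: "com \<Rightarrow> nat" where
  "clen Skip = 0"
| "clen (Asg x e) = length (cexp e 0) + 1"
| "clen (Put a e1 e2 e) = length (cexp e1 0) + length (cexp e2 1) + length (cexp e 1) + 11"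
| "clen (Rd x) = 1"
| "clen (Wr e) = length (cexp e 0) + 1"
| "clen (c ;; d) = clen c + clen d"
| "clen (IfP e c d) = length (cexp e 0) + clen c + clen d + 2"
| "clen (Wh e c) = length (cexp e 0) + clen c + 3"

text \<open>The else branch precedes the then branch, since \<open>JGTZ\<close> falls through when
  the test fails.\<close>

fun comp :: "com \<Rightarrow> nat \<Rightarrow> instr list" where
  "comp Skip pc = []"
| "comp (Asg x e) pc = cexp e 0 @ [STORE (Reg (sc_reg x))]"
| "comp (Put a e1 e2 e) pc = cexp e1 0 @ [STORE (Reg (scratch 0))] @ cexp e2 1 @ index_code a 0
     @ cexp e 1 @ [STORE (Ind (scratch 0))]"
| "comp (Rd x) pc = [READ (Reg (sc_reg x))]"
| "comp (Wr e) pc = cexp e 0 @ [WRITE (Reg 0)]"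
| "comp (c ;; d) pc = comp c pc @ comp d (pc + clen c)"
| "comp (IfP e c d) pc = (let l = length (cexp e 0) in
     cexp e 0 @ [JGTZ (pc + l + clen d + 2)] @ comp d (pc + l + 1)
     @ [JUMP (pc + l + clen d + clen c + 2)] @ comp c (pc + l + clen d + 2))"
| "comp (Wh e c) pc = (let l = length (cexp e 0) in
     cexp e 0 @ [JGTZ (pc + l + 2), JUMP (pc + l + clen c + 3)] @ comp c (pc + l + 2) @ [JUMP pc])"

lemma length_comp [simp]: "length (comp c pc) = clen c"
  by (induction c arbitrary: pc) (simp_all add: Let_def index_code_def)

section \<open>Execution of compiled code on the machine\<close>

definition code_at :: "instr list \<Rightarrow> nat \<Rightarrow> instr list \<Rightarrow> bool" where
  "code_at P pc is \<longleftrightarrow> (\<forall>i<length is. pc + i < length P \<and> P ! (pc + i) = is ! i)"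

lemma code_at_Nil [simp]: "code_at P pc []"
  by (simp add: code_at_def)

lemma code_at_Cons [simp]:
  "code_at P pc (i # is) \<longleftrightarrow> pc < length P \<and> P ! pc = i \<and> code_at P (Suc pc) is"
  unfolding code_at_def by (auto simp: less_Suc_eq_0_disj)

lemma code_at_append [simp]:
  "code_at P pc (is @ js) \<longleftrightarrow> code_at P pc is \<and> code_at P (pc + length is) js"
  by (induction "is" arbitrary: pc) auto

text \<open>Among the arithmetic operations only a product can lengthen a number by more than one
  bit; the guard limits this growth to \<open>b\<close> bits.\<close>

definition guarded :: "nat \<Rightarrow> instr \<Rightarrow> mem \<Rightarrow> bool" where
  "guarded b i M \<longleftrightarrow> (\<forall>a v. i = ARITH MULT a \<longrightarrow> operand_val M a = Some v \<longrightarrow> \<bar>v\<bar> \<le> 2 ^ b)"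

text \<open>Steps are appended at the end and their costs are dropped: register sizes are bounded
  later by following the run forward from the initial memory, and the costs are read off from the
  sizes.\<close>

inductive steps :: "instr list \<Rightarrow> nat \<Rightarrow> nat \<Rightarrow> config \<Rightarrow> config \<Rightarrow> bool" for P b where
  none: "steps P b 0 cf cf"
| step: "\<lbrakk>steps P b m cf (pc, M, xs, ys); guarded b (P ! pc) M; ram_step P (pc, M, xs, ys) t cf'\<rbrakk> \<Longrightarrow>
    steps P b (Suc m) cf cf'"

lemma steps_trans:
  assumes "steps P b m cf cf'" "steps P b n cf' cf''"
  shows "steps P b (m + n) cf cf''"
  using assms(2,1) by (induction rule: steps.induct) (auto intro: steps.step)

lemma steps_one:
  "guarded b (P ! pc) M \<Longrightarrow> ram_step P (pc, M, xs, ys) t cf' \<Longrightarrow> steps P b 1 (pc, M, xs, ys) cf'"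
  using steps.step[OF steps.none] by fastforce

lemma steps_jgtz:
  "pc < length P \<Longrightarrow> P ! pc = JGTZ j \<Longrightarrow>
    steps P b 1 (pc, M, xs, ys) (if M 0 > 0 then j else Suc pc, M, xs, ys)"
  by (rule steps_one[OF _ ram_step.Jgtz]) (auto simp: guarded_def)

lemma steps_jump:
  "pc < length P \<Longrightarrow> P ! pc = JUMP j \<Longrightarrow> steps P b 1 (pc, M, xs, ys) (j, M, xs, ys)"
  by (rule steps_one[OF _ ram_step.Jump]) (auto simp: guarded_def)

text \<open>Symbolic execution of jump-free code, which lets the simplifier run compiled
  expressions. An unguarded multiplication counts as failure.\<close>

fun straight :: "nat \<Rightarrow> instr list \<Rightarrow> mem \<Rightarrow> mem option" where
  "straight b [] M = Some M"
| "straight b (LOAD a # is) M = Option.bind (operand_val M a) (\<lambda>v. straight b is (M(0 := v)))"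
| "straight b (STORE a # is) M = Option.bind (operand_loc M a) (\<lambda>i. straight b is (M(i := M 0)))"
| "straight b (ARITH f a # is) M = Option.bind (operand_val M a)
     (\<lambda>v. if f = MULT \<and> \<bar>v\<bar> > 2 ^ b then None else straight b is (M(0 := arith f (M 0) v)))"
| "straight b (_ # is) M = None"

lemma straight_append:
  "straight b (is @ js) M = Option.bind (straight b is M) (straight b js)"
  by (induction b "is" M rule: straight.induct) (simp_all del: fun_upd_apply add: Option.bind_assoc cong: if_cong, auto simp del: fun_upd_apply intro!: Option.bind_cong)

lemma steps_straight:
  assumes "straight b is M = Some M'" "code_at P pc is"
  shows "steps P b (length is) (pc, M, xs, ys) (pc + length is, M', xs, ys)"
  using assms
proof (induction b "is" M arbitrary: pc rule: straight.induct)
  case (1 b M)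
  then show ?case by (simp add: steps.none)
next
  case (2 b a "is" M)
  then obtain v where v: "operand_val M a = Some v" "straight b is (M(0 := v)) = Some M'"
    by (auto simp: bind_eq_Some_conv)
  have "steps P b 1 (pc, M, xs, ys) (Suc pc, M(0 := v), xs, ys)"
    using 2 v by (intro steps_one) (auto simp: guarded_def intro: ram_step.Load)
  from steps_trans[OF this 2(1)[OF v]] 2 show ?case by simp
next
  case (3 b a "is" M)
  then obtain v where v: "operand_loc M a = Some v" "straight b is (M(v := M 0)) = Some M'"
    by (auto simp: bind_eq_Some_conv)
  have "steps P b 1 (pc, M, xs, ys) (Suc pc, M(v := M 0), xs, ys)"
    using 3 v by (intro steps_one) (auto simp: guarded_def intro: ram_step.Store)
  from steps_trans[OF this 3(1)[OF v]] 3 show ?case by simp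
next
  case (4 b f a "is" M)
  then obtain v where v: "operand_val M a = Some v" "\<not> (f = MULT \<and> \<bar>v\<bar> > 2 ^ b)"
      "straight b is (M(0 := arith f (M 0) v)) = Some M'"
    by (auto simp: bind_eq_Some_conv split: if_splits)
  have "steps P b 1 (pc, M, xs, ys) (Suc pc, M(0 := arith f (M 0) v), xs, ys)"
    using 4 v by (intro steps_one) (auto simp: guarded_def intro: ram_step.Arith)
  from steps_trans[OF this 4(1)[OF v]] 4 show ?case by simp
qed simp_all

lemma rel_upd [simp]:
  "rel s (M(0 := v)) = rel s M" "rel s (M(scratch d := v)) = rel s M"
  by (simp_all add: rel_def)

lemma straight_index:
  assumes "ok_index b p q" "M (scratch d) = p" "M 0 = q" "4 \<le> b"
  shows "\<exists>M'. straight b (index_code a d) M = Some M' \<and>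
    M' (scratch d) = int (ar_reg a (nat p) (nat q)) \<and> (\<forall>s. rel s M' = rel s M) \<and>
    (\<forall>i<d. M' (scratch i) = M (scratch i))"
proof -
  have p: "0 \<le> p" "0 \<le> q" "p + q \<le> 2 ^ b" using assms by (auto simp: ok_index_def)
  \<comment> \<open>\<open>4 \<le> b\<close> is what the multiplication by the literal 16 needs in
    order to be guarded.\<close>
  have b: "(16::int) \<le> 2 ^ b"
    using power_increasing[OF assms(4), of "2::int"] by simp
  define k where "k = nat p + nat q"
  have k: "q + p = int k" using p by (simp add: k_def)
  have "(q + p + 1) * (q + p) div 2 = int (triangle k)"
    unfolding k triangle_def by (simp add: zdiv_int algebra_simps)
  then have enc: "(q + p + 1) * (q + p) div 2 + p = int (prod_encode (nat p, nat q))"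
    using p by (simp add: prod_encode_def k_def)
  then have addr: "((q + p + 1) * (q + p) div 2 + p) * 16 + int (arr_id a) = int (ar_reg a (nat p) (nat q))"
    (is "?addr = _") by (simp add: ar_reg_def)
  have "straight b (index_code a d) M =
      Some (M(scratch (Suc d) := q + p, 0 := ?addr, scratch d := ?addr))"
    using assms p b unfolding index_code_def by (simp add: fun_upd_twist add.commute)
  then show ?thesis
    unfolding addr by auto
qed

lemma straight_cexp:
  assumes "ok b e s" "rel s M" "4 \<le> b"
  shows "\<exists>M'. straight b (cexp e d) M = Some M' \<and> M' 0 = ev e s \<and> rel s M' \<and>
    (\<forall>i<d. M' (scratch i) = M (scratch i))"
  using assms
proof (induction e arbitrary: d M)
  case (Cst k)
  then show ?case by simp
next
  case (V x)
  then show ?case by (simp add: rel_def)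
next
  case (Ix a e1 e2)
  from Ix.prems have "ok b e1 s" by simp
  from Ix.IH(1)[OF this Ix.prems(2,3)] obtain M1 where
    M1: "straight b (cexp e1 d) M = Some M1" "M1 0 = ev e1 s" "rel s M1"
      "\<forall>i<d. M1 (scratch i) = M (scratch i)" by blast
  have "ok b e2 s" "rel s (M1(scratch d := M1 0))" using Ix M1 by simp_all
  from Ix.IH(2)[OF this Ix.prems(3)] obtain M2 where
    M2: "straight b (cexp e2 (Suc d)) (M1(scratch d := M1 0)) = Some M2" "M2 0 = ev e2 s"
      "rel s M2" "\<forall>i<Suc d. M2 (scratch i) = (M1(scratch d := M1 0)) (scratch i)" by metis
  have "ok_index b (ev e1 s) (ev e2 s)" "M2 (scratch d) = ev e1 s" using Ix M1 M2 by auto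
  from straight_index[OF this M2(2) Ix.prems(3)] obtain M3 where
    M3: "straight b (index_code a d) M2 = Some M3"
      "M3 (scratch d) = int (ar_reg a (nat (ev e1 s)) (nat (ev e2 s)))" "rel s M3 = rel s M2"
      "\<forall>i<d. M3 (scratch i) = M2 (scratch i)" by metis
  have "M3 (ar_reg a (nat (ev e1 s)) (nat (ev e2 s))) = ev (Ix a e1 e2) s"
    using M2 M3 by (auto simp: rel_def)
  moreover have "\<forall>i<d. M3 (scratch i) = M (scratch i)" using M1 M2 M3 by auto
  ultimately show ?case using M1 M2 M3 by (simp add: straight_append)
next
  case (Op f e1 e2)
  from Op.prems have "ok b e2 s" by simp
  from Op.IH(2)[OF this Op.prems(2,3)] obtain M1 where
    M1: "straight b (cexp e2 d) M = Some M1" "M1 0 = ev e2 s" "rel s M1"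
      "\<forall>i<d. M1 (scratch i) = M (scratch i)" by blast
  have "ok b e1 s" "rel s (M1(scratch d := M1 0))" using Op M1 by simp_all
  from Op.IH(1)[OF this Op.prems(3)] obtain M2 where
    M2: "straight b (cexp e1 (Suc d)) (M1(scratch d := M1 0)) = Some M2" "M2 0 = ev e1 s"
      "rel s M2" "\<forall>i<Suc d. M2 (scratch i) = (M1(scratch d := M1 0)) (scratch i)" by metis
  then show ?case using M1 Op by (auto simp: straight_append)
qed

lemma steps_cexp:
  assumes "ok b e s" "rel s M" "4 \<le> b" "code_at P pc (cexp e d)"
  obtains M' where "steps P b (length (cexp e d)) (pc, M, xs, ys) (pc + length (cexp e d), M', xs, ys)"
    "M' 0 = ev e s" "rel s M'" "\<forall>i<d. M' (scratch i) = M (scratch i)"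
  using straight_cexp[OF assms(1-3)] steps_straight[OF _ assms(4)] by metis

lemma steps_test:
  assumes "ok b e s" "rel s M" "4 \<le> b" "code_at P pc (cexp e 0 @ [JGTZ j])"
  obtains M' where "rel s M'" "steps P b (length (cexp e 0) + 1) (pc, M, xs, ys)
    (if ev e s > 0 then j else pc + length (cexp e 0) + 1, M', xs, ys)"
proof -
  obtain M1 where M1: "steps P b (length (cexp e 0)) (pc, M, xs, ys) (pc + length (cexp e 0), M1, xs, ys)"
    "M1 0 = ev e s" "rel s M1"
    using steps_cexp[OF assms(1-3), of P pc 0] assms(4) by (metis code_at_append)
  have "steps P b 1 (pc + length (cexp e 0), M1, xs, ys)
      (if M1 0 > 0 then j else Suc (pc + length (cexp e 0)), M1, xs, ys)"
    using assms(4) by (intro steps_jgtz) auto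
  from steps_trans[OF M1(1) this] show ?thesis
    by (intro that[OF M1(3)]) (simp only: M1(2) Suc_eq_plus1)
qed

lemma rel_sc [simp]: "rel s M \<Longrightarrow> rel (set_sc x v s) (M(sc_reg x := v))"
  and rel_ar [simp]: "rel s M \<Longrightarrow> rel (set_ar a p q v s) (M(ar_reg a p q := v))"
  and rel_inp [simp]: "rel (s\<lparr>inp := xs\<rparr>) M = rel s M"
  and rel_outp [simp]: "rel (s\<lparr>outp := xs\<rparr>) M = rel s M"
  by (auto simp: rel_def upd2_def)

lemma comp_correct:
  assumes "exec b c s n s'" "rel s M" "4 \<le> b" "code_at P pc (comp c pc)"
  shows "\<exists>m M'. m \<le> Suc n * clen c \<and> rel s' M' \<and>
     steps P b m (pc, M, inp s, outp s) (pc + clen c, M', inp s', outp s')"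
  using assms
proof (induction arbitrary: pc M rule: exec.induct)
  case (Skip s)
  then show ?case by (auto intro: steps.none)
next
  case (Asg e s x)
  then obtain M1 where M1: "straight b (cexp e 0) M = Some M1" "M1 0 = ev e s" "rel s M1"
    using straight_cexp[of b e s M 0] by blast
  then have "straight b (comp (Asg x e) pc) M = Some (M1(sc_reg x := ev e s))"
    by (simp add: straight_append)
  from steps_straight[OF this Asg.prems(3)] M1(3) show ?case
    by (fastforce intro: rel_sc)
next
  case (Put e1 s e2 e a)
  let ?v = "ar_reg a (nat (ev e1 s)) (nat (ev e2 s))"
  obtain M1 where M1: "straight b (cexp e1 0) M = Some M1" "M1 0 = ev e1 s" "rel s M1"
    using straight_cexp[of b e1 s M 0] Put by blast
  have "rel s (M1(scratch 0 := M1 0))" using M1 by simp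
  from straight_cexp[OF Put.hyps(2) this Put.prems(2), of 1] obtain M2 where
    M2: "straight b (cexp e2 1) (M1(scratch 0 := M1 0)) = Some M2" "M2 0 = ev e2 s"
      "rel s M2" "M2 (scratch 0) = ev e1 s" using M1 by auto
  from straight_index[OF Put.hyps(4) M2(4,2) Put.prems(2)] M2 obtain M3 where
    M3: "straight b (index_code a 0) M2 = Some M3" "M3 (scratch 0) = int ?v" "rel s M3" by metis
  from straight_cexp[OF Put.hyps(3) M3(3) Put.prems(2), of 1] obtain M4 where
    M4: "straight b (cexp e 1) M3 = Some M4" "M4 0 = ev e s" "rel s M4" "M4 (scratch 0) = int ?v"
    using M3 by auto
  have "straight b (comp (Put a e1 e2 e) pc) M = Some (M4(?v := ev e s))"
    using M1 M2 M3 M4 by (simp add: straight_append)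
  from steps_straight[OF this Put.prems(3), of "inp s" "outp s"] rel_ar[OF M4(3)] show ?case
    by (intro exI[of _ "clen (Put a e1 e2 e)"] exI[of _ "M4(?v := ev e s)"])
      (simp del: comp.simps clen.simps fun_upd_apply)
next
  case (Rd s v xs x)
  have "steps P b 1 (pc, M, v # xs, outp s) (Suc pc, M(sc_reg x := v), xs, outp s)"
    using Rd by (intro steps_one) (auto simp: guarded_def intro!: ram_step.Read)
  with Rd show ?case by (auto intro!: exI[of _ 1] rel_sc)
next
  case (Wr e s)
  then obtain M1 where M1: "steps P b (length (cexp e 0)) (pc, M, inp s, outp s)
      (pc + length (cexp e 0), M1, inp s, outp s)" "M1 0 = ev e s" "rel s M1"
    using steps_cexp[of b e s M P pc 0] by (metis code_at_append comp.simps(5))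
  have "steps P b 1 (pc + length (cexp e 0), M1, inp s, outp s)
      (pc + clen (Wr e), M1, inp s, outp s @ [ev e s])"
    using Wr M1 by (intro steps_one) (auto simp: guarded_def intro!: ram_step.Write)
  from steps_trans[OF M1(1) this] M1 show ?case by fastforce
next
  case (Seq c s m s' d n s'')
  then obtain m1 M1 where 1: "m1 \<le> Suc m * clen c" "rel s' M1"
    "steps P b m1 (pc, M, inp s, outp s) (pc + clen c, M1, inp s', outp s')"
    by fastforce
  have "code_at P (pc + clen c) (comp d (pc + clen c))" using Seq.prems by simp
  from Seq.IH(2)[OF 1(2) Seq.prems(2) this] obtain m2 M2 where 2: "m2 \<le> Suc n * clen d"
    "rel s'' M2" "steps P b m2 (pc + clen c, M1, inp s', outp s')
      (pc + clen c + clen d, M2, inp s'', outp s'')" by auto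
  have "m1 + m2 \<le> Suc (m + n) * clen c + Suc (m + n) * clen d"
    by (intro add_mono order.trans[OF 1(1)] order.trans[OF 2(1)] mult_right_mono) auto
  with steps_trans[OF 1(3) 2(3)] 2(2) show ?case
    by (auto simp: algebra_simps intro!: exI[of _ "m1 + m2"])
next
  case (IfT e s c n s' d)
  let ?l = "length (cexp e 0)"
  let ?pc = "pc + ?l + clen d + 2"
  have "code_at P pc (cexp e 0 @ [JGTZ ?pc])" using IfT.prems(3) by (simp add: Let_def)
  from steps_test[OF IfT.hyps(1) IfT.prems(1,2) this] IfT.hyps(2) obtain M1 where
    M1: "rel s M1" "steps P b (?l + 1) (pc, M, inp s, outp s) (?pc, M1, inp s, outp s)"
    by (auto simp: algebra_simps)
  have "code_at P ?pc (comp c ?pc)" using IfT.prems(3) by (simp add: Let_def add_ac)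
  from IfT.IH[OF M1(1) IfT.prems(2) this] obtain m2 M2 where 2: "m2 \<le> Suc n * clen c"
    "rel s' M2" "steps P b m2 (?pc, M1, inp s, outp s) (?pc + clen c, M2, inp s', outp s')"
    by blast
  have "?pc + clen c = pc + clen (IfP e c d)" by simp
  with steps_trans[OF M1(2) 2(3)] 2(1,2) show ?case
    by (intro exI[of _ "?l + 1 + m2"] exI[of _ M2]) (auto simp: algebra_simps)
next
  case (IfF e s d n s' c)
  let ?l = "length (cexp e 0)"
  let ?pc = "pc + ?l + 1"
  have "code_at P pc (cexp e 0 @ [JGTZ (pc + ?l + clen d + 2)])" using IfF.prems(3) by (simp add: Let_def)
  from steps_test[OF IfF.hyps(1) IfF.prems(1,2) this] IfF.hyps(2) obtain M1 where
    M1: "rel s M1" "steps P b (?l + 1) (pc, M, inp s, outp s) (?pc, M1, inp s, outp s)"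
    by (auto simp: algebra_simps)
  have "code_at P ?pc (comp d ?pc)" using IfF.prems(3) by (simp add: Let_def add_ac)
  from IfF.IH[OF M1(1) IfF.prems(2) this] obtain m2 M2 where 2: "m2 \<le> Suc n * clen d"
    "rel s' M2" "steps P b m2 (?pc, M1, inp s, outp s) (?pc + clen d, M2, inp s', outp s')"
    by blast
  have "steps P b 1 (?pc + clen d, M2, inp s', outp s')
      (pc + clen (IfP e c d), M2, inp s', outp s')"
    using IfF.prems(3) by (intro steps_jump) (auto simp: Let_def add_ac)
  from steps_trans[OF M1(2) steps_trans[OF 2(3) this]] 2(1,2) show ?case
    by (intro exI[of _ "?l + 1 + (m2 + 1)"] exI[of _ M2]) (auto simp: algebra_simps)
next
  case (WhT e s c m s' n s'')
  let ?l = "length (cexp e 0)"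
  let ?pc = "pc + ?l + 2"
  have "code_at P pc (cexp e 0 @ [JGTZ ?pc])" using WhT.prems(3) by (simp add: Let_def)
  from steps_test[OF WhT.hyps(1) WhT.prems(1,2) this] WhT.hyps(2) obtain M1 where
    M1: "rel s M1" "steps P b (?l + 1) (pc, M, inp s, outp s) (?pc, M1, inp s, outp s)"
    by (auto simp: algebra_simps)
  have "code_at P ?pc (comp c ?pc)" using WhT.prems(3) by (simp add: Let_def add_ac)
  from WhT.IH(1)[OF M1(1) WhT.prems(2) this] obtain m2 M2 where 2: "m2 \<le> Suc m * clen c"
    "rel s' M2" "steps P b m2 (?pc, M1, inp s, outp s) (?pc + clen c, M2, inp s', outp s')"
    by blast
  have 3: "steps P b 1 (?pc + clen c, M2, inp s', outp s') (pc, M2, inp s', outp s')"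
    using WhT.prems(3) by (intro steps_jump) (auto simp: Let_def add_ac)
  from WhT.IH(2)[OF 2(2) WhT.prems(2,3)] obtain m4 M4 where 4: "m4 \<le> Suc n * clen (Wh e c)"
    "rel s'' M4" "steps P b m4 (pc, M2, inp s', outp s') (pc + clen (Wh e c), M4, inp s'', outp s'')"
    by blast
  \<comment> \<open>Test, body and jump back are charged to \<open>Suc m\<close>, the rest of the
    loop to \<open>Suc n\<close>; counting this iteration in \<open>exec\<close> makes the sum of
    the two factors exactly \<open>Suc (Suc (m + n))\<close>.\<close>
  have "?l + 1 + (m2 + 1) \<le> Suc m * clen (Wh e c)"
    using 2(1) by (simp add: algebra_simps)
  with 4 have "?l + 1 + (m2 + 1) + m4 \<le> Suc (Suc (m + n)) * clen (Wh e c)"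
    by (simp add: algebra_simps)
  with steps_trans[OF steps_trans[OF M1(2) steps_trans[OF 2(3) 3]] 4(3)] 4(2)
  show ?case by blast
next
  case (WhF e s c)
  let ?l = "length (cexp e 0)"
  have "code_at P pc (cexp e 0 @ [JGTZ (pc + ?l + 2)])" using WhF.prems(3) by (simp add: Let_def)
  from steps_test[OF WhF.hyps(1) WhF.prems(1,2) this] WhF.hyps(2) obtain M1 where
    M1: "rel s M1" "steps P b (?l + 1) (pc, M, inp s, outp s) (pc + ?l + 1, M1, inp s, outp s)"
    by (auto simp: algebra_simps)
  have "steps P b 1 (pc + ?l + 1, M1, inp s, outp s) (pc + clen (Wh e c), M1, inp s, outp s)"
    using WhF.prems(3) by (intro steps_jump) (auto simp: Let_def add_ac)
  from steps_trans[OF M1(2) this] M1(1) show ?case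
    by (intro exI[of _ "?l + 1 + 1"] exI[of _ M1]) (auto simp: algebra_simps)
qed

section \<open>Logarithmic cost of a run from the number of its steps\<close>

definition bounded :: "nat \<Rightarrow> mem \<Rightarrow> bool" where
  "bounded B M \<longleftrightarrow> (\<forall>i. \<bar>M i\<bar> \<le> 2 ^ B)"

fun operand_fits :: "nat \<Rightarrow> operand \<Rightarrow> bool" where
  "operand_fits b (Lit k) \<longleftrightarrow> \<bar>k\<bar> \<le> 2 ^ b"
| "operand_fits b (Reg i) \<longleftrightarrow> int i \<le> 2 ^ b"
| "operand_fits b (Ind i) \<longleftrightarrow> int i \<le> 2 ^ b"

text \<open>Literals and register numbers in the program text enter the cost as well. They are
  constants of the program, so every large enough \<open>b\<close> accommodates them.\<close>

fun fits :: "nat \<Rightarrow> instr \<Rightarrow> bool" where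
  "fits b (LOAD a) \<longleftrightarrow> operand_fits b a"
| "fits b (STORE a) \<longleftrightarrow> operand_fits b a"
| "fits b (ARITH f a) \<longleftrightarrow> operand_fits b a"
| "fits b (READ a) \<longleftrightarrow> operand_fits b a"
| "fits b (WRITE a) \<longleftrightarrow> operand_fits b a"
| "fits b _ \<longleftrightarrow> True"

lemma ex_pow2_ge: "\<exists>b0. \<forall>b\<ge>b0. (k::int) \<le> 2 ^ b"
proof (intro exI allI impI)
  fix b assume "b \<ge> nat k"
  have "k \<le> int (nat k)" by simp
  also have "\<dots> < 2 ^ nat k" by (metis of_nat_less_two_power)
  also have "\<dots> \<le> 2 ^ b" using \<open>b \<ge> nat k\<close> by simp
  finally show "k \<le> 2 ^ b" by simp
qed

lemma ex_fits: "\<exists>b0. \<forall>b\<ge>b0. fits b i"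
proof -
  have "\<exists>b0. \<forall>b\<ge>b0. operand_fits b a" for a
    by (cases a) (simp_all only: operand_fits.simps ex_pow2_ge)
  then show ?thesis by (cases i) simp_all
qed

lemma ex_program_fits: "\<exists>b0. \<forall>b\<ge>b0. \<forall>i\<in>set P. fits b i"
proof (induction P)
  case (Cons i P)
  then obtain b1 b2 where "\<forall>b\<ge>b1. fits b i" "\<forall>b\<ge>b2. \<forall>i\<in>set P. fits b i"
    using ex_fits by blast
  then show ?case by (intro exI[of _ "max b1 b2"]) auto
qed simp

lemma int_len_le: "\<bar>i\<bar> \<le> 2 ^ B \<Longrightarrow> int_len i \<le> B + 1"
proof -
  assume "\<bar>i\<bar> \<le> 2 ^ B"
  also have "(2::int) ^ B < 2 ^ (B + 1)" by (rule power_strict_increasing) simp_all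
  finally have "\<bar>i\<bar> < 2 ^ (B + 1)" .
  then have "nat \<bar>i\<bar> < 2 ^ (B + 1)" by (simp add: nat_less_iff)
  then show ?thesis unfolding int_len_def by (simp add: floorlog_le_iff)
qed

lemma abs_le_int_len: "\<bar>i\<bar> \<le> 2 ^ int_len i"
proof -
  have "nat \<bar>i\<bar> < 2 ^ floorlog 2 (nat \<bar>i\<bar>)" if "nat \<bar>i\<bar> > 0"
    using floorlog_bounds[of "nat \<bar>i\<bar>" 2] that by simp
  then have "nat \<bar>i\<bar> \<le> 2 ^ floorlog 2 (nat \<bar>i\<bar>)" by fastforce
  also have "\<dots> \<le> 2 ^ int_len i" by (simp add: int_len_def)
  finally have "int (nat \<bar>i\<bar>) \<le> int (2 ^ int_len i)" by (simp only: of_nat_le_iff)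
  then show ?thesis by simp
qed

lemma abs_div_le: "\<bar>x div y\<bar> \<le> \<bar>x\<bar>" for x y :: int
proof -
  have pos: "\<bar>x div y\<bar> \<le> \<bar>x\<bar>" if "y > 0" for x y :: int
  proof (cases "x div y \<ge> 0")
    case True
    then have "x div y * 1 \<le> x div y * y" using that by (intro mult_left_mono) auto
    also have "\<dots> \<le> x" using that by (simp add: minus_mod_eq_div_mult [symmetric])
    finally show ?thesis using True by simp
  next
    case False
    then have "(x div y + 1) * y \<le> (x div y + 1) * 1" using that by (intro mult_left_mono_neg) auto
    moreover have "x < (x div y + 1) * y"
      using pos_mod_bound[OF that, of x] div_mult_mod_eq[of x y] unfolding distrib_right by linarith
    ultimately show ?thesis using False by simp
  qed
  show ?thesis
  proof (cases y "0::int" rule: linorder_cases)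
    case less
    then show ?thesis using pos[of "- y" "- x"] by simp
  qed (use pos in simp_all)
qed

lemma arith_bound:
  assumes "\<bar>x\<bar> \<le> 2 ^ B" "\<bar>y\<bar> \<le> 2 ^ B" "f = MULT \<Longrightarrow> \<bar>y\<bar> \<le> 2 ^ b" "1 \<le> b"
  shows "\<bar>arith f x y\<bar> \<le> 2 ^ (B + b)"
proof -
  have 1: "(2::int) ^ b \<ge> 2 ^ 1" using assms(4) by (intro power_increasing) auto
  have 2: "(2::int) ^ (B + b) \<ge> 2 ^ B * 2"
    using mult_left_mono[OF 1, of "2 ^ B"] by (simp add: power_add)
  show ?thesis
  proof (cases f)
    case MULT
    then show ?thesis using assms by (auto simp: abs_mult power_add intro!: mult_mono)
  next
    case DIV
    then show ?thesis using abs_div_le[of x y] assms 2 by simp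
  qed (use assms 2 in auto)
qed

lemma abs_pow_mono: "\<bar>x\<bar> \<le> 2 ^ b \<Longrightarrow> b \<le> B \<Longrightarrow> \<bar>x\<bar> \<le> (2::int) ^ B"
  by (rule order.trans, assumption) simp

lemma operand_val_bound:
  assumes "bounded B M" "operand_fits b a" "b \<le> B" "operand_val M a = Some v"
  shows "\<bar>v\<bar> \<le> 2 ^ B" "val_cost M a \<le> 3 * (B + 1)"
proof -
  have *: "(2::int) ^ b \<le> 2 ^ B" using assms(3) by simp
  have r: "int_len (M i) \<le> B + 1" for i using assms(1) by (intro int_len_le) (simp add: bounded_def)
  have c: "int_len k \<le> B + 1" if "\<bar>k\<bar> \<le> 2 ^ b" for k using that * by (intro int_len_le) (rule order.trans)
  show "\<bar>v\<bar> \<le> 2 ^ B"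
  proof (cases a)
    case (Lit k)
    then show ?thesis using assms abs_pow_mono[of k b B] by simp
  next
    case (Reg i)
    then show ?thesis using assms(1,4) by (auto simp: bounded_def)
  next
    case (Ind i)
    then show ?thesis using assms(1,4) by (auto simp: bounded_def split: if_splits)
  qed
  show "val_cost M a \<le> 3 * (B + 1)"
  proof (cases a)
    case (Lit k)
    then show ?thesis using assms(2) c[of k] by simp
  next
    case (Reg i)
    then show ?thesis using assms(2) c[of "int i"] r[of i] by simp
  next
    case (Ind i)
    then show ?thesis using assms(2) c[of "int i"] r[of i] r[of "nat (M i)"] by simp
  qed
qed

lemma loc_cost_bound:
  assumes "bounded B M" "operand_fits b a" "b \<le> B"
  shows "loc_cost M a \<le> 2 * (B + 1)"
proof -
  have *: "(2::int) ^ b \<le> 2 ^ B" using assms(3) by simp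
  have r: "int_len (M i) \<le> B + 1" for i using assms(1) by (intro int_len_le) (simp add: bounded_def)
  have c: "int_len k \<le> B + 1" if "\<bar>k\<bar> \<le> 2 ^ b" for k using that * by (intro int_len_le) (rule order.trans)
  show ?thesis
  proof (cases a)
    case (Reg i)
    then show ?thesis using assms(2) c[of "int i"] by simp
  next
    case (Ind i)
    then show ?thesis using assms(2) c[of "int i"] r[of i] by simp
  qed simp
qed

text \<open>An instruction involves at most four numbers of at most \<open>B + 1\<close> bits: the
  accumulator or the number read, the register named by the operand, its content and, for an
  indirect operand, the content of the register addressed by it.\<close>

lemma ram_step_bound:
  assumes "ram_step P (pc, M, xs, ys) t (pc', M', xs', ys')" "guarded b (P ! pc) M"
    "\<forall>i\<in>set P. fits b i" "bounded B M" "1 \<le> b" "b \<le> B" "\<forall>x\<in>set xs. \<bar>x\<bar> \<le> 2 ^ b"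
  shows "bounded (B + b) M' \<and> t \<le> 4 * (B + 1) \<and> (\<forall>x\<in>set xs'. \<bar>x\<bar> \<le> 2 ^ b)"
proof -
  have pow: "(2::int) ^ B \<le> 2 ^ (B + b)" "(2::int) ^ b \<le> 2 ^ (B + b)" "(2::int) ^ b \<le> 2 ^ B"
    using assms(6) by simp_all
  have M: "\<bar>M i\<bar> \<le> 2 ^ B" "\<bar>M i\<bar> \<le> 2 ^ (B + b)" for i
    using assms(4) pow(1) unfolding bounded_def by (blast, meson order.trans)
  then have BM: "bounded (B + b) M" by (simp add: bounded_def)
  have len: "int_len (M i) \<le> B + 1" for i by (rule int_len_le[OF M(1)])
  have fits: "fits b (P ! pc)" if "pc < length P" using assms(3) that by simp
  have upd: "bounded (B + b) (M(i := v))" if "\<bar>v\<bar> \<le> 2 ^ (B + b)" for i v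
    using that M(2) by (simp add: bounded_def)
  from assms(1) show ?thesis
  proof cases
    case (Load a v)
    with fits operand_val_bound[OF assms(4) _ assms(6), of a v] show ?thesis
      using assms(7) upd[OF abs_pow_mono[of v B "B + b"], of 0] by auto
  next
    case (Store a i)
    with fits loc_cost_bound[OF assms(4) _ assms(6), of a] show ?thesis
      using len[of 0] M assms(7) by (auto intro!: upd)
  next
    case (Arith f a v)
    with fits operand_val_bound[OF assms(4) _ assms(6), of a v] show ?thesis
      using len[of 0] M(1) assms(2,5,7) by (auto intro!: upd arith_bound simp: guarded_def)
  next
    case (Read a i x)
    have "\<bar>x\<bar> \<le> 2 ^ B" by (rule abs_pow_mono[OF _ assms(6)]) (use Read(1) assms(7) in simp)
    then show ?thesis
      using Read fits loc_cost_bound[OF assms(4) _ assms(6), of a] int_len_le[of x B] assms(7)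
        upd[OF abs_pow_mono[of x B "B + b"], of i]
      by auto
  next
    case (Write a v)
    with fits operand_val_bound[OF assms(4) _ assms(6), of a v] show ?thesis
      using BM assms(7) by auto
  qed (use len[of 0] BM assms(7) in auto)
qed

text \<open>By induction, \<open>m\<close> guarded steps lengthen the registers by at most
  \<open>m * b\<close> bits, and every step costs at most what the last length allows. As
  \<open>ram_run\<close> describes only halting runs, the cost of a prefix is stated as an extension
  of arbitrary continuations.\<close>

lemma steps_bound:
  assumes "steps P b m (0, \<lambda>_. 0, xs, []) (pc, M, xs', ys)"
    "\<forall>i\<in>set P. fits b i" "1 \<le> b" "\<forall>x\<in>set xs. \<bar>x\<bar> \<le> 2 ^ b"
  shows "bounded (b + m * b) M \<and> (\<forall>x\<in>set xs'. \<bar>x\<bar> \<le> 2 ^ b) \<and>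
    (\<exists>t\<le>m * (4 * (b + m * b + 1)). \<forall>t' zs. ram_run P (pc, M, xs', ys) t' zs \<longrightarrow>
       ram_run P (0, \<lambda>_. 0, xs, []) (t + t') zs)"
  using assms(1)
proof (induction m "(0::nat, \<lambda>_::nat. 0::int, xs, [] :: int list)" "(pc, M, xs', ys)" arbitrary: pc M xs' ys rule: steps.induct)
  case none
  then show ?case using assms(4) by (auto simp: bounded_def)
next
  case (step m pc0 M0 xs0 ys0 t1)
  let ?B = "b + m * b"
  from step obtain t where IH: "bounded ?B M0" "\<forall>x\<in>set xs0. \<bar>x\<bar> \<le> 2 ^ b" "t \<le> m * (4 * (?B + 1))"
    "\<And>t' zs. ram_run P (pc0, M0, xs0, ys0) t' zs \<Longrightarrow> ram_run P (0, \<lambda>_. 0, xs, []) (t + t') zs"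
    by blast
  from ram_step_bound[OF step.hyps(4,3) assms(2) IH(1) assms(3) _ IH(2)]
  have *: "bounded (?B + b) M" "t1 \<le> 4 * (?B + 1)" "\<forall>x\<in>set xs'. \<bar>x\<bar> \<le> 2 ^ b" by simp_all
  have "t + t1 \<le> Suc m * (4 * (?B + 1))" using IH(3) *(2) by simp
  also have "\<dots> \<le> Suc m * (4 * (b + Suc m * b + 1))" by (intro mult_left_mono) auto
  finally have "t + t1 \<le> Suc m * (4 * (b + Suc m * b + 1))" .
  moreover have "ram_run P (0, \<lambda>_. 0, xs, []) (t + t1 + t') zs" if "ram_run P (pc, M, xs', ys) t' zs" for t' zs
    using IH(4)[OF ram_run.Step[OF step.hyps(4) that]] by (simp add: add.assoc)
  ultimately show ?case using * by (auto simp: add_ac)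
qed

definition init :: "int list \<Rightarrow> state" where
  "init xs = \<lparr>sc = \<lambda>_. 0, ar = \<lambda>_ _ _. 0, inp = xs, outp = []\<rparr>"

definition program :: "com \<Rightarrow> instr list" where
  "program c = comp c 0 @ [HALT]"

text \<open>The second conclusion bounds values instead of time. Applied to the code that computes
  the capacities, it limits the number of scaling phases.\<close>

lemma exec_ram_run:
  assumes "exec b c (init xs) n s" "\<forall>i\<in>set (program c). fits b i" "4 \<le> b" "\<forall>x\<in>set xs. \<bar>x\<bar> \<le> 2 ^ b"
    and L: "L = Suc n * clen c"
  shows "\<exists>t\<le>L * (4 * (b + L * b + 1)) + 1. ram_run (program c) (0, \<lambda>_. 0, xs, []) t (outp s)"
    and "\<bar>sc s x\<bar> \<le> 2 ^ (b + L * b)"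
proof -
  have "rel (init xs) (\<lambda>_. 0)" "code_at (program c) 0 (comp c 0)"
    by (simp_all add: rel_def init_def program_def code_at_def nth_append)
  from comp_correct[OF assms(1) this(1) assms(3) this(2)] obtain m M where
    m: "m \<le> L" "rel s M" "steps (program c) b m (0, \<lambda>_. 0, xs, []) (clen c, M, inp s, outp s)"
    unfolding L by (auto simp: init_def)
  from steps_bound[OF m(3) assms(2) _ assms(4)] assms(3) obtain t where
    t: "bounded (b + m * b) M" "t \<le> m * (4 * (b + m * b + 1))"
      "\<And>t' zs. ram_run (program c) (clen c, M, inp s, outp s) t' zs \<Longrightarrow>
        ram_run (program c) (0, \<lambda>_. 0, xs, []) (t + t') zs" by auto
  have "ram_run (program c) (clen c, M, inp s, outp s) 1 (outp s)"
    by (rule ram_run.Halt) (simp_all add: program_def nth_append)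
  from t(3)[OF this] have "ram_run (program c) (0, \<lambda>_. 0, xs, []) (t + 1) (outp s)" .
  moreover have "m * (4 * (b + m * b + 1)) \<le> L * (4 * (b + L * b + 1))"
    using m(1) by (intro mult_mono add_mono) auto
  ultimately show "\<exists>t\<le>L * (4 * (b + L * b + 1)) + 1. ram_run (program c) (0, \<lambda>_. 0, xs, []) t (outp s)"
    using t(2) by (intro exI[of _ "t + 1"]) auto
  have "\<bar>sc s x\<bar> \<le> 2 ^ (b + m * b)" using m(2) t(1) by (metis bounded_def rel_def)
  also have "\<dots> \<le> 2 ^ (b + L * b)" using m(1) by (intro power_increasing) auto
  finally show "\<bar>sc s x\<bar> \<le> 2 ^ (b + L * b)" .
qed

section \<open>Program logic\<close>

definition tc :: "nat \<Rightarrow> com \<Rightarrow> state \<Rightarrow> nat \<Rightarrow> (state \<Rightarrow> bool) \<Rightarrow> bool" where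
  "tc b c s n Q \<longleftrightarrow> (\<exists>m s'. m \<le> n \<and> exec b c s m s' \<and> Q s')"

lemma tc_conseq: "tc b c s m R \<Longrightarrow> m \<le> n \<Longrightarrow> (\<And>t. R t \<Longrightarrow> Q t) \<Longrightarrow> tc b c s n Q"
  unfolding tc_def by (meson order.trans)

lemma tc_Seq: "tc b c s m R \<Longrightarrow> (\<And>t. R t \<Longrightarrow> tc b d t n Q) \<Longrightarrow> tc b (c ;; d) s (m + n) Q"
  unfolding tc_def by (meson add_mono exec.Seq)

lemma tc_Skip [simp]: "tc b Skip s n Q \<longleftrightarrow> Q s"
  unfolding tc_def by (auto elim: exec_SkipE intro: exec.Skip)

lemma tc_Asg [simp]: "tc b (Asg x e) s n Q \<longleftrightarrow> ok b e s \<and> Q (set_sc x (ev e s) s)"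
  unfolding tc_def by (auto elim!: exec_AsgE intro: exec.Asg)

lemma tc_Put [simp]: "tc b (Put a e1 e2 e) s n Q \<longleftrightarrow>
    ok b e1 s \<and> ok b e2 s \<and> ok b e s \<and> ok_index b (ev e1 s) (ev e2 s) \<and>
    Q (set_ar a (nat (ev e1 s)) (nat (ev e2 s)) (ev e s) s)"
  unfolding tc_def by (auto elim!: exec_PutE intro: exec.Put)

lemma tc_Rd [simp]: "tc b (Rd x) s n Q \<longleftrightarrow>
    (\<exists>v xs. inp s = v # xs \<and> Q (set_sc x v s\<lparr>inp := xs\<rparr>))"
  unfolding tc_def by (force elim!: exec_RdE intro: exec.Rd)

lemma tc_Wr [simp]: "tc b (Wr e) s n Q \<longleftrightarrow> ok b e s \<and> Q (s\<lparr>outp := outp s @ [ev e s]\<rparr>)"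
  unfolding tc_def by (auto elim!: exec_WrE intro: exec.Wr)

lemma tc_If [simp]: "tc b (IfP e c d) s n Q \<longleftrightarrow>
    ok b e s \<and> (if ev e s > 0 then tc b c s n Q else tc b d s n Q)"
  unfolding tc_def by (auto elim!: exec_IfE intro: exec.IfT exec.IfF)

lemma tc_Seq_iff: "tc b (c ;; d) s n Q \<longleftrightarrow>
    (\<exists>m\<le>n. \<exists>s'. exec b c s m s' \<and> tc b d s' (n - m) Q)"
proof -
  have "m + l \<le> n \<longleftrightarrow> m \<le> n \<and> l \<le> n - m" for m l :: nat by linarith
  then show ?thesis unfolding tc_def
    by (fastforce elim!: exec_SeqE intro: exec.Seq)
qed

text \<open>Atomic commands use up no budget, so the simplifier can execute straight-line prefixes
  symbolically; only loops call for an explicit intermediate assertion.\<close>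

lemma tc_Seq_simps [simp]:
  "tc b (Skip ;; d) s n Q \<longleftrightarrow> tc b d s n Q"
  "tc b (Asg x e ;; d) s n Q \<longleftrightarrow> ok b e s \<and> tc b d (set_sc x (ev e s) s) n Q"
  "tc b (Put a e1 e2 e ;; d) s n Q \<longleftrightarrow>
    ok b e1 s \<and> ok b e2 s \<and> ok b e s \<and> ok_index b (ev e1 s) (ev e2 s) \<and>
    tc b d (set_ar a (nat (ev e1 s)) (nat (ev e2 s)) (ev e s) s) n Q"
  "tc b (Rd x ;; d) s n Q \<longleftrightarrow>
    (\<exists>v xs. inp s = v # xs \<and> tc b d (set_sc x v s\<lparr>inp := xs\<rparr>) n Q)"
  "tc b (Wr e ;; d) s n Q \<longleftrightarrow> ok b e s \<and> tc b d (s\<lparr>outp := outp s @ [ev e s]\<rparr>) n Q"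
  "tc b (IfP e c1 c2 ;; d) s n Q \<longleftrightarrow>
    ok b e s \<and> (if ev e s > 0 then tc b (c1 ;; d) s n Q else tc b (c2 ;; d) s n Q)"
  unfolding tc_Seq_iff
  by (auto elim!: exec_SkipE exec_AsgE exec_PutE exec_RdE exec_WrE exec_IfE
      intro: exec.intros exI[of _ 0]) (metis diff_zero exec.intros le0)+

lemma tc_Seq_assoc [simp]: "tc b ((c ;; d) ;; e) s n Q \<longleftrightarrow> tc b (c ;; d ;; e) s n Q"
proof -
  have "exec b ((c ;; d) ;; e) s m t \<longleftrightarrow> exec b (c ;; d ;; e) s m t" for m t
    by (auto elim!: exec_SeqE) (metis add.assoc exec.Seq)+
  then show ?thesis by (simp add: tc_def)
qed

text \<open>The number of iterations of every loop of the solver is determined beforehand, so an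
  invariant indexed by the iteration takes the place of a variant.\<close>

lemma tc_While:
  assumes I: "I 0 s"
    and step: "\<And>j t. j < k \<Longrightarrow> I j t \<Longrightarrow> ok b e t \<and> ev e t > 0 \<and> tc b c t l (I (Suc j))"
    and stop: "\<And>t. I k t \<Longrightarrow> ok b e t \<and> \<not> ev e t > 0"
  shows "tc b (Wh e c) s (k * (l + 1)) (I k)"
proof -
  have "tc b (Wh e c) t ((k - j) * (l + 1)) (I k)" if "j \<le> k" "I j t" for j t
    using that
  proof (induction j arbitrary: t rule: inc_induct)
    case base
    then show ?case using stop[of t] exec.WhF[of b e t c] unfolding tc_def by auto
  next
    case (step j)
    from step.hyps step.prems assms(2)[of j t] obtain m t' where
      m: "ok b e t" "ev e t > 0" "m \<le> l" "exec b c t m t'" "I (Suc j) t'"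
      unfolding tc_def by auto
    from step.IH[OF m(5)] obtain m' t'' where
      m': "m' \<le> (k - Suc j) * (l + 1)" "exec b (Wh e c) t' m' t''" "I k t''"
      unfolding tc_def by auto
    have "k - j = Suc (k - Suc j)" using step.hyps by simp
    then have "Suc (m + m') \<le> (k - j) * (l + 1)" using m(3) m'(1) by simp
    then show ?case unfolding tc_def using exec.WhT[OF m(1,2,4) m'(2)] m'(3) by blast
  qed
  from this[of 0] I show ?thesis by simp
qed

section \<open>Frame conditions and counting loops\<close>

fun mods :: "com \<Rightarrow> scal set" where
  "mods Skip = {}" | "mods (Asg x e) = {x}" | "mods (Put a e1 e2 e) = {}" | "mods (Rd x) = {x}"
| "mods (Wr e) = {}" | "mods (c ;; d) = mods c \<union> mods d" | "mods (IfP e c d) = mods c \<union> mods d"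
| "mods (Wh e c) = mods c"

fun ar_mods :: "com \<Rightarrow> arr set" where
  "ar_mods (Put a e1 e2 e) = {a}" | "ar_mods (c ;; d) = ar_mods c \<union> ar_mods d"
| "ar_mods (IfP e c d) = ar_mods c \<union> ar_mods d" | "ar_mods (Wh e c) = ar_mods c"
| "ar_mods _ = {}"

fun reads :: "com \<Rightarrow> bool" where
  "reads (Rd x) = True" | "reads (c ;; d) = (reads c \<or> reads d)"
| "reads (IfP e c d) = (reads c \<or> reads d)" | "reads (Wh e c) = reads c" | "reads _ = False"

fun writes :: "com \<Rightarrow> bool" where
  "writes (Wr e) = True" | "writes (c ;; d) = (writes c \<or> writes d)"
| "writes (IfP e c d) = (writes c \<or> writes d)" | "writes (Wh e c) = writes c" | "writes _ = False"

text \<open>A syntactic frame condition, thanks to which loop invariants mention only what the body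
  changes.\<close>

definition frame :: "com \<Rightarrow> state \<Rightarrow> state \<Rightarrow> bool" where
  "frame c s t \<longleftrightarrow> (\<forall>x. x \<notin> mods c \<longrightarrow> sc t x = sc s x) \<and> (\<forall>a. a \<notin> ar_mods c \<longrightarrow> ar t a = ar s a) \<and>
    (\<not> reads c \<longrightarrow> inp t = inp s) \<and> (\<not> writes c \<longrightarrow> outp t = outp s)"

lemma exec_frame: "exec b c s n t \<Longrightarrow> frame c s t"
  by (induction rule: exec.induct) (auto simp: frame_def)

lemma tc_frame: "tc b c s n Q \<Longrightarrow> tc b c s n (\<lambda>t. Q t \<and> frame c s t)"
  unfolding tc_def using exec_frame by blast

definition For :: "scal \<Rightarrow> exp \<Rightarrow> com \<Rightarrow> com" where
  "For i e c = Asg i (Cst 0) ;; Wh (e \<^bold>- V i) (c ;; Asg i (V i \<^bold>+ Cst 1))"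

lemma For_mods [simp]:
  "mods (For i e c) = insert i (mods c)" "ar_mods (For i e c) = ar_mods c"
  "reads (For i e c) = reads c" "writes (For i e c) = writes c"
  by (auto simp: For_def)

text \<open>The bound \<open>e\<close> is evaluated anew at every test, so it has to be constant on
  all states that the frame permits. The invariant must ignore the counter, which is incremented
  after the body; the body learns the value of the counter separately.\<close>

lemma tc_For:
  assumes I: "I 0 s"
    and inv: "\<And>j v t. I j t \<Longrightarrow> I j (set_sc i v t)"
    and e: "\<And>t. frame (For i e c) s t \<Longrightarrow> ok b e t \<and> ev e t = int k"
    and i: "i \<notin> mods c"
    and step: "\<And>j t. j < k \<Longrightarrow> I j t \<Longrightarrow> sc t i = int j \<Longrightarrow> frame (For i e c) s t \<Longrightarrow>
      tc b c t l (I (Suc j))"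
  shows "tc b (For i e c) s (k * (l + 1)) (\<lambda>t. I k t \<and> frame (For i e c) s t)"
proof -
  let ?I = "\<lambda>j t. I j t \<and> sc t i = int j \<and> frame (For i e c) s t"
  have "tc b (Wh (e \<^bold>- V i) (c ;; Asg i (V i \<^bold>+ Cst 1))) (set_sc i 0 s) (k * (l + 1)) (?I k)"
  proof (rule tc_While)
    show "?I 0 (set_sc i 0 s)" using I inv by (auto simp: frame_def)
  next
    fix j t assume j: "j < k" "?I j t"
    have "tc b c t l (\<lambda>t'. I (Suc j) t' \<and> frame c t t')" using step j tc_frame by blast
    then have "tc b (c ;; Asg i (V i \<^bold>+ Cst 1)) t (l + 0) (?I (Suc j))"
      by (rule tc_Seq) (use j i inv in \<open>auto simp: frame_def\<close>)
    then show "ok b (e \<^bold>- V i) t \<and> 0 < ev (e \<^bold>- V i) t \<and>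
        tc b (c ;; Asg i (V i \<^bold>+ Cst 1)) t l (?I (Suc j))"
      using e[of t] j by simp
  next
    fix t assume "?I k t"
    then show "ok b (e \<^bold>- V i) t \<and> \<not> 0 < ev (e \<^bold>- V i) t" using e[of t] by simp
  qed
  moreover have "tc b (For i e c) s n Q \<longleftrightarrow>
      tc b (Wh (e \<^bold>- V i) (c ;; Asg i (V i \<^bold>+ Cst 1))) (set_sc i 0 s) n Q" for n Q
    by (simp add: For_def)
  ultimately have "tc b (For i e c) s (k * (l + 1)) (?I k)" by simp
  then show ?thesis by (rule tc_conseq) auto
qed

lemma tc_ForI:
  assumes "I 0 s" "\<And>j v t. I j t \<Longrightarrow> I j (set_sc i v t)"
    "\<And>t. frame (For i e c) s t \<Longrightarrow> ok b e t \<and> ev e t = int k" "i \<notin> mods c"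
    "\<And>j t. j < k \<Longrightarrow> I j t \<Longrightarrow> sc t i = int j \<Longrightarrow> frame (For i e c) s t \<Longrightarrow>
      tc b c t l (I (Suc j))"
    "k * (l + 1) \<le> n" "\<And>t. I k t \<Longrightarrow> frame (For i e c) s t \<Longrightarrow> Q t"
  shows "tc b (For i e c) s n Q"
  by (rule tc_conseq[OF tc_For[of I, OF assms(1-5)] assms(6)]) (use assms(7) in auto)

lemma upd2_apply [simp]: "upd2 f p q v p' q' = (if p' = p \<and> q' = q then v else f p' q')"
  by (simp add: upd2_def)

lemma upd2_row [simp]: "upd2 f p q v p = (f p)(q := v)" "p' \<noteq> p \<Longrightarrow> upd2 f p q v p' = f p'"
  by (auto simp: upd2_def)

section \<open>Minimum cuts by bit scaling\<close>

text \<open>Only the part of \<open>S\<close> below \<open>N\<close> matters, so complements can be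
  formed in the whole type \<open>nat\<close>.\<close>

definition cut_sum :: "nat \<Rightarrow> matrix \<Rightarrow> nat set \<Rightarrow> int" where
  "cut_sum N r S = (\<Sum>p<N. \<Sum>q<N. if p \<in> S \<and> q \<notin> S then r p q else 0)"

definition nonneg :: "nat \<Rightarrow> matrix \<Rightarrow> bool" where
  "nonneg N r \<longleftrightarrow> (\<forall>p<N. \<forall>q<N. 0 \<le> r p q)"

lemma cut_sum_nonneg: "nonneg N r \<Longrightarrow> 0 \<le> cut_sum N r S"
  unfolding cut_sum_def nonneg_def by (intro sum_nonneg) auto

lemma cut_sum_cong:
  assumes "\<And>p q. p < N \<Longrightarrow> q < N \<Longrightarrow> r p q = r' p q"
  shows "cut_sum N r S = cut_sum N r' S"
  unfolding cut_sum_def using assms by (intro sum.cong) auto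

lemma cut_sum_add: "cut_sum N (\<lambda>p q. r p q + r' p q) S = cut_sum N r S + cut_sum N r' S"
  unfolding cut_sum_def sum.distrib [symmetric] by (intro sum.cong) auto

lemma cut_sum_scale: "cut_sum N (\<lambda>p q. k * r p q) S = k * cut_sum N r S"
  unfolding cut_sum_def sum_distrib_left by (intro sum.cong) auto

lemma cut_sum_upd:
  assumes "p < N" "q < N"
  shows "cut_sum N (upd2 r p q v) S = cut_sum N r S + (if p \<in> S \<and> q \<notin> S then v - r p q else 0)"
proof -
  let ?d = "if p \<in> S \<and> q \<notin> S then v - r p q else 0"
  have "cut_sum N (upd2 r p q v) S = (\<Sum>p'<N. \<Sum>q'<N. (if p' \<in> S \<and> q' \<notin> S then r p' q' else 0) +
      (if q' = q then if p' = p then ?d else 0 else 0))"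
    unfolding cut_sum_def upd2_def by (intro sum.cong) auto
  also have "\<dots> = cut_sum N r S + ?d"
    unfolding sum.distrib cut_sum_def using assms by (simp add: sum.delta)
  finally show ?thesis .
qed

section \<open>Labelling search and unit augmentation in the residual graph\<close>

definition labelled :: "nat \<Rightarrow> (nat \<Rightarrow> int) \<Rightarrow> nat set" where
  "labelled N lab = {p. p < N \<and> lab p = 1}"

lemma finite_labelled [simp]: "finite (labelled N lab)"
  by (simp add: labelled_def)

lemma card_labelled: "card (labelled N lab) \<le> N"
  using card_mono[of "{..<N}" "labelled N lab"] by (auto simp: labelled_def)

definition boolean :: "nat \<Rightarrow> (nat \<Rightarrow> int) \<Rightarrow> bool" where
  "boolean N lab \<longleftrightarrow> (\<forall>p<N. lab p = 0 \<or> lab p = 1)"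

text \<open>Parents point towards the source 0: \<open>k\<close> ranks nodes by the order of discovery.\<close>

definition search_tree :: "nat \<Rightarrow> matrix \<Rightarrow> (nat \<Rightarrow> int) \<Rightarrow> (nat \<Rightarrow> int) \<Rightarrow> (nat \<Rightarrow> nat) \<Rightarrow> bool" where
  "search_tree N r lab par k \<longleftrightarrow> boolean N lab \<and> 0 \<in> labelled N lab \<and>
     (\<forall>q\<in>labelled N lab. k q < card (labelled N lab)) \<and>
     (\<forall>q\<in>labelled N lab. q \<noteq> 0 \<longrightarrow>
        (\<exists>p\<in>labelled N lab. par q = int p \<and> r p q > 0 \<and> k p < k q))"

lemma search_tree_init:
  assumes "0 < N" "\<And>p. p < N \<Longrightarrow> lab p = (if p = 0 then 1 else 0)"
  shows "search_tree N r lab par (\<lambda>_. 0)"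
proof -
  have "labelled N lab = {0}" using assms by (auto simp: labelled_def split: if_splits)
  then show ?thesis using assms by (auto simp: search_tree_def boolean_def)
qed

lemma search_tree_step:
  assumes "search_tree N r lab par k" "p \<in> labelled N lab" "q < N" "lab q = 0" "r p q > 0"
  shows "search_tree N r (lab(q := 1)) (par(q := int p)) (k(q := card (labelled N lab)))"
proof -
  have L: "labelled N (lab(q := 1)) = insert q (labelled N lab)" and q: "q \<notin> labelled N lab"
    using assms(3,4) by (auto simp: labelled_def)
  have c: "card (labelled N (lab(q := 1))) = Suc (card (labelled N lab))" unfolding L using q by simp
  show ?thesis
    using assms q unfolding search_tree_def c unfolding L
    by (auto simp: boolean_def less_Suc_eq)
qed

definition residually_closed :: "nat \<Rightarrow> matrix \<Rightarrow> nat set \<Rightarrow> bool" where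
  "residually_closed N r L \<longleftrightarrow> (\<forall>p\<in>L. \<forall>q<N. r p q > 0 \<longrightarrow> q \<in> L)"

definition zero_cut :: "nat \<Rightarrow> matrix \<Rightarrow> (nat \<Rightarrow> int) \<Rightarrow> bool" where
  "zero_cut N r lab \<longleftrightarrow> boolean N lab \<and> lab 0 = 1 \<and> lab 1 = 0 \<and> cut_sum N r (labelled N lab) = 0"

lemma closed_cut:
  assumes "residually_closed N r (labelled N lab)" "nonneg N r"
  shows "cut_sum N r (labelled N lab) = 0"
  unfolding cut_sum_def
proof (intro sum.neutral ballI)
  fix p q assume "p \<in> {..<N}" "q \<in> {..<N}"
  then show "(if p \<in> labelled N lab \<and> q \<notin> labelled N lab then r p q else 0) = 0"
    using assms unfolding residually_closed_def nonneg_def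
    by (metis lessThan_iff order_le_less)
qed

text \<open>A sweep that starts from the labelled set \<open>L\<close> has treated the pairs before \<open>(p, q)\<close>.\<close>

definition sweep :: "nat \<Rightarrow> matrix \<Rightarrow> nat set \<Rightarrow> nat \<Rightarrow> nat \<Rightarrow> (nat \<Rightarrow> int) \<Rightarrow> (nat \<Rightarrow> int) \<Rightarrow> bool" where
  "sweep N r L p q lab par \<longleftrightarrow> (\<exists>k. search_tree N r lab par k) \<and> L \<subseteq> labelled N lab \<and>
     (residually_closed N r L \<longrightarrow> labelled N lab = L) \<and>
     (\<forall>p'\<in>L. \<forall>q'<N. p' < p \<or> p' = p \<and> q' < q \<longrightarrow> r p' q' > 0 \<longrightarrow> q' \<in> labelled N lab)"

lemma sweep_label:
  assumes s: "sweep N r L p q lab par" and "lab p = 1" "lab q = 0" "r p q > 0" "p < N" "q < N"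
  shows "sweep N r L p (Suc q) (lab(q := 1)) (par(q := int p))"
proof -
  have L: "labelled N (lab(q := 1)) = insert q (labelled N lab)" and q: "q \<notin> labelled N lab"
    and p: "p \<in> labelled N lab"
    using assms(2-6) by (auto simp: labelled_def)
  obtain k where "search_tree N r lab par k" using s by (auto simp: sweep_def)
  from search_tree_step[OF this p \<open>q < N\<close> \<open>lab q = 0\<close> \<open>r p q > 0\<close>]
  have "\<exists>k. search_tree N r (lab(q := 1)) (par(q := int p)) k" by blast
  \<comment> \<open>If \<open>L\<close> were closed, nothing would have been labelled outside
    \<open>L\<close> so far; then \<open>p\<close> would lie in \<open>L\<close>, and so would
    \<open>q\<close>, which is not labelled.\<close>
  moreover have "\<not> residually_closed N r L"
    using s p q assms(4,6) unfolding sweep_def residually_closed_def by blast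
  ultimately show ?thesis using s unfolding sweep_def L by (auto simp: less_Suc_eq)
qed

lemma sweep_skip:
  assumes s: "sweep N r L p q lab par" and "\<not> (lab p = 1 \<and> lab q = 0 \<and> r p q > 0)" "p < N" "q < N"
  shows "sweep N r L p (Suc q) lab par"
proof -
  have "q \<in> labelled N lab" if "p \<in> L" "r p q > 0"
  proof -
    have "lab p = 1" using s that by (auto simp: sweep_def labelled_def)
    then have "lab q \<noteq> 0" using assms(2) that by blast
    then show ?thesis using s \<open>q < N\<close> by (auto simp: sweep_def search_tree_def boolean_def labelled_def)
  qed
  then show ?thesis using s unfolding sweep_def by (auto simp: less_Suc_eq)
qed

lemma sweep_row: "sweep N r L p N lab par \<longleftrightarrow> sweep N r L (Suc p) 0 lab par"
  by (auto simp: sweep_def less_Suc_eq)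

text \<open>A sweep that starts from a set that is not closed labels a new node. Hence
  \<open>N\<close> sweeps reach a closed set, and this fixed number replaces a queue of pending
  nodes.\<close>

definition swept :: "nat \<Rightarrow> matrix \<Rightarrow> nat \<Rightarrow> (nat \<Rightarrow> int) \<Rightarrow> (nat \<Rightarrow> int) \<Rightarrow> bool" where
  "swept N r i lab par \<longleftrightarrow> (\<exists>k. search_tree N r lab par k) \<and>
     (residually_closed N r (labelled N lab) \<or> Suc i \<le> card (labelled N lab))"

lemma swept_0: "search_tree N r lab par k \<Longrightarrow> swept N r 0 lab par"
  by (auto simp: swept_def search_tree_def Suc_le_eq card_gt_0_iff)

lemma sweep_start: "swept N r i lab par \<Longrightarrow> sweep N r (labelled N lab) 0 0 lab par"
  by (auto simp: swept_def sweep_def)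

lemma sweep_finish:
  assumes "swept N r i lab par" "sweep N r (labelled N lab) N 0 lab' par'"
  shows "swept N r (Suc i) lab' par'"
proof -
  let ?L = "labelled N lab" and ?L' = "labelled N lab'"
  have "residually_closed N r ?L' \<or> Suc (Suc i) \<le> card ?L'"
  proof (cases "?L' = ?L")
    case True
    have "\<forall>p\<in>?L. p < N" by (simp add: labelled_def)
    with assms(2) show ?thesis unfolding True residually_closed_def sweep_def True by blast
  next
    case False
    with assms(2) have "?L \<subset> ?L'" "\<not> residually_closed N r ?L" by (auto simp: sweep_def)
    then show ?thesis using assms(1) psubset_card_mono[of ?L' ?L] by (auto simp: swept_def)
  qed
  then show ?thesis using assms(2) by (auto simp: swept_def sweep_def)
qed

lemma swept_closed:
  assumes "swept N r N lab par"
  shows "residually_closed N r (labelled N lab)"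
  using assms card_labelled[of N lab] by (auto simp: swept_def)

text \<open>The path has been augmented from the node \<open>v\<close> to the sink 1. Its arcs nearer to the source
  still have positive residual capacity.\<close>

definition augmenting :: "nat \<Rightarrow> matrix \<Rightarrow> (nat \<Rightarrow> int) \<Rightarrow> (nat \<Rightarrow> int) \<Rightarrow> (nat \<Rightarrow> nat) \<Rightarrow> nat \<Rightarrow>
    nat \<Rightarrow> matrix \<Rightarrow> bool" where
  "augmenting N r0 lab par k j v r \<longleftrightarrow> v \<in> labelled N lab \<and> (v \<noteq> 0 \<longrightarrow> k v + j < N) \<and> nonneg N r \<and>
     (\<forall>S. 1 \<notin> S \<longrightarrow> cut_sum N r S + (if v \<in> S then 1 else 0) = cut_sum N r0 S) \<and>
     (\<forall>w\<in>labelled N lab. k w \<le> k v \<longrightarrow> w \<noteq> 0 \<longrightarrow> r (nat (par w)) w > 0)"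

lemma augmenting_init:
  assumes "search_tree N r lab par k" "nonneg N r" "lab 1 = 1" "1 < N"
  shows "augmenting N r lab par k 0 1 r"
  unfolding augmenting_def
proof (intro conjI)
  show "1 \<in> labelled N lab" using assms by (simp add: labelled_def)
  then show "1 \<noteq> 0 \<longrightarrow> k 1 + 0 < N"
    using assms(1) card_labelled[of N lab] unfolding search_tree_def by (metis add_0_right order_less_le_trans)
  show "\<forall>w\<in>labelled N lab. k w \<le> k 1 \<longrightarrow> w \<noteq> 0 \<longrightarrow> r (nat (par w)) w > 0"
    using assms(1) unfolding search_tree_def by (metis nat_int)
qed (use assms in auto)

text \<open>Pushing a unit over the arc from \<open>p\<close> to \<open>v\<close> changes a cut by
  an amount that depends only on which of the two nodes lie in \<open>S\<close>. This is just
  compensated by moving the correction term from \<open>v\<close> to \<open>p\<close>. The remaining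
  arcs of the path are untouched, as their heads have smaller rank than \<open>v\<close>.\<close>

lemma augmenting_step:
  assumes st: "search_tree N r0 lab par k" and a: "augmenting N r0 lab par k j v r" and "v \<noteq> 0"
  defines "p \<equiv> nat (par v)"
  defines "r1 \<equiv> upd2 r p v (r p v - 1)"
  shows "0 \<le> par v" "p < N" "v < N" "augmenting N r0 lab par k (Suc j) p (upd2 r1 v p (r1 v p + 1))"
proof -
  have v: "v \<in> labelled N lab" using a by (simp add: augmenting_def)
  then obtain p' where p': "p' \<in> labelled N lab" "par v = int p'" "k p' < k v"
    using st \<open>v \<noteq> 0\<close> unfolding search_tree_def by blast
  then have p: "p \<in> labelled N lab" "k p < k v" by (simp_all add: p_def)
  show "0 \<le> par v" using p' by simp
  show pN: "p < N" "v < N" using p v by (auto simp: labelled_def)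
  let ?r = "upd2 r1 v p (r1 v p + 1)"
  have pv: "p \<noteq> v" using p by auto
  have rpv: "r p v > 0" using a v \<open>v \<noteq> 0\<close> by (auto simp: augmenting_def p_def)
  have r: "?r p' q' = (if p' = p \<and> q' = v then r p v - 1 else if p' = v \<and> q' = p then r v p + 1 else r p' q')"
    for p' q' using pv by (auto simp: r1_def upd2_def)
  show "augmenting N r0 lab par k (Suc j) p ?r"
    unfolding augmenting_def
  proof (intro conjI allI impI ballI)
    show "nonneg N ?r" using a rpv unfolding augmenting_def nonneg_def r by auto
  next
    fix S :: "nat set" assume "1 \<notin> S"
    have "cut_sum N ?r S = cut_sum N r S + (if p \<in> S \<and> v \<notin> S then - 1 else 0) + (if v \<in> S \<and> p \<notin> S then 1 else 0)"
      unfolding cut_sum_upd[OF pN(2,1)] r1_def cut_sum_upd[OF pN] by auto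
    moreover have "cut_sum N r S + (if v \<in> S then 1 else 0) = cut_sum N r0 S"
      using a \<open>1 \<notin> S\<close> by (auto simp: augmenting_def)
    ultimately show "cut_sum N ?r S + (if p \<in> S then 1 else 0) = cut_sum N r0 S"
      by (auto split: if_splits)
  next
    fix w assume w: "w \<in> labelled N lab" "k w \<le> k p" "w \<noteq> 0"
    then have "r (nat (par w)) w > 0" "w \<noteq> v" using a p by (auto simp: augmenting_def)
    then show "?r (nat (par w)) w > 0" unfolding r by auto
  qed (use a p \<open>v \<noteq> 0\<close> in \<open>auto simp: augmenting_def\<close>)
qed

text \<open>The inequality \<open>k v + N < N\<close> is impossible, so after \<open>N\<close>
  pushes the node reached is the source.\<close>

lemma augmenting_finish:
  assumes "augmenting N r0 lab par k N v r"
  shows "nonneg N r" "\<And>S. 0 \<in> S \<Longrightarrow> 1 \<notin> S \<Longrightarrow> cut_sum N r S + 1 = cut_sum N r0 S"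
proof -
  have "v = 0" using assms by (auto simp: augmenting_def)
  then show "nonneg N r" "\<And>S. 0 \<in> S \<Longrightarrow> 1 \<notin> S \<Longrightarrow> cut_sum N r S + 1 = cut_sum N r0 S"
    using assms by (auto simp: augmenting_def)
qed

text \<open>The residual capacities \<open>r\<close> differ from the capacities \<open>r0\<close> by a flow: no flow is needed,
  it suffices that all cuts change by the same amount.\<close>

definition residual :: "nat \<Rightarrow> matrix \<Rightarrow> matrix \<Rightarrow> bool" where
  "residual N r0 r \<longleftrightarrow> nonneg N r \<and>
     (\<exists>F. \<forall>S. 0 \<in> S \<longrightarrow> 1 \<notin> S \<longrightarrow> cut_sum N r S + F = cut_sum N r0 S)"

text \<open>The progress measure of a phase: until a zero cut is found, some cut loses one unit per
  round. It starts with at most \<open>N * N\<close> units and cannot become negative, whence the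
  number \<open>N * N + 1\<close> of rounds.\<close>

definition augmented :: "nat \<Rightarrow> matrix \<Rightarrow> nat \<Rightarrow> matrix \<Rightarrow> (nat \<Rightarrow> int) \<Rightarrow> bool" where
  "augmented N r0 i r lab \<longleftrightarrow> residual N r0 r \<and>
     (zero_cut N r lab \<or> (\<exists>S. 0 \<in> S \<and> 1 \<notin> S \<and> cut_sum N r S + int i \<le> int (N * N)))"

lemma augmented_step:
  assumes "augmented N r0 i r lab" "nonneg N r'" "1 < N"
    and d: "\<And>S. 0 \<in> S \<Longrightarrow> 1 \<notin> S \<Longrightarrow> cut_sum N r' S + 1 = cut_sum N r S"
  shows "augmented N r0 (Suc i) r' lab'"
proof -
  \<comment> \<open>One more augmentation would turn a cut of residual capacity zero
    negative.\<close>
  have "\<not> zero_cut N r lab"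
  proof
    assume "zero_cut N r lab"
    then have "cut_sum N r' (labelled N lab) + 1 = 0" using d[of "labelled N lab"] \<open>1 < N\<close>
      by (auto simp: zero_cut_def labelled_def)
    with cut_sum_nonneg[OF assms(2), of "labelled N lab"] show False by simp
  qed
  with assms(1) obtain S where S: "0 \<in> S" "1 \<notin> S" "cut_sum N r S + int i \<le> int (N * N)"
    by (auto simp: augmented_def)
  have "cut_sum N r' S + int (Suc i) \<le> int (N * N)" using d[OF S(1,2)] S(3) by linarith
  with S have "\<exists>S. 0 \<in> S \<and> 1 \<notin> S \<and> cut_sum N r' S + int (Suc i) \<le> int (N * N)" by blast
  moreover have "residual N r0 r'"
  proof -
    obtain F where "\<forall>S. 0 \<in> S \<longrightarrow> 1 \<notin> S \<longrightarrow> cut_sum N r S + F = cut_sum N r0 S"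
      using assms(1) by (auto simp: augmented_def residual_def)
    then have "\<forall>S. 0 \<in> S \<longrightarrow> 1 \<notin> S \<longrightarrow> cut_sum N r' S + (F + 1) = cut_sum N r0 S"
      using d by (smt (verit))
    with assms(2) show ?thesis unfolding residual_def by blast
  qed
  ultimately show ?thesis by (simp add: augmented_def)
qed

lemma augmented_stop:
  assumes "augmented N r0 i r lab0" "residually_closed N r (labelled N lab)" "boolean N lab"
    "lab 0 = 1" "lab 1 \<noteq> 1" "1 < N"
  shows "augmented N r0 (Suc i) r lab"
  using assms closed_cut[OF assms(2)] by (auto simp: augmented_def zero_cut_def boolean_def residual_def)

lemma augmented_end:
  assumes "augmented N r0 (N * N + 1) r lab"
  shows "residual N r0 r" "zero_cut N r lab"
proof -
  show r: "residual N r0 r" using assms by (simp add: augmented_def)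
  have "\<not> cut_sum N r S + int (N * N + 1) \<le> int (N * N)" for S
    using cut_sum_nonneg[of N r S] r by (simp add: residual_def)
  then show "zero_cut N r lab" using assms by (auto simp: augmented_def)
qed

text \<open>Halving a weight loses one bit, so the next approximation is twice the previous one plus
  that bit. Doubled residual capacities still vanish on the old zero cut, and the new bits add at
  most one unit for each of the \<open>N * N\<close> pairs of nodes.\<close>

lemma phase_start:
  assumes w: "residual N (\<lambda>p q. w p q div 2 ^ Suc i) r" "0 \<in> S" "1 \<notin> S" "cut_sum N r S = 0"
    and r': "\<And>p q. p < N \<Longrightarrow> q < N \<Longrightarrow> r' p q = 2 * r p q + (w p q div 2 ^ i) mod 2"
  shows "augmented N (\<lambda>p q. w p q div 2 ^ i) 0 r' lab"
proof -
  let ?b = "\<lambda>p q. (w p q div 2 ^ i) mod 2"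
  have *: "cut_sum N r' S = 2 * cut_sum N r S + cut_sum N ?b S" for S
    using cut_sum_cong[of N r' "\<lambda>p q. 2 * r p q + ?b p q"] r'
    by (simp add: cut_sum_add cut_sum_scale)
  have "w p q div 2 ^ i = 2 * (w p q div 2 ^ Suc i) + ?b p q" for p q
    by (simp only: power_Suc2 zdiv_zmult2_eq) (simp add: zdiv_zmult2_eq)
  then have **: "cut_sum N (\<lambda>p q. w p q div 2 ^ i) S =
      2 * cut_sum N (\<lambda>p q. w p q div 2 ^ Suc i) S + cut_sum N ?b S" for S
    unfolding cut_sum_scale [symmetric] cut_sum_add [symmetric] by (intro cut_sum_cong)
  have "\<exists>F. \<forall>S. 0 \<in> S \<longrightarrow> 1 \<notin> S \<longrightarrow> cut_sum N r' S + F = cut_sum N (\<lambda>p q. w p q div 2 ^ i) S"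
  proof -
    obtain F where "\<forall>S. 0 \<in> S \<longrightarrow> 1 \<notin> S \<longrightarrow> cut_sum N r S + F = cut_sum N (\<lambda>p q. w p q div 2 ^ Suc i) S"
      using assms(1) by (auto simp: residual_def)
    then show ?thesis
      using * ** by (intro exI[of _ "2 * F"]) (auto simp: algebra_simps)
  qed
  moreover have "nonneg N r'" using assms(1) r' by (auto simp: residual_def nonneg_def)
  moreover have "cut_sum N r' S \<le> int (N * N)"
  proof -
    have "cut_sum N ?b S \<le> (\<Sum>p<N. \<Sum>q<N. 1)"
      unfolding cut_sum_def by (intro sum_mono) (auto simp: mod2_eq_if)
    then show ?thesis using * assms(4) by simp
  qed
  ultimately show ?thesis using assms(2,3) by (auto simp: augmented_def residual_def)
qed

lemma zero_cut_min:
  assumes "residual N w r" "zero_cut N r lab" "0 \<in> S" "1 \<notin> S" "1 < N"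
  shows "cut_sum N w (labelled N lab) \<le> cut_sum N w S"
proof -
  have L: "0 \<in> labelled N lab" "1 \<notin> labelled N lab" "cut_sum N r (labelled N lab) = 0"
    using assms(2,5) by (auto simp: zero_cut_def labelled_def)
  from assms(1) obtain F where
    F: "\<And>S. 0 \<in> S \<Longrightarrow> 1 \<notin> S \<Longrightarrow> cut_sum N r S + F = cut_sum N w S" and "nonneg N r"
    by (auto simp: residual_def)
  from F[OF L(1,2)] F[OF assms(3,4)] cut_sum_nonneg[OF this(2), of S] L(3) show ?thesis by linarith
qed

section \<open>The minimum cut program and its verification\<close>

definition relax :: com where
  "relax = IfP (Ix Lab (Cst 0) (V Sp)) (IfP (Cst 1 \<^bold>- Ix Lab (Cst 0) (V Sq))
     (IfP (Ix Res (V Sp) (V Sq)) (Put Lab (Cst 0) (V Sq) (Cst 1) ;; Put Par (Cst 0) (V Sq) (V Sp)) Skip) Skip) Skip"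

definition sweep_loop :: com where
  "sweep_loop = For Sp (V SN) (For Sq (V SN) relax)"

definition search :: com where
  "search = For Sp (V SN) (Put Lab (Cst 0) (V Sp) (Cst 0)) ;; Put Lab (Cst 0) (Cst 0) (Cst 1) ;;
     For Si (V SN) sweep_loop"

text \<open>At the source, node 0, nothing happens. Thus the loop over the path can always run
  \<open>N\<close> times, however short the path is.\<close>

definition push :: com where
  "push = IfP (V St) (Asg Sp (Ix Par (Cst 0) (V St)) ;;
     Put Res (V Sp) (V St) (Ix Res (V Sp) (V St) \<^bold>- Cst 1) ;;
     Put Res (V St) (V Sp) (Ix Res (V St) (V Sp) \<^bold>+ Cst 1) ;; Asg St (V Sp)) Skip"

definition augment :: com where
  "augment = IfP (Ix Lab (Cst 0) (Cst 1)) (Asg St (Cst 1) ;; For Si (V SN) push) Skip"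

text \<open>The leading bit is moved from \<open>Wt\<close> to \<open>Res\<close>. Since
  \<open>Wt\<close> keeps only the bits still to come, comparing it with \<open>Spow\<close> is
  enough to find the next bit.\<close>

definition refine :: com where
  "refine = Put Res (V Sp) (V Sq) (Ix Res (V Sp) (V Sq) \<^bold>+ Ix Res (V Sp) (V Sq)) ;;
     IfP (Ix Wt (V Sp) (V Sq) \<^bold>- V Spow \<^bold>+ Cst 1)
       (Put Wt (V Sp) (V Sq) (Ix Wt (V Sp) (V Sq) \<^bold>- V Spow) ;;
        Put Res (V Sp) (V Sq) (Ix Res (V Sp) (V Sq) \<^bold>+ Cst 1)) Skip"

definition phase :: com where
  "phase = Asg Spow (V Spow \<^bold>div Cst 2) ;; For Sp (V SN) (For Sq (V SN) refine) ;;
     For Sa (V Scnt) (search ;; augment)"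

definition scale :: com where
  "scale = Asg Spow (Cst 1) ;; Asg SP (Cst 0) ;;
     Wh (V SZ \<^bold>- V Spow \<^bold>+ Cst 1) (Asg Spow (V Spow \<^bold>+ V Spow) ;; Asg SP (V SP \<^bold>+ Cst 1))"

definition min_cut :: com where
  "min_cut = Asg Scnt (V SN \<^bold>* V SN \<^bold>+ Cst 1) ;; For Sj (V SP) phase"

lemmas solver_defs = relax_def sweep_loop_def search_def push_def augment_def refine_def phase_def

lemma ok_index_less: "p < N \<Longrightarrow> q < N \<Longrightarrow> 2 * int N \<le> 2 ^ b \<Longrightarrow> ok_index b (int p) (int q)"
  by (simp add: ok_index_def)

lemma ok_index_0_less: "q < N \<Longrightarrow> 2 * int N \<le> 2 ^ b \<Longrightarrow> ok_index b 0 (int q)"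
  unfolding ok_index_def by linarith

lemma tc_relax:
  assumes "sweep N r L p q (ar s Lab 0) (ar s Par 0)" "r = ar s Res" "p < N" "q < N"
    "sc s Sp = int p" "sc s Sq = int q" "2 * int N \<le> 2 ^ b"
  shows "tc b relax s 0 (\<lambda>t. sweep N r L p (Suc q) (ar t Lab 0) (ar t Par 0))"
proof -
  have *: "ar s Lab 0 i = 0 \<or> ar s Lab 0 i = 1" if "i < N" for i
    using assms(1) that by (auto simp: sweep_def search_tree_def boolean_def)
  have ok: "ok_index b 0 (int p)" "ok_index b 0 (int q)" "ok_index b (int p) (int q)"
    using assms by (auto intro: ok_index_less ok_index_0_less)
  show ?thesis
  proof (cases "ar s Lab 0 p = 1 \<and> ar s Lab 0 q = 0 \<and> r p q > 0")
    case True
    then show ?thesis using sweep_label[OF assms(1) _ _ _ assms(3,4)] assms ok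
      by (simp add: relax_def)
  next
    case False
    then show ?thesis using sweep_skip[OF assms(1) False assms(3,4)] *[OF assms(3)] *[OF assms(4)] assms ok
      by (auto simp: relax_def)
  qed
qed

lemma tc_sweep_loop:
  assumes "swept N r i (ar s Lab 0) (ar s Par 0)" "r = ar s Res" "sc s SN = int N" "2 * int N \<le> 2 ^ b"
  shows "tc b sweep_loop s (N * (N + 1)) (\<lambda>t. swept N r (Suc i) (ar t Lab 0) (ar t Par 0))"
proof -
  let ?L = "labelled N (ar s Lab 0)"
  show ?thesis unfolding sweep_loop_def
  proof (rule tc_ForI[where k = N and l = N and I = "\<lambda>p t. sweep N r ?L p 0 (ar t Lab 0) (ar t Par 0)"])
    show "sweep N r ?L 0 0 (ar s Lab 0) (ar s Par 0)" using assms(1) by (rule sweep_start)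
  next
    fix p t assume p: "p < N" "sweep N r ?L p 0 (ar t Lab 0) (ar t Par 0)" "sc t Sp = int p"
      and f: "frame (For Sp (V SN) (For Sq (V SN) relax)) s t"
    show "tc b (For Sq (V SN) relax) t N (\<lambda>t. sweep N r ?L (Suc p) 0 (ar t Lab 0) (ar t Par 0))"
    proof (rule tc_ForI[where k = N and l = 0 and I = "\<lambda>q t. sweep N r ?L p q (ar t Lab 0) (ar t Par 0)"])
      fix q t' assume "q < N" "sweep N r ?L p q (ar t' Lab 0) (ar t' Par 0)" "sc t' Sq = int q"
        "frame (For Sq (V SN) relax) t t'"
      then show "tc b relax t' 0 (\<lambda>t. sweep N r ?L p (Suc q) (ar t Lab 0) (ar t Par 0))"
        using p f assms by (intro tc_relax) (auto simp: frame_def relax_def)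
    qed (use p f assms in \<open>auto simp: frame_def relax_def sweep_row [symmetric]\<close>)
  qed (use assms in \<open>auto simp: frame_def relax_def intro: sweep_finish\<close>)
qed

definition search_time :: "nat \<Rightarrow> nat" where
  "search_time N = N + N * (N * (N + 1) + 1)"

lemma tc_search:
  assumes "r = ar s Res" "sc s SN = int N" "2 * int N \<le> 2 ^ b" "0 < N"
  shows "tc b search s (search_time N) (\<lambda>t. (\<exists>k. search_tree N r (ar t Lab 0) (ar t Par 0) k) \<and>
    residually_closed N r (labelled N (ar t Lab 0)))"
    (is "tc b search s _ ?Q")
  unfolding search_def search_time_def
proof (rule tc_Seq)
  show "tc b (For Sp (V SN) (Put Lab (Cst 0) (V Sp) (Cst 0))) s N
      (\<lambda>t. (\<forall>p<N. ar t Lab 0 p = 0) \<and> frame (For Sp (V SN) (Put Lab (Cst 0) (V Sp) (Cst 0))) s t)"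
    by (rule tc_ForI[where k = N and l = 0 and I = "\<lambda>p t. \<forall>p'<p. ar t Lab 0 p' = 0"])
      (use assms in \<open>auto simp: frame_def less_Suc_eq intro: ok_index_0_less\<close>)
next
  fix t :: state assume t: "(\<forall>p<N. ar t Lab 0 p = 0) \<and> frame (For Sp (V SN) (Put Lab (Cst 0) (V Sp) (Cst 0))) s t"
  define t1 where "t1 = set_ar Lab 0 0 1 t"
  have "search_tree N r (ar t1 Lab 0) (ar t1 Par 0) (\<lambda>_. 0)"
    using assms t by (intro search_tree_init) (auto simp: t1_def)
  then have s: "swept N r 0 (ar t1 Lab 0) (ar t1 Par 0)" by (rule swept_0)
  have t1: "r = ar t1 Res" "sc t1 SN = int N" using assms t by (auto simp: t1_def frame_def)
  have "tc b (For Si (V SN) sweep_loop) t1 (N * (N * (N + 1) + 1))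
      ?Q"
  proof (rule tc_ForI[where k = N and l = "N * (N + 1)" and
        I = "\<lambda>i t. swept N r i (ar t Lab 0) (ar t Par 0)"])
    fix i t2 assume "swept N r i (ar t2 Lab 0) (ar t2 Par 0)" "frame (For Si (V SN) sweep_loop) t1 t2"
    then show "tc b sweep_loop t2 (N * (N + 1)) (\<lambda>t. swept N r (Suc i) (ar t Lab 0) (ar t Par 0))"
      using t1 assms by (intro tc_sweep_loop) (auto simp: frame_def solver_defs)
  next
    fix t :: state assume "swept N r N (ar t Lab 0) (ar t Par 0)"
    then show "(\<exists>k. search_tree N r (ar t Lab 0) (ar t Par 0) k) \<and>
        residually_closed N r (labelled N (ar t Lab 0))"
      using swept_closed[of N r "ar t Lab 0" "ar t Par 0"] by (simp add: swept_def)
  next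
    fix t :: state assume "frame (For Si (V SN) sweep_loop) t1 t"
    then show "ok b (V SN) t \<and> ev (V SN) t = int N" using t1 by (simp add: frame_def solver_defs)
  qed (use s in \<open>simp_all add: sweep_loop_def relax_def\<close>)
  then show "tc b (Put Lab (Cst 0) (Cst 0) (Cst 1) ;; For Si (V SN) sweep_loop) t (N * (N * (N + 1) + 1))
      ?Q"
    by (simp add: t1_def ok_index_def)
qed

lemma tc_push:
  assumes st: "search_tree N r0 lab par k" and a: "augmenting N r0 lab par k j (nat (sc s St)) (ar s Res)"
    and "0 \<le> sc s St" "par = ar s Par 0" "2 * int N \<le> 2 ^ b"
  shows "tc b push s 0 (\<lambda>t. 0 \<le> sc t St \<and> augmenting N r0 lab par k (Suc j) (nat (sc t St)) (ar t Res))"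
proof (cases "sc s St = 0")
  case True
  then have "augmenting N r0 lab par k (Suc j) 0 (ar s Res)" using a by (simp add: augmenting_def)
  then show ?thesis using True by (simp add: push_def)
next
  case False
  then have v: "nat (sc s St) \<noteq> 0" using assms(3) by simp
  note * = augmenting_step[OF st a v]
  obtain u p where u: "sc s St = int u" and p: "par u = int p"
    using assms(3) *(1) by (metis nat_eq_iff2 nonneg_int_cases)
  have ok: "ok_index b 0 (int u)" "ok_index b (int p) (int u)" "ok_index b (int u) (int p)"
    using *(2,3) assms(5) u p by (auto intro: ok_index_less ok_index_0_less)
  have "augmenting N r0 lab par k (Suc j) p (upd2 (upd2 (ar s Res) p u (ar s Res p u - 1)) u p
      (upd2 (ar s Res) p u (ar s Res p u - 1) u p + 1))"
    using *(4) by (simp only: u p nat_int)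
  moreover have "ar s Par 0 u = int p" using p assms(4) by simp
  ultimately show ?thesis
    using ok v u by (simp add: push_def del: upd2_apply upd2_row)
qed

lemma tc_augment:
  assumes st: "search_tree N r lab par k" and "nonneg N r" "1 < N" "2 * int N \<le> 2 ^ b"
    and s: "r = ar s Res" "par = ar s Par 0" "lab = ar s Lab 0" "sc s SN = int N"
  shows "tc b augment s N (\<lambda>t. if lab 1 = 1
    then nonneg N (ar t Res) \<and> (\<forall>S. 0 \<in> S \<longrightarrow> 1 \<notin> S \<longrightarrow> cut_sum N (ar t Res) S + 1 = cut_sum N r S)
    else ar t Res = r)"
proof (cases "lab 1 = 1")
  case True
  have "tc b (For Si (V SN) push) (set_sc St 1 s) N (\<lambda>t. nonneg N (ar t Res) \<and>
      (\<forall>S. 0 \<in> S \<longrightarrow> 1 \<notin> S \<longrightarrow> cut_sum N (ar t Res) S + 1 = cut_sum N r S))"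
  proof (rule tc_ForI[where k = N and l = 0 and
        I = "\<lambda>j t. 0 \<le> sc t St \<and> augmenting N r lab par k j (nat (sc t St)) (ar t Res)"])
    fix j t assume "0 \<le> sc t St \<and> augmenting N r lab par k j (nat (sc t St)) (ar t Res)"
      "frame (For Si (V SN) push) (set_sc St 1 s) t"
    then show "tc b push t 0 (\<lambda>t. 0 \<le> sc t St \<and> augmenting N r lab par k (Suc j) (nat (sc t St)) (ar t Res))"
      using s assms(4) by (intro tc_push[OF st]) (auto simp: frame_def push_def)
  next
    fix t :: state assume "0 \<le> sc t St \<and> augmenting N r lab par k N (nat (sc t St)) (ar t Res)"
    then show "nonneg N (ar t Res) \<and>
      (\<forall>S. 0 \<in> S \<longrightarrow> 1 \<notin> S \<longrightarrow> cut_sum N (ar t Res) S + 1 = cut_sum N r S)"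
      using augmenting_finish by blast
  qed (use augmenting_init[OF st assms(2) True assms(3)] s in \<open>auto simp: frame_def push_def\<close>)
  then show ?thesis using True s assms(3,4) by (simp add: augment_def ok_index_def)
next
  case False
  then have "lab 1 = 0" using st assms(3) by (auto simp: search_tree_def boolean_def)
  then show ?thesis using s assms(3,4) by (simp add: augment_def ok_index_def)
qed

lemma tc_round:
  assumes "augmented N r0 i (ar s Res) (ar s Lab 0)" "sc s SN = int N" "2 * int N \<le> 2 ^ b" "1 < N"
  shows "tc b (search ;; augment) s (search_time N + N) (\<lambda>t. augmented N r0 (Suc i) (ar t Res) (ar t Lab 0))"
proof (rule tc_Seq)
  let ?r = "ar s Res"
  show "tc b search s (search_time N) (\<lambda>t. ((\<exists>k. search_tree N ?r (ar t Lab 0) (ar t Par 0) k) \<and>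
    residually_closed N ?r (labelled N (ar t Lab 0))) \<and> frame search s t)"
    using assms by (intro tc_frame tc_search) auto
next
  fix t :: state
  let ?r = "ar s Res" and ?lab = "ar t Lab 0"
  assume "((\<exists>k. search_tree N ?r ?lab (ar t Par 0) k) \<and>
    residually_closed N ?r (labelled N ?lab)) \<and> frame search s t"
  then obtain k where t: "search_tree N ?r ?lab (ar t Par 0) k"
    "residually_closed N ?r (labelled N ?lab)" "frame search s t" by blast
  have nn: "nonneg N ?r" using assms(1) by (simp add: augmented_def residual_def)
  have t': "?r = ar t Res" "sc t SN = int N"
    using t(3) assms(2) by (auto simp: frame_def solver_defs)
  let ?Q = "\<lambda>t'. if ?lab 1 = 1 then nonneg N (ar t' Res) \<and>
        (\<forall>S. 0 \<in> S \<longrightarrow> 1 \<notin> S \<longrightarrow> cut_sum N (ar t' Res) S + 1 = cut_sum N ?r S) else ar t' Res = ?r"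
  have "tc b augment t N ?Q" by (rule tc_augment[OF t(1) nn assms(4,3) t'(1) refl refl t'(2)])
  from tc_frame[OF this]
  show "tc b augment t N (\<lambda>t. augmented N r0 (Suc i) (ar t Res) (ar t Lab 0))"
  proof (rule tc_conseq[where R = "\<lambda>t'. ?Q t' \<and> frame augment t t'"])
    fix t' :: state assume t': "?Q t' \<and> frame augment t t'"
    then have lab: "ar t' Lab 0 = ?lab" by (simp add: frame_def solver_defs)
    show "augmented N r0 (Suc i) (ar t' Res) (ar t' Lab 0)"
    proof (cases "?lab 1 = 1")
      case True
      then show ?thesis using augmented_step[OF assms(1) _ assms(4)] t' by simp
    next
      case False
      have "boolean N ?lab" "?lab 0 = 1" using t(1) by (auto simp: search_tree_def labelled_def)
      with augmented_stop[OF assms(1) t(2) _ _ False assms(4)] False t' show ?thesis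
        unfolding lab by simp
    qed
  qed simp
qed

definition refined :: "nat \<Rightarrow> nat \<Rightarrow> matrix \<Rightarrow> matrix \<Rightarrow> nat \<Rightarrow> nat \<Rightarrow>
    matrix \<Rightarrow> matrix \<Rightarrow> bool" where
  "refined N i w r p q w' r' \<longleftrightarrow> (\<forall>p'<N. \<forall>q'<N. if p' < p \<or> p' = p \<and> q' < q
     then r' p' q' = 2 * r p' q' + w p' q' div 2 ^ i \<and> w' p' q' = w p' q' mod 2 ^ i
     else r' p' q' = r p' q' \<and> w' p' q' = w p' q')"

lemma refined_row: "refined N i w r p N w' r' \<longleftrightarrow> refined N i w r (Suc p) 0 w' r'"
proof -
  have "p' < p \<or> p' = p \<and> q' < N \<longleftrightarrow> p' < Suc p \<or> p' = Suc p \<and> q' < 0" if "q' < N" for p' q'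
    using that by auto
  then show ?thesis unfolding refined_def by simp
qed

lemma tc_refine:
  assumes "refined N i w r p q (ar s Wt) (ar s Res)" "p < N" "q < N" "2 * int N \<le> 2 ^ b"
    "sc s Sp = int p" "sc s Sq = int q" "sc s Spow = 2 ^ i" "0 \<le> w p q" "w p q < 2 ^ Suc i"
  shows "tc b refine s 0 (\<lambda>t. refined N i w r p (Suc q) (ar t Wt) (ar t Res))"
proof -
  have ok: "ok_index b (int p) (int q)" using assms(2-4) by (rule ok_index_less)
  have eq: "ar s Res p q = r p q" "ar s Wt p q = w p q" using assms(1-3) by (auto simp: refined_def)
  have dm: "w p q div 2 ^ i = (if 2 ^ i \<le> w p q then 1 else 0)"
      "w p q mod 2 ^ i = (if 2 ^ i \<le> w p q then w p q - 2 ^ i else w p q)"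
  proof -
    have "w p q div 2 ^ i = 1" "w p q mod 2 ^ i = w p q - 2 ^ i" if "2 ^ i \<le> w p q"
    proof -
      have "w p q = (w p q - 2 ^ i) + 1 * 2 ^ i" "w p q - 2 ^ i < 2 ^ i" using assms(9) by auto
      with that show "w p q div 2 ^ i = 1" "w p q mod 2 ^ i = w p q - 2 ^ i"
        by (metis add.commute add_0 diff_ge_0_iff_ge div_mult_self1 div_pos_pos_trivial zero_less_numeral
            zero_less_power less_irrefl power_not_zero zero_neq_numeral,
          metis diff_ge_0_iff_ge mod_mult_self1 mod_pos_pos_trivial)
    qed
    then show "w p q div 2 ^ i = (if 2 ^ i \<le> w p q then 1 else 0)"
      "w p q mod 2 ^ i = (if 2 ^ i \<le> w p q then w p q - 2 ^ i else w p q)"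
      using assms(8) by auto
  qed
  have step: "refined N i w r p (Suc q) w' r'"
    if "r' p q = 2 * r p q + w p q div 2 ^ i" "w' p q = w p q mod 2 ^ i"
      "\<And>p' q'. (p', q') \<noteq> (p, q) \<Longrightarrow> r' p' q' = ar s Res p' q' \<and> w' p' q' = ar s Wt p' q'" for w' r'
    unfolding refined_def
  proof (intro allI impI)
    fix p' q' assume *: "p' < N" "q' < N"
    show "if p' < p \<or> p' = p \<and> q' < Suc q
       then r' p' q' = 2 * r p' q' + w p' q' div 2 ^ i \<and> w' p' q' = w p' q' mod 2 ^ i
       else r' p' q' = r p' q' \<and> w' p' q' = w p' q'"
    proof (cases "(p', q') = (p, q)")
      case True
      then show ?thesis using that(1,2) by auto
    next
      case False
      then have "p' < p \<or> p' = p \<and> q' < Suc q \<longleftrightarrow> p' < p \<or> p' = p \<and> q' < q" by (auto simp: less_Suc_eq)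
      with assms(1) * that(3)[OF False] show ?thesis by (auto simp: refined_def)
    qed
  qed
  show ?thesis
  proof (cases "2 ^ i \<le> w p q")
    case True
    then show ?thesis using ok assms(5-7) unfolding refine_def
      by (simp add: eq del: upd2_row) (rule step, auto simp: dm eq)
  next
    case False
    then show ?thesis using ok assms(5-7) unfolding refine_def
      by (simp add: eq del: upd2_row) (rule step, auto simp: dm eq)
  qed
qed

definition phase_time :: "nat \<Rightarrow> nat" where
  "phase_time N = N * (N + 1) + (N * N + 1) * (search_time N + N + 1)"

lemma tc_phase:
  assumes "sc s SN = int N" "sc s Scnt = int (N * N + 1)" "sc s Spow = 2 ^ Suc i" "2 * int N \<le> 2 ^ b" "1 < N"
    and w: "\<And>p q. p < N \<Longrightarrow> q < N \<Longrightarrow> ar s Wt p q = w p q mod 2 ^ Suc i"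
    and r: "residual N (\<lambda>p q. w p q div 2 ^ Suc i) (ar s Res)" "0 \<in> S" "1 \<notin> S" "cut_sum N (ar s Res) S = 0"
  shows "tc b phase s (phase_time N) (\<lambda>t. sc t Spow = 2 ^ i \<and>
    (\<forall>p<N. \<forall>q<N. ar t Wt p q = w p q mod 2 ^ i) \<and>
    residual N (\<lambda>p q. w p q div 2 ^ i) (ar t Res) \<and> zero_cut N (ar t Res) (ar t Lab 0))"
    (is "tc b phase s _ ?Q")
proof -
  define s1 where "s1 = set_sc Spow (2 ^ i) s"
  let ?w = "ar s Wt" and ?r = "ar s Res"
  let ?loop1 = "For Sp (V SN) (For Sq (V SN) refine)"
  let ?loop2 = "For Sa (V Scnt) (search ;; augment)"
  have s1: "sc s1 SN = int N" "sc s1 Spow = 2 ^ i" "sc s1 Scnt = int (N * N + 1)" "ar s1 = ar s"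
    using assms by (auto simp: s1_def)
  have "tc b ?loop1 s1 (N * (N + 1)) (\<lambda>t. refined N i ?w ?r N 0 (ar t Wt) (ar t Res) \<and> frame ?loop1 s1 t)"
  proof (rule tc_ForI[where k = N and l = N and I = "\<lambda>p t. refined N i ?w ?r p 0 (ar t Wt) (ar t Res)"])
    fix p and t :: state assume p: "p < N" "refined N i ?w ?r p 0 (ar t Wt) (ar t Res)" "sc t Sp = int p"
      and f: "frame ?loop1 s1 t"
    show "tc b (For Sq (V SN) refine) t N (\<lambda>t. refined N i ?w ?r (Suc p) 0 (ar t Wt) (ar t Res))"
    proof (rule tc_ForI[where k = N and l = 0 and I = "\<lambda>q t. refined N i ?w ?r p q (ar t Wt) (ar t Res)"])
      fix q and t' :: state assume q: "q < N" "refined N i ?w ?r p q (ar t' Wt) (ar t' Res)" "sc t' Sq = int q"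
        "frame (For Sq (V SN) refine) t t'"
      show "tc b refine t' 0 (\<lambda>t. refined N i ?w ?r p (Suc q) (ar t Wt) (ar t Res))"
        using w[OF p(1) q(1)]
        by (intro tc_refine[OF q(2) p(1) q(1) assms(4)]) (use p q f s1 in \<open>auto simp: frame_def refine_def\<close>)
    qed (use p f s1 in \<open>auto simp: frame_def refine_def refined_row [symmetric]\<close>)
  qed (use s1 in \<open>auto simp: frame_def refine_def refined_def\<close>)
  then have "tc b (?loop1 ;; ?loop2) s1 (phase_time N) ?Q"
    unfolding phase_time_def
  proof (rule tc_Seq)
    fix t :: state assume "refined N i ?w ?r N 0 (ar t Wt) (ar t Res) \<and> frame ?loop1 s1 t"
    then have t: "refined N i ?w ?r N 0 (ar t Wt) (ar t Res)" "sc t SN = int N" "sc t Spow = 2 ^ i"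
      "sc t Scnt = int (N * N + 1)"
      using s1 by (auto simp: frame_def refine_def)
    \<comment> \<open>What is left in \<open>Wt\<close> determines both the bit used in this phase
      and the remainder for the later ones.\<close>
    have m: "w p q mod 2 ^ Suc i = 2 ^ i * ((w p q div 2 ^ i) mod 2) + w p q mod 2 ^ i" for p q
      by (simp only: power_Suc2) (simp add: zmod_zmult2_eq)
    have W: "ar t Wt p q = w p q mod 2 ^ i" "ar t Res p q = 2 * ?r p q + (w p q div 2 ^ i) mod 2"
      if "p < N" "q < N" for p q
      using t(1) that w[OF that] unfolding refined_def m by simp_all
    have start: "augmented N (\<lambda>p q. w p q div 2 ^ i) 0 (ar t Res) (ar t Lab 0)"
      by (rule phase_start[OF r]) (use W in auto)
    show "tc b ?loop2 t ((N * N + 1) * (search_time N + N + 1)) ?Q"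
    proof (rule tc_ForI[where k = "N * N + 1" and l = "search_time N + N" and
          I = "\<lambda>j t. augmented N (\<lambda>p q. w p q div 2 ^ i) j (ar t Res) (ar t Lab 0)"])
      fix j and t' :: state assume j: "augmented N (\<lambda>p q. w p q div 2 ^ i) j (ar t' Res) (ar t' Lab 0)"
        and f: "frame ?loop2 t t'"
      have "sc t' SN = int N" using f t by (auto simp: frame_def solver_defs)
      then show "tc b (search ;; augment) t' (search_time N + N)
          (\<lambda>t. augmented N (\<lambda>p q. w p q div 2 ^ i) (Suc j) (ar t Res) (ar t Lab 0))"
        using tc_round[OF j _ assms(4,5)] by blast
    next
      fix t' :: state assume "augmented N (\<lambda>p q. w p q div 2 ^ i) (N * N + 1) (ar t' Res) (ar t' Lab 0)"
        and f: "frame ?loop2 t t'"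
      with augmented_end show "sc t' Spow = 2 ^ i \<and>
        (\<forall>p<N. \<forall>q<N. ar t' Wt p q = w p q mod 2 ^ i) \<and>
        residual N (\<lambda>p q. w p q div 2 ^ i) (ar t' Res) \<and> zero_cut N (ar t' Res) (ar t' Lab 0)"
        using f t W by (auto simp: frame_def solver_defs)
    next
      fix t' :: state assume "frame ?loop2 t t'"
      then show "ok b (V Scnt) t' \<and> ev (V Scnt) t' = int (N * N + 1)"
        using t(4) by (simp add: frame_def solver_defs)
    qed (use start in \<open>simp_all add: solver_defs search_def augment_def\<close>)
  qed
  moreover have "sc s Spow div 2 = 2 ^ i" using assms(3) by simp
  ultimately show ?thesis by (simp add: phase_def s1_def)
qed

lemma tc_min_cut:
  assumes s: "sc s SN = int N" "sc s SP = int P" "sc s Spow = 2 ^ P"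
    and "2 * int N \<le> 2 ^ b" "1 < N" "0 < P"
    and w: "\<And>p q. p < N \<Longrightarrow> q < N \<Longrightarrow> 0 \<le> ar s Wt p q \<and> ar s Wt p q < 2 ^ P"
    and r: "\<And>p q. p < N \<Longrightarrow> q < N \<Longrightarrow> ar s Res p q = 0"
  shows "tc b min_cut s (P * (phase_time N + 1)) (\<lambda>t. boolean N (ar t Lab 0) \<and> ar t Lab 0 0 = 1 \<and>
    ar t Lab 0 1 = 0 \<and> (\<forall>S. 0 \<in> S \<longrightarrow> 1 \<notin> S \<longrightarrow>
      cut_sum N (ar s Wt) (labelled N (ar t Lab 0)) \<le> cut_sum N (ar s Wt) S))"
    (is "tc b min_cut s _ ?Q")
proof -
  define s1 where "s1 = set_sc Scnt (int (N * N + 1)) s"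
  let ?w = "ar s Wt"
  \<comment> \<open>Before the first phase the labels are meaningless, so a zero cut is then only
    required to exist; all residual capacities vanish and \<open>{0}\<close> serves. As
    \<open>P\<close> is positive, the final labels do form a zero cut.\<close>
  let ?I = "\<lambda>j t. sc t Spow = 2 ^ (P - j) \<and> (\<forall>p<N. \<forall>q<N. ar t Wt p q = ?w p q mod 2 ^ (P - j)) \<and>
     residual N (\<lambda>p q. ?w p q div 2 ^ (P - j)) (ar t Res) \<and>
     (\<exists>S. 0 \<in> S \<and> 1 \<notin> S \<and> cut_sum N (ar t Res) S = 0) \<and> (0 < j \<longrightarrow> zero_cut N (ar t Res) (ar t Lab 0))"
  have Z: "cut_sum N (ar s Res) S = 0" for S
    using r unfolding cut_sum_def by (intro sum.neutral ballI) simp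
  have Z': "cut_sum N (\<lambda>p q. ?w p q div 2 ^ P) S = 0" for S
    using w unfolding cut_sum_def by (intro sum.neutral ballI) simp
  have "tc b (For Sj (V SP) phase) s1 (P * (phase_time N + 1)) ?Q"
  proof (rule tc_ForI[where k = P and l = "phase_time N" and I = ?I])
    show "?I 0 s1"
    proof (intro conjI)
      show "\<exists>S. 0 \<in> S \<and> 1 \<notin> S \<and> cut_sum N (ar s1 Res) S = 0"
        using Z by (intro exI[of _ "{0}"]) (simp add: s1_def)
      show "residual N (\<lambda>p q. ?w p q div 2 ^ (P - 0)) (ar s1 Res)"
        using Z Z' r by (auto simp: residual_def nonneg_def s1_def)
    qed (use s w in \<open>auto simp: s1_def\<close>)
  next
    fix j and t :: state assume j: "j < P" "?I j t" and f: "frame (For Sj (V SP) phase) s1 t"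
    then obtain S where S: "0 \<in> S" "1 \<notin> S" "cut_sum N (ar t Res) S = 0" by blast
    have Pj: "P - j = Suc (P - Suc j)" using j by simp
    have "sc t SN = int N" "sc t Scnt = int (N * N + 1)"
      using f s by (auto simp: frame_def s1_def solver_defs search_def augment_def)
    then have "tc b phase t (phase_time N) (\<lambda>t. sc t Spow = 2 ^ (P - Suc j) \<and>
      (\<forall>p<N. \<forall>q<N. ar t Wt p q = ?w p q mod 2 ^ (P - Suc j)) \<and>
      residual N (\<lambda>p q. ?w p q div 2 ^ (P - Suc j)) (ar t Res) \<and> zero_cut N (ar t Res) (ar t Lab 0))"
      using j S by (intro tc_phase[OF _ _ _ assms(4,5)]) (auto simp: Pj)
    then show "tc b phase t (phase_time N) (?I (Suc j))"
    proof (rule tc_conseq)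
      fix t' :: state assume *: "sc t' Spow = 2 ^ (P - Suc j) \<and>
        (\<forall>p<N. \<forall>q<N. ar t' Wt p q = ?w p q mod 2 ^ (P - Suc j)) \<and>
        residual N (\<lambda>p q. ?w p q div 2 ^ (P - Suc j)) (ar t' Res) \<and> zero_cut N (ar t' Res) (ar t' Lab 0)"
      then have "0 \<in> labelled N (ar t' Lab 0)" "1 \<notin> labelled N (ar t' Lab 0)"
        "cut_sum N (ar t' Res) (labelled N (ar t' Lab 0)) = 0"
        using assms(5) by (auto simp: zero_cut_def labelled_def)
      with * show "?I (Suc j) t'" by blast
    qed simp
  next
    fix t :: state assume "?I P t"
    then have "residual N ?w (ar t Res)" "zero_cut N (ar t Res) (ar t Lab 0)"
      using \<open>0 < P\<close> by simp_all
    then show "boolean N (ar t Lab 0) \<and> ar t Lab 0 0 = 1 \<and> ar t Lab 0 1 = 0 \<and>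
      (\<forall>S. 0 \<in> S \<longrightarrow> 1 \<notin> S \<longrightarrow> cut_sum N ?w (labelled N (ar t Lab 0)) \<le> cut_sum N ?w S)"
      using zero_cut_min[OF _ _ _ _ assms(5)] by (auto simp: zero_cut_def)
  next
    fix t :: state assume "frame (For Sj (V SP) phase) s1 t"
    then show "ok b (V SP) t \<and> ev (V SP) t = int P"
      using s by (simp add: frame_def s1_def solver_defs search_def augment_def)
  qed (simp_all add: solver_defs search_def augment_def)
  moreover have "\<bar>sc s SN\<bar> \<le> 2 ^ b" using assms(4) unfolding s(1) by linarith
  ultimately show ?thesis using s(1) by (simp add: min_cut_def s1_def add.commute)
qed

lemma tc_scale:
  assumes "1 \<le> sc s SZ" "sc s SZ \<le> 2 ^ B"
  shows "tc b scale s (B + 1) (\<lambda>t. \<exists>P>0. P \<le> B + 1 \<and> sc t SP = int P \<and> sc t Spow = 2 ^ P \<and> sc s SZ < 2 ^ P)"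
proof -
  let ?Z = "sc s SZ"
  define P where "P = (LEAST P. ?Z < 2 ^ P)"
  have "(2::int) ^ B < 2 ^ (B + 1)" by simp
  then have ex: "?Z < 2 ^ (B + 1)" using assms(2) by linarith
  have P: "?Z < 2 ^ P" unfolding P_def by (rule LeastI[of "\<lambda>P. ?Z < 2 ^ P", OF ex])
  have less: "2 ^ j \<le> ?Z" if "j < P" for j
    using not_less_Least[OF that[unfolded P_def]] by simp
  then have less: "0 < 1 + (?Z - 2 ^ j)" if "j < P" for j
    using that by (simp add: add_pos_nonneg)
  have "P \<le> B + 1" unfolding P_def by (rule Least_le[of "\<lambda>P. ?Z < 2 ^ P", OF ex])
  moreover have "0 < P" using P assms(1) by (cases P) auto
  moreover have "tc b (Wh (V SZ \<^bold>- V Spow \<^bold>+ Cst 1) (Asg Spow (V Spow \<^bold>+ V Spow) ;; Asg SP (V SP \<^bold>+ Cst 1)))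
      (set_sc SP 0 (set_sc Spow 1 s)) (P * (0 + 1))
      (\<lambda>t. sc t SP = int P \<and> sc t Spow = 2 ^ P \<and> sc t SZ = ?Z)"
    by (rule tc_While[where I = "\<lambda>j t. sc t SP = int j \<and> sc t Spow = 2 ^ j \<and> sc t SZ = ?Z"])
      (use P less in \<open>auto simp: add.commute\<close>)
  ultimately have "tc b (Wh (V SZ \<^bold>- V Spow \<^bold>+ Cst 1) (Asg Spow (V Spow \<^bold>+ V Spow) ;; Asg SP (V SP \<^bold>+ Cst 1)))
      (set_sc SP 0 (set_sc Spow 1 s)) (B + 1)
      (\<lambda>t. \<exists>P>0. P \<le> B + 1 \<and> sc t SP = int P \<and> sc t Spow = 2 ^ P \<and> ?Z < 2 ^ P)"
    using P by (elim tc_conseq) auto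
  then show ?thesis by (simp add: scale_def)
qed

section \<open>The relaxed problem on a star\<close>

lemma sum_rotate: "(\<Sum>l\<in>C. \<Sum>u\<in>A. \<Sum>v\<in>B. f l u v) = (\<Sum>u\<in>A. \<Sum>v\<in>B. \<Sum>l\<in>C. f l u v)"
  by (subst sum.swap, rule sum.cong[OF refl], rule sum.swap)

lemma cut_sum_submodular:
  assumes "nonneg N x"
  shows "cut_sum N x (A \<inter> B) + cut_sum N x (A \<union> B) \<le> cut_sum N x A + cut_sum N x B"
  unfolding cut_sum_def sum.distrib [symmetric]
  using assms by (intro sum_mono) (auto simp: nonneg_def)

definition dcut :: "nat \<Rightarrow> matrix \<Rightarrow> int \<Rightarrow> int \<Rightarrow> nat set \<Rightarrow> int" where
  "dcut N x a b X = a * cut_sum N x X + b * cut_sum N x (- X)"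

lemma dcut_alt: "dcut N x a b X = (\<Sum>u<N. \<Sum>v<N. x u v *
    ((if u \<in> X \<and> v \<notin> X then a else 0) + (if u \<notin> X \<and> v \<in> X then b else 0)))"
  unfolding dcut_def cut_sum_def sum_distrib_left sum.distrib [symmetric]
  by (intro sum.cong) auto

text \<open>From \<open>a * a' = b * b'\<close> the pair \<open>(a', b')\<close> is proportional to
  the swapped pair \<open>(b, a)\<close>. Submodularity for \<open>Z\<close> and \<open>- Y\<close>,
  weighted by \<open>a\<close>, and for \<open>Y\<close> and \<open>- Z\<close>, weighted by
  \<open>b\<close>, add up to posi-modularity of the cut of \<open>Z\<close> with weights
  \<open>(a, b)\<close> and the cut of \<open>Y\<close> with weights \<open>(b, a)\<close>. The
  latter is a positive multiple of the cut in the hypothesis, which therefore cancels.\<close>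

lemma dcut_diff_le:
  assumes x: "nonneg N x" and pos: "0 \<le> a" "0 \<le> b" "0 \<le> a'" "0 \<le> b'" "0 < a + b" "0 < a' + b'"
    and eq: "a * a' = b * b'" and le: "dcut N x a' b' Y \<le> dcut N x a' b' (Y - Z)"
  shows "dcut N x a b (Z - Y) \<le> dcut N x a b Z"
proof -
  let ?c = "cut_sum N x"
  have 1: "?c (Z - Y) + ?c (- (Y - Z)) \<le> ?c Z + ?c (- Y)"
    using cut_sum_submodular[OF x, of Z "- Y"] by (simp add: Diff_eq Int_commute Un_commute)
  have 2: "?c (Y - Z) + ?c (- (Z - Y)) \<le> ?c Y + ?c (- Z)"
    using cut_sum_submodular[OF x, of Y "- Z"] by (simp add: Diff_eq Int_commute Un_commute)
  have le2: "a * (?c (Z - Y) + ?c (- (Y - Z))) + b * (?c (Y - Z) + ?c (- (Z - Y)))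
      \<le> a * (?c Z + ?c (- Y)) + b * (?c Y + ?c (- Z))"
    by (rule add_mono[OF mult_left_mono[OF 1 pos(1)] mult_left_mono[OF 2 pos(2)]])
  have swap: "(a + b) * dcut N x a' b' X = (a' + b') * (b * ?c X + a * ?c (- X))" for X
  proof -
    have "(a + b) * a' = (a' + b') * b" "(a + b) * b' = (a' + b') * a"
      using eq by (simp_all add: algebra_simps)
    then show ?thesis unfolding dcut_def by (metis (no_types, opaque_lifting) distrib_left mult.assoc)
  qed
  have "(a' + b') * (b * ?c Y + a * ?c (- Y)) \<le> (a' + b') * (b * ?c (Y - Z) + a * ?c (- (Y - Z)))"
    unfolding swap [symmetric] using le pos by (intro mult_left_mono) auto
  then have "b * ?c Y + a * ?c (- Y) \<le> b * ?c (Y - Z) + a * ?c (- (Y - Z))"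
    using pos by simp
  with le2 show ?thesis unfolding dcut_def by (simp add: distrib_left)
qed

text \<open>Vertices are numbers below \<open>nv\<close>, the terminals being the first
  \<open>k\<close>, and \<open>x\<close> holds the costs after scaling to integers. Weights 0 at the
  center \<open>c0\<close> make the distance formula for two leaves correct for the center too. The
  sides are given by \<open>ty\<close>.\<close>

locale star_instance =
  fixes nv k K c0 :: nat and lf :: "nat \<Rightarrow> nat" and a b :: "nat \<Rightarrow> int" and ty :: "nat \<Rightarrow> bool"
    and x :: "nat \<Rightarrow> nat \<Rightarrow> int"
  assumes k: "k \<le> nv" and c0: "c0 < k" "a c0 = 0" "b c0 = 0"
    and lf: "bij_betw lf {..<K} ({..<k} - {c0})"
    and ab: "\<And>l. l < K \<Longrightarrow> 0 \<le> a (lf l)" "\<And>l. l < K \<Longrightarrow> 0 \<le> b (lf l)" "\<And>l. l < K \<Longrightarrow> 0 < a (lf l) + b (lf l)"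
    and side: "\<And>l m. l < K \<Longrightarrow> m < K \<Longrightarrow> l \<noteq> m \<Longrightarrow> ty l = ty m \<Longrightarrow> a (lf l) * a (lf m) = b (lf l) * b (lf m)"
    and x: "nonneg nv x"
begin

definition cost :: "(nat \<Rightarrow> nat) \<Rightarrow> int" where
  "cost y = (\<Sum>u<nv. \<Sum>v<nv. x u v * (if y u = y v then 0 else a (y u) + b (y v)))"

abbreviation g :: "nat \<Rightarrow> nat set \<Rightarrow> int" where
  "g l \<equiv> dcut nv x (a (lf l)) (b (lf l))"

definition labelling :: "(nat \<Rightarrow> nat) \<Rightarrow> bool" where
  "labelling y \<longleftrightarrow> (\<forall>u<nv. y u < k) \<and> (\<forall>u<k. y u = u)"

text \<open>A pair with different labels pays \<open>a\<close> in the cut of the label of its tail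
  and \<open>b\<close> in the cut of the label of its head. The set of the center may be left out
  because its weights are 0.\<close>

lemma cost_eq:
  assumes "labelling y"
  shows "cost y = (\<Sum>l<K. g l {u. u < nv \<and> y u = lf l})"
proof -
  have "(if y u = y v then 0 else a (y u) + b (y v)) =
      (\<Sum>l<K. (if y u = lf l \<and> y v \<noteq> lf l then a (lf l) else 0) + (if y u \<noteq> lf l \<and> y v = lf l then b (lf l) else 0))"
    if "u < nv" "v < nv" for u v
  proof -
    let ?h = "\<lambda>i. (if y u = i \<and> y v \<noteq> i then a i else 0) + (if y u \<noteq> i \<and> y v = i then b i else 0)"
    have "(\<Sum>l<K. ?h (lf l)) = (\<Sum>i\<in>{..<k} - {c0}. ?h i)"
      by (rule sum.reindex_bij_betw[OF lf])
    also have "\<dots> = (\<Sum>i<k. ?h i)"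
      using c0 by (intro sum.mono_neutral_left) auto
    also have "\<dots> = (if y u = y v then 0 else a (y u) + b (y v))"
    proof -
      have "y u < k" "y v < k" using assms that by (auto simp: labelling_def)
      then have "(\<Sum>i<k. if y u = i \<and> y v \<noteq> i then a i else 0) = (if y u = y v then 0 else a (y u))"
        "(\<Sum>i<k. if y u \<noteq> i \<and> y v = i then b i else 0) = (if y u = y v then 0 else b (y v))"
        using sum.delta'[of "{..<k}" "y u" "\<lambda>i. if y v = i then 0 else a i"]
          sum.delta'[of "{..<k}" "y v" "\<lambda>i. if y u = i then 0 else b i"]
        by (auto intro!: sum.neutral simp: if_distrib cong: if_cong sum.cong elim!: trans [rotated] intro!: sum.cong)
      then show ?thesis by (simp add: sum.distrib)
    qed
    finally show ?thesis by simp
  qed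
  then have "cost y = (\<Sum>u<nv. \<Sum>v<nv. \<Sum>l<K. x u v *
      ((if y u = lf l \<and> y v \<noteq> lf l then a (lf l) else 0) + (if y u \<noteq> lf l \<and> y v = lf l then b (lf l) else 0)))"
    unfolding cost_def sum_distrib_left [symmetric] by (intro sum.cong) auto
  also have "\<dots> = (\<Sum>l<K. g l {u. u < nv \<and> y u = lf l})"
    unfolding dcut_alt by (rule trans[OF _ sum_rotate [symmetric]]) (intro sum.cong, auto)
  finally show ?thesis .
qed

text \<open>The relaxation: only sets of leaves on different sides have to be disjoint.\<close>

definition admissible :: "(nat \<Rightarrow> nat set) \<Rightarrow> bool" where
  "admissible X \<longleftrightarrow> (\<forall>l<K. X l \<subseteq> {..<nv} \<and> (\<forall>u<k. u \<in> X l \<longleftrightarrow> u = lf l)) \<and>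
     (\<forall>l<K. \<forall>m<K. ty l \<noteq> ty m \<longrightarrow> X l \<inter> X m = {})"

definition total :: "(nat \<Rightarrow> nat set) \<Rightarrow> int" where
  "total X = (\<Sum>l<K. g l (X l))"

lemma lf_less: "l < K \<Longrightarrow> lf l < k" "l < K \<Longrightarrow> lf l \<noteq> c0"
  using lf by (auto simp: bij_betw_def)

lemma lf_inject: "l < K \<Longrightarrow> m < K \<Longrightarrow> lf l = lf m \<longleftrightarrow> l = m"
  using lf by (auto simp: bij_betw_def inj_on_def)

lemma labelling_admissible:
  assumes "labelling y"
  shows "admissible (\<lambda>l. {u. u < nv \<and> y u = lf l})"
  using assms k lf_inject by (auto simp: admissible_def labelling_def)

lemma admissible_disjoint:
  "admissible X \<Longrightarrow> l < K \<Longrightarrow> m < K \<Longrightarrow> ty l \<noteq> ty m \<Longrightarrow> u \<in> X l \<Longrightarrow> u \<notin> X m"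
  unfolding admissible_def by blast

section \<open>Uncrossing an optimal solution of the relaxation\<close>

lemma minimal_subset:
  assumes adm: "admissible X" and min: "\<And>X'. admissible X' \<Longrightarrow> total X \<le> total X'"
    and m: "m < K" "Z \<subseteq> X m" "lf m \<in> Z"
  shows "g m (X m) \<le> g m Z"
proof -
  have "u \<in> Z \<longleftrightarrow> u = lf m" if "u < k" for u
    using adm m that by (auto simp: admissible_def)
  then have "admissible (X(m := Z))"
    using adm m(1,2) unfolding admissible_def by (auto split: if_splits) blast+
  from min[OF this] have "(\<Sum>l<K. g l (X l)) \<le> (\<Sum>l<K. g l ((X(m := Z)) l))" by (simp add: total_def)
  also have "\<dots> = g m Z + (\<Sum>l\<in>{..<K} - {m}. g l (X l))"
    using m(1) by (subst sum.remove[of _ m]) (auto intro!: sum.cong)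
  also have "(\<Sum>l<K. g l (X l)) = g m (X m) + (\<Sum>l\<in>{..<K} - {m}. g l (X l))"
    using m(1) by (subst sum.remove[of _ m]) auto
  finally show ?thesis by simp
qed

text \<open>Every removal appeals to the minimality of the original family: shrinking
  \<open>X m\<close> to \<open>X m - Z\<close> cannot help, whatever \<open>Z\<close> has become,
  and this is the hypothesis of \<open>dcut_diff_le\<close>. Across the sides there is nothing to
  remove.\<close>

lemma minimal_disjoint:
  assumes adm: "admissible X" and min: "\<And>X'. admissible X' \<Longrightarrow> total X \<le> total X'"
    and l: "l < K" and W: "finite W" "W \<subseteq> {..<K} - {l}"
  shows "g l (X l - (\<Union>m\<in>W. X m)) \<le> g l (X l)"
  using W
proof (induction W rule: finite_induct)
  case (insert m W)
  let ?Z = "X l - (\<Union>m\<in>W. X m)"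
  have m: "m < K" "m \<noteq> l" using insert.prems by auto
  have "g l (?Z - X m) \<le> g l ?Z"
  proof (cases "ty l = ty m")
    case True
    have "lf m \<in> X m - ?Z" using adm m l lf_less[OF m(1)] lf_inject[of m l] by (auto simp: admissible_def)
    from minimal_subset[OF adm min m(1) _ this] have "g m (X m) \<le> g m (X m - ?Z)" by blast
    then show ?thesis
      using ab[OF l] ab[OF m(1)] side[OF l m(1) _ True] m(2) by (intro dcut_diff_le[OF x]) auto
  next
    case False
    then have "?Z - X m = ?Z" using admissible_disjoint[OF adm l m(1)] by blast
    then show ?thesis by simp
  qed
  also have "g l ?Z \<le> g l (X l)" using insert by simp
  also have "?Z - X m = X l - (\<Union>m\<in>insert m W. X m)" by blast
  finally show ?case .
qed simp

text \<open>Overlaps go to the leaf with the largest index and uncovered vertices to the center.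
  This is what a loop over the leaves with overwriting computes.\<close>

fun answer :: "(nat \<Rightarrow> nat set) \<Rightarrow> nat \<Rightarrow> nat \<Rightarrow> nat" where
  "answer X 0 u = c0"
| "answer X (Suc l) u = (if u \<in> X l then lf l else answer X l u)"

lemma answer_cases: "(\<exists>l<j. answer X j u = lf l \<and> u \<in> X l \<and> (\<forall>m<j. l < m \<longrightarrow> u \<notin> X m)) \<or>
    answer X j u = c0 \<and> (\<forall>m<j. u \<notin> X m)"
  by (induction j) (auto simp: less_Suc_eq)

lemma answer_labelling:
  assumes "admissible X"
  shows "labelling (answer X K)"
  unfolding labelling_def
proof (intro conjI allI impI)
  fix u
  show "answer X K u < k" using answer_cases[of K X u] lf_less c0 by auto
next
  fix u assume u: "u < k"
  then have *: "u \<in> X l \<longleftrightarrow> u = lf l" if "l < K" for l using assms that by (auto simp: admissible_def)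
  show "answer X K u = u"
  proof (cases "u = c0")
    case True
    then show ?thesis using answer_cases[of K X u] * lf_less(2) by fastforce
  next
    case False
    then have "u \<in> lf ` {..<K}" using lf u by (auto simp: bij_betw_def)
    then obtain l where "l < K" "u = lf l" by auto
    then show ?thesis using answer_cases[of K X u] * by auto
  qed
qed

text \<open>The fibre of a leaf is its set minus all later ones, and is no more expensive than the
  set itself. Conversely the fibres of any labelling are a solution of the relaxation, so its
  optimum is a lower bound.\<close>

theorem answer_optimal:
  assumes adm: "admissible X" and min: "\<And>X'. admissible X' \<Longrightarrow> total X \<le> total X'"
    and y: "labelling y"
  shows "cost (answer X K) \<le> cost y"
proof -
  have "g l {u. u < nv \<and> answer X K u = lf l} \<le> g l (X l)" if l: "l < K" for l
  proof -
    have "{u. u < nv \<and> answer X K u = lf l} = X l - (\<Union>m\<in>{Suc l..<K}. X m)"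
    proof (intro equalityI subsetI)
      fix u assume "u \<in> {u. u < nv \<and> answer X K u = lf l}"
      then obtain l' where "l' < K" "lf l' = lf l" "u \<in> X l'" "\<forall>m<K. l' < m \<longrightarrow> u \<notin> X m"
        using answer_cases[of K X u] lf_less(2)[OF l] by auto
      moreover from this have "l' = l" using lf_inject l by blast
      ultimately show "u \<in> X l - (\<Union>m\<in>{Suc l..<K}. X m)" by (auto simp: Suc_le_eq)
    next
      fix u assume u: "u \<in> X l - (\<Union>m\<in>{Suc l..<K}. X m)"
      moreover have "u < nv" using u adm l by (auto simp: admissible_def)
      moreover have "l' = l" if "l' < K" "u \<in> X l'" "\<forall>m<K. l' < m \<longrightarrow> u \<notin> X m" for l'
        using u that l by (auto simp: Suc_le_eq intro: linorder_cases[of l l'])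
      moreover obtain l' where "l' < K" "answer X K u = lf l'" "u \<in> X l'" "\<forall>m<K. l' < m \<longrightarrow> u \<notin> X m"
        using answer_cases[of K X u] u l by blast
      ultimately have "u < nv" "answer X K u = lf l" by metis+
      then show "u \<in> {u. u < nv \<and> answer X K u = lf l}" by simp
    qed
    moreover have "g l (X l - (\<Union>m\<in>{Suc l..<K}. X m)) \<le> g l (X l)"
      by (rule minimal_disjoint[OF adm min l]) auto
    ultimately show ?thesis by simp
  qed
  then have "cost (answer X K) \<le> total X"
    unfolding cost_eq[OF answer_labelling[OF adm]] total_def by (intro sum_mono) auto
  also have "\<dots> \<le> total (\<lambda>l. {u. u < nv \<and> y u = lf l})" by (rule min[OF labelling_admissible[OF y]])
  also have "\<dots> = cost y" using cost_eq[OF y] by (simp add: total_def)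
  finally show ?thesis .
qed

text \<open>There is one copy of the vertices per leaf. Terminals are contracted into the source 0
  or the sink 1 according to whether they belong to the set of the leaf, with the roles exchanged on
  the complemented side. This enforces the terminal constraints.\<close>

definition node :: "nat \<Rightarrow> nat \<Rightarrow> nat" where
  "node l u = (if u < k then if (u = lf l) \<noteq> ty l then 0 else 1 else 2 + (l * (nv - k) + (u - k)))"

definition nodes :: nat where "nodes = 2 + K * (nv - k)"

lemma node_less: "l < K \<Longrightarrow> u < nv \<Longrightarrow> node l u < nodes"
proof -
  assume *: "l < K" "u < nv"
  have "Suc l * (nv - k) \<le> K * (nv - k)" using * by (intro mult_le_mono) auto
  then show ?thesis using * by (auto simp: node_def nodes_def)
qed

text \<open>The set of vertices assigned to leaf \<open>l\<close> by the source side \<open>S\<close> of a cut: on one of the two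
  sides it is read off in complemented form.\<close>

definition decode :: "nat set \<Rightarrow> nat \<Rightarrow> nat set" where
  "decode S l = {u. u < nv \<and> (node l u \<in> S) \<noteq> ty l}"

text \<open>Complementing a set exchanges outgoing and incoming arcs, and so the two
  weights.\<close>

definition arc_a :: "nat \<Rightarrow> int" where "arc_a l = (if ty l then b (lf l) else a (lf l))"
definition arc_b :: "nat \<Rightarrow> int" where "arc_b l = (if ty l then a (lf l) else b (lf l))"
text \<open>The arc from \<open>node l u\<close> to \<open>node m u\<close> is cut iff
  \<open>u\<close> lies in both sets, as \<open>l\<close> is on the plain and \<open>m\<close> on
  the complemented side.\<close>

definition crossing :: "nat \<Rightarrow> nat \<Rightarrow> int" where
  "crossing l m = (if \<not> ty l \<and> ty m then 1 else 0)"

definition arc_cut :: "nat \<Rightarrow> nat \<Rightarrow> nat \<Rightarrow> nat set \<Rightarrow> int" where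
  "arc_cut l u v S = (if node l u \<in> S \<and> node l v \<notin> S then arc_a l * x u v else 0) +
       (if node l v \<in> S \<and> node l u \<notin> S then arc_b l * x u v else 0)"

definition crossing_cut :: "int \<Rightarrow> nat \<Rightarrow> nat \<Rightarrow> nat \<Rightarrow> nat set \<Rightarrow> int" where
  "crossing_cut big l m u S = (if node l u \<in> S \<and> node m u \<notin> S then big * crossing l m else 0)"

definition capacity :: "int \<Rightarrow> nat set \<Rightarrow> int" where
  "capacity big S = (\<Sum>u<nv. \<Sum>v<nv. \<Sum>l<K. arc_cut l u v S) +
     (\<Sum>l<K. \<Sum>m<K. \<Sum>u<nv. crossing_cut big l m u S)"

lemma capacity_eq:
  "capacity big S = total (decode S) +
    big * (\<Sum>l<K. \<Sum>m<K. \<Sum>u<nv. if \<not> ty l \<and> ty m \<and> u \<in> decode S l \<inter> decode S m then 1 else 0)"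
proof -
  have "total (decode S) = (\<Sum>u<nv. \<Sum>v<nv. \<Sum>l<K. x u v *
      ((if u \<in> decode S l \<and> v \<notin> decode S l then a (lf l) else 0) +
       (if u \<notin> decode S l \<and> v \<in> decode S l then b (lf l) else 0)))"
    unfolding total_def dcut_alt
    by (rule sum_rotate)
  also have "\<dots> = (\<Sum>u<nv. \<Sum>v<nv. \<Sum>l<K. arc_cut l u v S)"
    by (intro sum.cong) (auto simp: decode_def arc_cut_def arc_a_def arc_b_def)
  finally show ?thesis
    unfolding capacity_def sum_distrib_left
    by (simp add: crossing_cut_def crossing_def decode_def if_distrib cong: if_cong)
      (intro sum.cong, auto)
qed

lemma decode_terminal:
  assumes "0 \<in> S" "1 \<notin> S" "u < k"
  shows "u \<in> decode S l \<longleftrightarrow> u = lf l"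
  using assms k by (auto simp: decode_def node_def)

definition encode :: "(nat \<Rightarrow> nat set) \<Rightarrow> nat set" where
  "encode X = insert 0 {node l u | l u. l < K \<and> k \<le> u \<and> u < nv \<and> (u \<in> X l) \<noteq> ty l}"

lemma node_inject:
  assumes "l < K" "m < K" "k \<le> u" "u < nv" "k \<le> v" "v < nv"
  shows "node l u = node m v \<longleftrightarrow> l = m \<and> u = v"
proof
  assume *: "node l u = node m v"
  let ?n = "nv - k"
  have "l * ?n + (u - k) = m * ?n + (v - k)" "u - k < ?n" "v - k < ?n"
    using assms * by (auto simp: node_def)
  then have "(l * ?n + (u - k)) div ?n = (m * ?n + (v - k)) div ?n" "u - k < ?n" "v - k < ?n" by simp_all
  then have "l = m" by simp
  then show "l = m \<and> u = v" using \<open>l * ?n + (u - k) = m * ?n + (v - k)\<close> assms by auto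
qed simp

lemma encode_cut: "0 \<in> encode X" "1 \<notin> encode X"
  by (auto simp: encode_def node_def)

lemma decode_encode:
  assumes "admissible X" "l < K"
  shows "decode (encode X) l = X l"
proof -
  have "u \<in> decode (encode X) l \<longleftrightarrow> u \<in> X l" for u
  proof (cases "u < k")
    case True
    then show ?thesis using decode_terminal[OF encode_cut True] assms by (auto simp: admissible_def)
  next
    case False
    then have "node l u \<noteq> 0" by (simp add: node_def)
    then have "node l u \<in> encode X \<longleftrightarrow> (\<exists>m v. node l u = node m v \<and> m < K \<and> k \<le> v \<and> v < nv \<and> (v \<in> X m) \<noteq> ty m)"
      by (simp add: encode_def)
    then have "node l u \<in> encode X \<longleftrightarrow> (u \<in> X l) \<noteq> ty l" if "u < nv"
      using that False assms(2) node_inject[OF assms(2)] by (metis linorder_not_less)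
    then show ?thesis using assms by (auto simp: decode_def admissible_def)
  qed
  then show ?thesis by blast
qed

lemma capacity_encode:
  assumes "admissible X"
  shows "capacity big (encode X) = total X"
proof -
  have "total (decode (encode X)) = total X"
    unfolding total_def using decode_encode[OF assms] by (intro sum.cong) auto
  moreover have "(\<Sum>l<K. \<Sum>m<K. \<Sum>u<nv. if \<not> ty l \<and> ty m \<and>
      u \<in> decode (encode X) l \<inter> decode (encode X) m then 1 else 0) = (0::int)"
    using admissible_disjoint[OF assms] decode_encode[OF assms] by (intro sum.neutral ballI) auto
  ultimately show ?thesis by (simp add: capacity_eq)
qed

lemma labelling_ex: "labelling (\<lambda>u. if u < k then u else c0)"
  using c0 k by (simp add: labelling_def)

text \<open>A single overlap across the sides costs \<open>big\<close>, more than the cut of the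
  labelling that sends every nonterminal to the center. So a minimum cut has none and decodes to an
  admissible family, which can be compared with all others by encoding them.\<close>

theorem min_cut_optimal:
  assumes S: "0 \<in> S" "1 \<notin> S" and min: "\<And>S'. 0 \<in> S' \<Longrightarrow> 1 \<notin> S' \<Longrightarrow> capacity big S \<le> capacity big S'"
    and big: "(\<Sum>u<nv. \<Sum>v<nv. \<Sum>l<K. (arc_a l + arc_b l) * x u v) < big"
  shows "labelling (answer (decode S) K)" "labelling y \<Longrightarrow> cost (answer (decode S) K) \<le> cost y"
proof -
  let ?viol = "\<Sum>l<K. \<Sum>m<K. \<Sum>u<nv. if \<not> ty l \<and> ty m \<and> u \<in> decode S l \<inter> decode S m then 1 else (0::int)"
  define X0 where "X0 = (\<lambda>l. {u. u < nv \<and> (if u < k then u else c0) = lf l})"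
  have X0: "admissible X0" unfolding X0_def by (rule labelling_admissible[OF labelling_ex])
  have big_pos: "0 < big"
    using big x ab by (elim le_less_trans[rotated], intro sum_nonneg)
      (auto simp: nonneg_def arc_a_def arc_b_def intro!: mult_nonneg_nonneg)
  have "total X0 \<le> (\<Sum>u<nv. \<Sum>v<nv. \<Sum>l<K. (arc_a l + arc_b l) * x u v)"
    unfolding total_def dcut_alt
    by (rule order.trans[OF eq_refl[OF sum_rotate]], intro sum_mono)
      (use x ab in \<open>auto simp: arc_a_def arc_b_def nonneg_def algebra_simps\<close>)
  with min[OF encode_cut, of X0] big have "capacity big S < big" by (simp add: capacity_encode[OF X0])
  moreover have "0 \<le> total (decode S)"
    unfolding total_def dcut_alt using x ab by (intro sum_nonneg) (auto simp: nonneg_def)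
  ultimately have "big * ?viol < big" unfolding capacity_eq by linarith
  then have "?viol < 1" using big_pos by simp
  moreover have "0 \<le> ?viol" by (intro sum_nonneg) auto
  ultimately have viol: "?viol = 0" by linarith
  have "decode S l \<inter> decode S m = {}" if "l < K" "m < K" "\<not> ty l" "ty m" for l m
  proof -
    have "\<forall>l\<in>{..<K}. \<forall>m\<in>{..<K}. \<forall>u\<in>{..<nv}.
        (if \<not> ty l \<and> ty m \<and> u \<in> decode S l \<inter> decode S m then 1 else 0) = (0::int)"
      using viol by (simp add: sum_nonneg_eq_0_iff sum_nonneg)
    then have "u \<notin> decode S l \<inter> decode S m" if "u < nv" for u
      using that \<open>l < K\<close> \<open>m < K\<close> \<open>\<not> ty l\<close> \<open>ty m\<close> by (metis lessThan_iff zero_neq_one)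
    then show ?thesis by (auto simp: decode_def)
  qed
  then have adm: "admissible (decode S)"
    using decode_terminal[OF S] unfolding admissible_def by (auto simp: decode_def)
  have "total (decode S) \<le> total X'" if "admissible X'" for X'
    using min[OF encode_cut, of X'] capacity_encode[OF that] viol by (simp add: capacity_eq)
  with adm show "labelling (answer (decode S) K)" "labelling y \<Longrightarrow> cost (answer (decode S) K) \<le> cost y"
    using answer_labelling answer_optimal by blast+
qed

end

section \<open>The program\<close>

text \<open>The metric is not part of the input; its data are literals in the program text.\<close>

fun tabulate :: "(arr \<Rightarrow> nat \<Rightarrow> nat \<Rightarrow> int) \<Rightarrow> (arr \<times> nat \<times> nat) list \<Rightarrow> com" where
  "tabulate f [] = Skip"
| "tabulate f ((a, p, q) # xs) =
     Put a (Cst (int p)) (Cst (int q)) (Cst (f a p q)) ;; tabulate f xs"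

lemma tc_tabulate:
  assumes "\<And>a p q. (a, p, q) \<in> set xs \<Longrightarrow> int p + int q \<le> 2 ^ b"
  shows "tc b (tabulate f xs) s 0
    (\<lambda>t. t = s\<lparr>ar := \<lambda>a p q. if (a, p, q) \<in> set xs then f a p q else ar s a p q\<rparr>)"
  using assms
proof (induction xs arbitrary: s)
  case (Cons k xs)
  obtain a p q where k: "k = (a, p, q)" by (cases k)
  let ?s = "set_ar a p q (f a p q) s"
  have "tc b (tabulate f xs) ?s 0
      (\<lambda>t. t = ?s\<lparr>ar := \<lambda>a p q. if (a, p, q) \<in> set xs then f a p q else ar ?s a p q\<rparr>)"
    using Cons.prems by (intro Cons.IH) auto
  moreover have "ok_index b (int p) (int q)" using Cons.prems[of a p q] by (simp add: k ok_index_def)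
  moreover have "?s\<lparr>ar := \<lambda>a p q. if (a, p, q) \<in> set xs then f a p q else ar ?s a p q\<rparr> =
      s\<lparr>ar := \<lambda>a p q. if (a, p, q) \<in> set (k # xs) then f a p q else ar s a p q\<rparr>"
    by (intro state.equality ext) (auto simp: k)
  ultimately show ?case by (simp add: k del: upd2_row)
qed simp

definition table_keys :: "nat \<Rightarrow> nat \<Rightarrow> (arr \<times> nat \<times> nat) list" where
  "table_keys k K = map (Pair Nd) (List.product [0..<K] [0..<k]) @ map (Pair Cr) (List.product [0..<K] [0..<K]) @
     List.product [Al, Be, Ty, Lf] (List.product [0] [0..<K])"

lemma table_keys_iff: "(A, p, q) \<in> set (table_keys k K) \<longleftrightarrow> A = Nd \<and> p < K \<and> q < k \<or>
    A = Cr \<and> p < K \<and> q < K \<or> A \<in> {Al, Be, Ty, Lf} \<and> p = 0 \<and> q < K"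
  by (cases A) (auto simp: table_keys_def)

definition table :: "(nat \<Rightarrow> nat) \<Rightarrow> (nat \<Rightarrow> int) \<Rightarrow> (nat \<Rightarrow> int) \<Rightarrow> (nat \<Rightarrow> bool) \<Rightarrow> arr \<Rightarrow> nat \<Rightarrow> nat \<Rightarrow> int" where
  "table lf al be ty A p q = (case A of
       Nd \<Rightarrow> if (q = lf p) \<noteq> ty p then 0 else 1
     | Cr \<Rightarrow> if \<not> ty p \<and> ty q then 1 else 0
     | Al \<Rightarrow> al q | Be \<Rightarrow> be q | Ty \<Rightarrow> if ty q then 1 else 0 | Lf \<Rightarrow> int (lf q) | _ \<Rightarrow> 0)"

text \<open>The product of all denominators serves as common denominator. It needs no gcd, and each
  new right factor is an input number.\<close>

definition read_entry :: com where
  "read_entry = Rd Sx ;; Rd Sy ;; Put Num (V Su) (V Sv) (V Sx) ;; Put Den (V Su) (V Sv) (V Sy) ;;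
     Asg SD (V SD \<^bold>* V Sy)"

definition read_input :: "nat \<Rightarrow> nat \<Rightarrow> com" where
  "read_input k K = Rd Sn ;; Asg Snv (V Sn \<^bold>+ Cst (int k)) ;; Asg SN (Cst 2 \<^bold>+ V Sn \<^bold>* Cst (int K)) ;;
     Asg SD (Cst 1) ;; For Su (V Snv) (For Sv (V Snv) read_entry)"

text \<open>Only nonterminals are numbered here, once \<open>n\<close> is known; the entries of the
  terminals come from the table.\<close>

definition number_nodes :: "nat \<Rightarrow> nat \<Rightarrow> com" where
  "number_nodes k K = For Sl (Cst (int K)) (For Su (V Sn)
     (Put Nd (V Sl) (V Su \<^bold>+ Cst (int k)) (Cst 2 \<^bold>+ (V Sn \<^bold>* V Sl \<^bold>+ V Su))))"

abbreviation nd :: "scal \<Rightarrow> scal \<Rightarrow> exp" where "nd l u \<equiv> Ix Nd (V l) (V u)"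

text \<open>Weights are added and not assigned, since contracted terminals make several arcs share
  their end nodes. \<open>SZ\<close> sums up everything added and so bounds each single
  weight.\<close>

definition add_arcs :: com where
  "add_arcs = Put Wt (nd Sl Su) (nd Sl Sv) (Ix Wt (nd Sl Su) (nd Sl Sv) \<^bold>+ V Sx \<^bold>* Ix Al (Cst 0) (V Sl)) ;;
     Put Wt (nd Sl Sv) (nd Sl Su) (Ix Wt (nd Sl Sv) (nd Sl Su) \<^bold>+ V Sx \<^bold>* Ix Be (Cst 0) (V Sl)) ;;
     Asg SZ (V SZ \<^bold>+ V Sx \<^bold>* Ix Al (Cst 0) (V Sl) \<^bold>+ V Sx \<^bold>* Ix Be (Cst 0) (V Sl))"

definition build_arcs :: "nat \<Rightarrow> com" where
  "build_arcs K = For Su (V Snv) (For Sv (V Snv)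
     (Asg Sx (V SD \<^bold>div Ix Den (V Su) (V Sv) \<^bold>* Ix Num (V Su) (V Sv)) ;; For Sl (Cst (int K)) add_arcs))"

definition add_crossing :: com where
  "add_crossing = Put Wt (nd Sl Su) (nd Sm Su) (Ix Wt (nd Sl Su) (nd Sm Su) \<^bold>+ V Sinf \<^bold>* Ix Cr (V Sl) (V Sm)) ;;
     Asg SZ (V SZ \<^bold>+ V Sinf \<^bold>* Ix Cr (V Sl) (V Sm))"

definition build_crossings :: "nat \<Rightarrow> com" where
  "build_crossings K = For Sl (Cst (int K)) (For Sm (Cst (int K)) (For Su (V Snv) add_crossing))"

text \<open>Starting \<open>SZ\<close> at 1 makes \<open>Sinf\<close> strictly larger than the sum
  of the arc weights, as required of a crossing arc.\<close>

definition front :: "(arr \<Rightarrow> nat \<Rightarrow> nat \<Rightarrow> int) \<Rightarrow> nat \<Rightarrow> nat \<Rightarrow> com" where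
  "front f k K = tabulate f (table_keys k K) ;; read_input k K ;; number_nodes k K ;;
     Asg SZ (Cst 1) ;; build_arcs K ;; Asg Sinf (V SZ) ;; build_crossings K"

text \<open>The two nested tests amount to \<open>Ss \<noteq> Ty\<close>, the decoding of a label
  with regard to the side.\<close>

definition pick :: com where
  "pick = Asg Ss (Ix Lab (Cst 0) (nd Sl Su)) ;;
     IfP (V Ss \<^bold>- Ix Ty (Cst 0) (V Sl)) (Asg Sy (Ix Lf (Cst 0) (V Sl)))
       (IfP (Ix Ty (Cst 0) (V Sl) \<^bold>- V Ss) (Asg Sy (Ix Lf (Cst 0) (V Sl))) Skip)"

definition write_answer :: "nat \<Rightarrow> nat \<Rightarrow> com" where
  "write_answer c0 K = For Su (V Snv) (Asg Sy (Cst (int c0)) ;; For Sl (Cst (int K)) pick ;; Wr (V Sy))"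

definition solve :: "(arr \<Rightarrow> nat \<Rightarrow> nat \<Rightarrow> int) \<Rightarrow> nat \<Rightarrow> nat \<Rightarrow> nat \<Rightarrow> com" where
  "solve f k K c0 = front f k K ;; scale ;; min_cut ;; write_answer c0 K"

section \<open>Verification of the network construction and of the output\<close>

definition wt_bounded :: "nat \<Rightarrow> state \<Rightarrow> bool" where
  "wt_bounded N s \<longleftrightarrow> (\<forall>p<N. \<forall>q<N. 0 \<le> ar s Wt p q \<and> ar s Wt p q \<le> sc s SZ)"

text \<open>The network is described only by its cut values. They are additive, so nested loops
  yield nested sums in the shape of \<open>capacity\<close>, without any formula for single matrix
  entries.\<close>

definition accumulated :: "nat \<Rightarrow> state \<Rightarrow> int \<Rightarrow> (nat set \<Rightarrow> int) \<Rightarrow> state \<Rightarrow> bool" where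
  "accumulated N s d D t \<longleftrightarrow> sc t SZ = sc s SZ + d \<and>
     (\<forall>S. cut_sum N (ar t Wt) S = cut_sum N (ar s Wt) S + D S) \<and> (wt_bounded N s \<longrightarrow> wt_bounded N t)"

lemma accumulated_refl: "accumulated N s 0 (\<lambda>_. 0) s"
  by (simp add: accumulated_def)

lemma accumulated_trans:
  "accumulated N s d D t \<Longrightarrow> accumulated N t d' D' \<rho> \<Longrightarrow> accumulated N s (d + d') (\<lambda>S. D S + D' S) \<rho>"
  by (simp add: accumulated_def)

lemma accumulated_sc [simp]:
  "i \<noteq> SZ \<Longrightarrow> accumulated N s d D (set_sc i v t) = accumulated N s d D t"
  by (simp add: accumulated_def wt_bounded_def)

lemma accumulated_sc_left [simp]:
  "i \<noteq> SZ \<Longrightarrow> accumulated N (set_sc i v s) = accumulated N s"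
  by (intro ext) (simp add: accumulated_def wt_bounded_def)

lemma accumulated_add:
  assumes "ar t Wt = upd2 (ar s Wt) p q (ar s Wt p q + d)" "sc t SZ = sc s SZ + d" "0 \<le> d" "p < N" "q < N"
  shows "accumulated N s d (\<lambda>S. if p \<in> S \<and> q \<notin> S then d else 0) t"
  using assms(3) unfolding accumulated_def wt_bounded_def assms(1,2) cut_sum_upd[OF assms(4,5)]
  by (auto intro: add_increasing2)

lemma tc_For_accumulate:
  assumes body: "\<And>j t. j < k \<Longrightarrow> sc t i = int j \<Longrightarrow> frame (For i e c) s t \<Longrightarrow>
      tc b c t l (accumulated N t (d j) (D j))"
    and e: "\<And>t. frame (For i e c) s t \<Longrightarrow> ok b e t \<and> ev e t = int k"
    and i: "i \<notin> mods c" "i \<noteq> SZ"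
  shows "tc b (For i e c) s (k * (l + 1)) (accumulated N s (\<Sum>j<k. d j) (\<lambda>S. \<Sum>j<k. D j S))"
proof (rule tc_ForI[where k = k and l = l and I = "\<lambda>j. accumulated N s (\<Sum>j'<j. d j') (\<lambda>S. \<Sum>j'<j. D j' S)"])
  fix j t assume j: "j < k" "sc t i = int j" "frame (For i e c) s t"
    and acc: "accumulated N s (\<Sum>j'<j. d j') (\<lambda>S. \<Sum>j'<j. D j' S) t"
  show "tc b c t l (accumulated N s (\<Sum>j'<Suc j. d j') (\<lambda>S. \<Sum>j'<Suc j. D j' S))"
    by (rule tc_conseq[OF body[OF j] order.refl]) (use accumulated_trans[OF acc] in simp)
qed (use e i in \<open>auto simp: accumulated_refl\<close>)

context star_instance
begin

text \<open>Collects the demands on the guard \<open>B\<close> made by the indices, whose pairwise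
  sums must stay below \<open>2 ^ B\<close>, and by the weights of the leaves.\<close>

definition wide :: "nat \<Rightarrow> bool" where
  "wide B \<longleftrightarrow> 4 * int (nv + K + nodes) \<le> 2 ^ B \<and> (\<forall>l<K. \<bar>arc_a l\<bar> \<le> 2 ^ B \<and> \<bar>arc_b l\<bar> \<le> 2 ^ B)"

definition tables_ok :: "state \<Rightarrow> bool" where
  "tables_ok s \<longleftrightarrow> (\<forall>l<K. ar s Al 0 l = arc_a l \<and> ar s Be 0 l = arc_b l \<and>
       ar s Ty 0 l = (if ty l then 1 else 0) \<and> ar s Lf 0 l = int (lf l)) \<and>
     (\<forall>l<K. \<forall>m<K. ar s Cr l m = crossing l m) \<and> (\<forall>l<K. \<forall>t<k. ar s Nd l t = int (node l t))"

definition nodes_ok :: "state \<Rightarrow> bool" where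
  "nodes_ok s \<longleftrightarrow> (\<forall>l<K. \<forall>u<nv. ar s Nd l u = int (node l u))"

lemma wide_le: "wide B \<Longrightarrow> 4 * int nv + 4 * int K + 4 * int nodes \<le> 2 ^ B"
  by (simp add: wide_def)

lemma wide_index:
  assumes "wide B" "p < nv + K + nodes" "q < nv + K + nodes"
  shows "ok_index B (int p) (int q)" "ok_index B 0 (int q)"
proof -
  have "int p < int nv + int K + int nodes" "int q < int nv + int K + int nodes" using assms(2,3) by simp_all
  with wide_le[OF assms(1)] show "ok_index B (int p) (int q)" "ok_index B 0 (int q)"
    unfolding ok_index_def by linarith+
qed

lemma tc_tables:
  assumes "wide B"
  shows "tc B (tabulate (table lf arc_a arc_b ty) (table_keys k K)) (init xs) 0
    (\<lambda>t. tables_ok t \<and> (\<forall>p q. ar t Wt p q = 0 \<and> ar t Res p q = 0) \<and> inp t = xs \<and> outp t = [])"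
proof (rule tc_conseq[OF tc_tabulate])
  fix A p q assume "(A, p, q) \<in> set (table_keys k K)"
  then have "p < K + k \<and> q < K + k" by (auto simp: table_keys_iff)
  then show "int p + int q \<le> 2 ^ B" using wide_le[OF assms] k by linarith
next
  fix t assume t: "t = init xs\<lparr>ar := \<lambda>A p q. if (A, p, q) \<in> set (table_keys k K)
     then table lf arc_a arc_b ty A p q else ar (init xs) A p q\<rparr>"
  show "tables_ok t \<and> (\<forall>p q. ar t Wt p q = 0 \<and> ar t Res p q = 0) \<and> inp t = xs \<and> outp t = []"
    unfolding t tables_ok_def
    by (simp add: table_keys_iff table_def init_def crossing_def node_def)
qed simp

lemma tc_number_nodes:
  assumes "wide B" "tables_ok s" "sc s Sn = int n" "nv = n + k"
  shows "tc B (number_nodes k K) s (K * (n + 1)) nodes_ok"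
proof -
  let ?c = "Put Nd (V Sl) (V Su \<^bold>+ Cst (int k)) (Cst 2 \<^bold>+ (V Sn \<^bold>* V Sl \<^bold>+ V Su))"
  let ?I = "\<lambda>l t. (\<forall>l'<K. \<forall>u<nv. l' < l \<or> u < k \<longrightarrow> ar t Nd l' u = int (node l' u))"
  have nk: "nv - k = n" using assms(4) by simp
  have big: "int l \<le> 2 ^ B" if "l < K" for l using wide_le[OF assms(1)] that by linarith
  show ?thesis unfolding number_nodes_def
  proof (rule tc_ForI[where k = K and l = n and I = ?I])
    fix l t assume l: "l < K" "?I l t" "sc t Sl = int l" and f: "frame (For Sl (Cst (int K)) (For Su (V Sn) ?c)) s t"
    have n: "sc t Sn = int n" using f assms(3) by (simp add: frame_def)
    show "tc B (For Su (V Sn) ?c) t n (?I (Suc l))"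
    proof (rule tc_ForI[where k = n and l = 0 and I = "\<lambda>i t. \<forall>l'<K. \<forall>u<nv. l' < l \<or> u < k \<or> l' = l \<and> u < i + k \<longrightarrow>
        ar t Nd l' u = int (node l' u)"])
      fix i t' assume i: "i < n" "\<forall>l'<K. \<forall>u<nv. l' < l \<or> u < k \<or> l' = l \<and> u < i + k \<longrightarrow> ar t' Nd l' u = int (node l' u)"
        "sc t' Su = int i" and f': "frame (For Su (V Sn) ?c) t t'"
      have s: "sc t' Sl = int l" "sc t' Sn = int n" using f' l n by (auto simp: frame_def)
      have "ok_index B (int l) (int (i + k))" using wide_index(1)[OF assms(1), of l "i + k"] l i assms(4) by simp
      moreover have "int (node l (i + k)) = 2 + (int n * int l + int i)"
        by (simp add: node_def nk mult.commute)
      ultimately show "tc B ?c t' 0 (\<lambda>t. \<forall>l'<K. \<forall>u<nv. l' < l \<or> u < k \<or> l' = l \<and> u < Suc i + k \<longrightarrow>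
          ar t Nd l' u = int (node l' u))"
        using i s l big by (auto simp: nat_add_distrib less_Suc_eq)
    next
      fix t' assume "\<forall>l'<K. \<forall>u<nv. l' < l \<or> u < k \<or> l' = l \<and> u < n + k \<longrightarrow> ar t' Nd l' u = int (node l' u)"
      then show "?I (Suc l) t'" using assms(4) by (auto simp: less_Suc_eq)
    qed (use l n in \<open>auto simp: frame_def\<close>)
  qed (use assms(2) in \<open>auto simp: tables_ok_def nodes_ok_def\<close>)
qed

lemma node_index:
  assumes "wide B" "l < K" "m < K" "u < nv" "v < nv"
  shows "ok_index B (int (node l u)) (int (node m v))" "ok_index B (int l) (int u)" "ok_index B 0 (int l)"
    "ok_index B (int l) (int m)" "ok_index B 0 (int (node l u))"
  using node_less[OF assms(2,4)] node_less[OF assms(3,5)] assms(2-5) by (auto intro!: wide_index[OF assms(1)])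

lemma tc_add_arcs:
  assumes "wide B" "tables_ok s" "nodes_ok s" "l < K" "u < nv" "v < nv"
    and s: "sc s Sl = int l" "sc s Su = int u" "sc s Sv = int v" "sc s Sx = x u v"
  shows "tc B add_arcs s 0 (accumulated nodes s ((arc_a l + arc_b l) * x u v)
    (arc_cut l u v))"
proof -
  let ?p = "node l u" and ?q = "node l v"
  let ?W1 = "upd2 (ar s Wt) ?p ?q (ar s Wt ?p ?q + x u v * arc_a l)"
  let ?W2 = "upd2 ?W1 ?q ?p (?W1 ?q ?p + x u v * arc_b l)"
  let ?t1 = "s\<lparr>ar := (ar s)(Wt := ?W1), sc := (sc s)(SZ := sc s SZ + x u v * arc_a l)\<rparr>"
  let ?t = "s\<lparr>ar := (ar s)(Wt := ?W2), sc := (sc s)(SZ := sc s SZ + x u v * arc_a l + x u v * arc_b l)\<rparr>"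
  have pos: "0 \<le> x u v * arc_a l" "0 \<le> x u v * arc_b l"
    using x assms(4-6) ab[OF assms(4)] by (auto simp: nonneg_def arc_a_def arc_b_def)
  have "accumulated nodes s (x u v * arc_a l) (\<lambda>S. if ?p \<in> S \<and> ?q \<notin> S then x u v * arc_a l else 0) ?t1"
    using pos node_less assms(4-6) by (intro accumulated_add) auto
  moreover have "accumulated nodes ?t1 (x u v * arc_b l) (\<lambda>S. if ?q \<in> S \<and> ?p \<notin> S then x u v * arc_b l else 0) ?t"
    using pos node_less assms(4-6) by (intro accumulated_add) auto
  ultimately have "accumulated nodes s (x u v * arc_a l + x u v * arc_b l)
      (\<lambda>S. (if ?p \<in> S \<and> ?q \<notin> S then x u v * arc_a l else 0) + (if ?q \<in> S \<and> ?p \<notin> S then x u v * arc_b l else 0)) ?t"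
    by (rule accumulated_trans)
  moreover have "x u v * arc_a l + x u v * arc_b l = (arc_a l + arc_b l) * x u v" by (simp add: algebra_simps)
  ultimately have acc: "accumulated nodes s ((arc_a l + arc_b l) * x u v) (arc_cut l u v) ?t"
    by (simp only: arc_cut_def [abs_def] mult.commute[of "x u v"])
  have N: "ar s Nd l u = int ?p" "ar s Nd l v = int ?q" using assms(3-6) by (auto simp: nodes_ok_def)
  have A: "ar s Al 0 l = arc_a l" "ar s Be 0 l = arc_b l" using assms(2,4) by (auto simp: tables_ok_def)
  have B: "\<bar>arc_a l\<bar> \<le> 2 ^ B" "\<bar>arc_b l\<bar> \<le> 2 ^ B" using assms(1,4) by (auto simp: wide_def)
  note ix = node_index[OF assms(1,4,4,5,6)] node_index[OF assms(1,4,4,6,5)]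
  show ?thesis
    unfolding add_arcs_def using acc ix
    by (simp add: s N A B del: upd2_apply upd2_row)
qed

definition input :: "nat \<Rightarrow> matrix \<Rightarrow> matrix \<Rightarrow> int list" where
  "input n num den = int n # concat (map (\<lambda>u. concat (map (\<lambda>v. [num u v, den u v]) [0..<n + k])) [0..<n + k])"

definition entries_ok :: "nat \<Rightarrow> matrix \<Rightarrow> matrix \<Rightarrow> nat \<Rightarrow> nat \<Rightarrow> state \<Rightarrow> bool" where
  "entries_ok n num den u v s \<longleftrightarrow>
     (\<forall>u'<nv. \<forall>v'<nv. u' < u \<or> u' = u \<and> v' < v \<longrightarrow> ar s Num u' v' = num u' v' \<and> ar s Den u' v' = den u' v') \<and>
     sc s SD = (\<Prod>u'<u. \<Prod>v'<nv. den u' v') * (\<Prod>v'<v. den u v')"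

lemma entries_ok_row: "entries_ok n num den u nv s \<longleftrightarrow> entries_ok n num den (Suc u) 0 s"
  unfolding entries_ok_def by (auto simp: less_Suc_eq)

lemma tc_read_entry:
  assumes "wide B" "u < nv" "v < nv" "sc s Su = int u" "sc s Sv = int v" "\<bar>den u v\<bar> \<le> 2 ^ B"
    "entries_ok n num den u v s" "inp s = num u v # den u v # xs"
  shows "tc B read_entry s 0 (\<lambda>t. entries_ok n num den u (Suc v) t \<and> inp t = xs)"
proof -
  have "ok_index B (int u) (int v)" using assms(2,3) by (intro wide_index[OF assms(1)]) auto
  then show ?thesis using assms(4-8)
    unfolding read_entry_def by (auto simp: entries_ok_def less_Suc_eq)
qed

lemma tc_read_input:
  assumes "wide B" "nv = n + k" "inp s = input n num den"
    and den: "\<And>u v. u < nv \<Longrightarrow> v < nv \<Longrightarrow> \<bar>den u v\<bar> \<le> 2 ^ B"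
  shows "tc B (read_input k K) s (nv * (nv + 1)) (\<lambda>t. sc t Sn = int n \<and> sc t Snv = int nv \<and>
    sc t SN = int nodes \<and> entries_ok n num den nv 0 t \<and> inp t = [])"
proof -
  let ?row = "\<lambda>u. concat (map (\<lambda>v. [num u v, den u v]) [0..<nv])"
  define s1 where "s1 = s\<lparr>sc := (sc s)(Sn := int n, Snv := int nv, SN := int nodes, SD := 1),
    inp := concat (map ?row [0..<nv])\<rparr>"
  let ?loop = "For Su (V Snv) (For Sv (V Snv) read_entry)"
  have "tc B ?loop s1 (nv * (nv + 1)) (\<lambda>t. sc t Sn = int n \<and> sc t Snv = int nv \<and>
    sc t SN = int nodes \<and> entries_ok n num den nv 0 t \<and> inp t = [])"
  proof (rule tc_ForI[where k = nv and l = nv and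
        I = "\<lambda>u t. entries_ok n num den u 0 t \<and> inp t = concat (map ?row [u..<nv])"])
    fix u t assume u: "u < nv" "entries_ok n num den u 0 t \<and> inp t = concat (map ?row [u..<nv])"
      "sc t Su = int u" and f: "frame ?loop s1 t"
    have nv: "sc t Snv = int nv" using f by (simp add: frame_def s1_def read_entry_def)
    have inp: "inp t = ?row u @ concat (map ?row [Suc u..<nv])"
      using u by (simp add: upt_conv_Cons del: upt_Suc)
    show "tc B (For Sv (V Snv) read_entry) t nv
        (\<lambda>t. entries_ok n num den (Suc u) 0 t \<and> inp t = concat (map ?row [Suc u..<nv]))"
    proof (rule tc_ForI[where k = nv and l = 0 and I = "\<lambda>v t. entries_ok n num den u v t \<and>
          inp t = concat (map (\<lambda>v. [num u v, den u v]) [v..<nv]) @ concat (map ?row [Suc u..<nv])"])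
      fix v t' assume v: "v < nv" "entries_ok n num den u v t' \<and>
          inp t' = concat (map (\<lambda>v. [num u v, den u v]) [v..<nv]) @ concat (map ?row [Suc u..<nv])"
        "sc t' Sv = int v" and f': "frame (For Sv (V Snv) read_entry) t t'"
      have "sc t' Su = int u" using f' u by (simp add: frame_def read_entry_def)
      moreover have "inp t' = num u v # den u v # (concat (map (\<lambda>v. [num u v, den u v]) [Suc v..<nv]) @
          concat (map ?row [Suc u..<nv]))"
        using v by (simp add: upt_conv_Cons del: upt_Suc)
      ultimately show "tc B read_entry t' 0 (\<lambda>t. entries_ok n num den u (Suc v) t \<and>
          inp t = concat (map (\<lambda>v. [num u v, den u v]) [Suc v..<nv]) @ concat (map ?row [Suc u..<nv]))"
        using u v den by (intro tc_read_entry[OF assms(1)]) auto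
    next
      fix j v and t' :: state
      assume "entries_ok n num den u j t' \<and>
        inp t' = concat (map (\<lambda>v. [num u v, den u v]) [j..<nv]) @ concat (map ?row [Suc u..<nv])"
      then show "entries_ok n num den u j (set_sc Sv v t') \<and> inp (set_sc Sv v t') =
        concat (map (\<lambda>v. [num u v, den u v]) [j..<nv]) @ concat (map ?row [Suc u..<nv])"
        by (simp add: entries_ok_def)
    qed (use u inp nv in \<open>auto simp: frame_def read_entry_def entries_ok_row [symmetric]\<close>)
  next
    fix j v and t :: state
    assume "entries_ok n num den j 0 t \<and> inp t = concat (map ?row [j..<nv])"
    then show "entries_ok n num den j 0 (set_sc Su v t) \<and> inp (set_sc Su v t) = concat (map ?row [j..<nv])"
      by (simp add: entries_ok_def)
  qed (auto simp: frame_def read_entry_def s1_def entries_ok_def)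
  moreover have "int K \<le> 2 ^ B" using wide_le[OF assms(1)] by linarith
  moreover have "s1 = s\<lparr>inp := concat (map ?row [0..<nv]),
      sc := (sc s)(Sn := int n, Snv := int n + int k, SN := 2 + int n * int K, SD := 1)\<rparr>"
  proof -
    have "nv - k = n" "int nv = int n + int k" using assms(2) by simp_all
    then show ?thesis by (simp add: s1_def nodes_def mult.commute)
  qed
  moreover have "inp s = int n # concat (map ?row [0..<nv])"
    using assms(2,3) by (simp add: input_def)
  ultimately show ?thesis by (simp add: read_input_def)
qed

lemma tc_build_arcs:
  assumes "wide B" "tables_ok s" "nodes_ok s" "entries_ok n num den nv 0 s" "sc s Snv = int nv"
    and num: "\<And>u v. u < nv \<Longrightarrow> v < nv \<Longrightarrow> \<bar>num u v\<bar> \<le> 2 ^ B"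
    and scaled: "\<And>u v. u < nv \<Longrightarrow> v < nv \<Longrightarrow> x u v = (\<Prod>u<nv. \<Prod>v<nv. den u v) div den u v * num u v"
  shows "tc B (build_arcs K) s (nv * (nv * (K + 1) + 1))
    (accumulated nodes s (\<Sum>u<nv. \<Sum>v<nv. \<Sum>l<K. (arc_a l + arc_b l) * x u v)
      (\<lambda>S. \<Sum>u<nv. \<Sum>v<nv. \<Sum>l<K. arc_cut l u v S))"
proof -
  let ?inner = "For Sl (Cst (int K)) add_arcs"
  let ?body = "Asg Sx (V SD \<^bold>div Ix Den (V Su) (V Sv) \<^bold>* Ix Num (V Su) (V Sv)) ;; ?inner"
  note mods = add_arcs_def
  show ?thesis unfolding build_arcs_def
  proof (rule tc_For_accumulate)
    fix u t assume u: "u < nv" "sc t Su = int u" and f: "frame (For Su (V Snv) (For Sv (V Snv) ?body)) s t"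
    have nv: "sc t Snv = int nv" using f assms(5) by (simp add: frame_def mods)
    show "tc B (For Sv (V Snv) ?body) t (nv * (K + 1)) (accumulated nodes t
      (\<Sum>v<nv. \<Sum>l<K. (arc_a l + arc_b l) * x u v)
      (\<lambda>S. \<Sum>v<nv. \<Sum>l<K. arc_cut l u v S))"
    proof (rule tc_For_accumulate)
      fix v t' assume v: "v < nv" "sc t' Sv = int v" and f': "frame (For Sv (V Snv) ?body) t t'"
      have s: "sc t' Su = int u" "sc t' SD = sc s SD" "ar t' Den = ar s Den" "ar t' Num = ar s Num"
        "tables_ok t'" "nodes_ok t'"
        using f f' u assms(2,3) by (auto simp: frame_def mods tables_ok_def nodes_ok_def)
      have "sc s SD div ar s Den u v * ar s Num u v = x u v" and n: "\<bar>ar s Num u v\<bar> \<le> 2 ^ B"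
        using assms(4) u v scaled num by (auto simp: entries_ok_def)
      define t1 where "t1 = set_sc Sx (x u v) t'"
      have "tc B ?inner t1 (K * (0 + 1)) (accumulated nodes t1 (\<Sum>l<K. (arc_a l + arc_b l) * x u v)
        (\<lambda>S. \<Sum>l<K. arc_cut l u v S))"
      proof (rule tc_For_accumulate)
        fix l t2 assume l: "l < K" "sc t2 Sl = int l" and f2: "frame ?inner t1 t2"
        then show "tc B add_arcs t2 0 (accumulated nodes t2 ((arc_a l + arc_b l) * x u v)
            (arc_cut l u v))"
          using s u v by (intro tc_add_arcs[OF assms(1)])
            (auto simp: frame_def mods t1_def tables_ok_def nodes_ok_def)
      qed (simp_all add: mods)
      moreover have "ok_index B (int u) (int v)" using u v by (intro wide_index[OF assms(1)]) auto
      ultimately show "tc B ?body t' K (accumulated nodes t' (\<Sum>l<K. (arc_a l + arc_b l) * x u v)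
        (\<lambda>S. \<Sum>l<K. arc_cut l u v S))"
        using n s v \<open>sc s SD div ar s Den u v * ar s Num u v = x u v\<close> by (simp add: t1_def)
    qed (use nv in \<open>simp_all add: frame_def mods\<close>)
  qed (use assms(5) in \<open>simp_all add: frame_def mods\<close>)
qed

lemma tc_add_crossing:
  assumes "wide B" "tables_ok s" "nodes_ok s" "l < K" "m < K" "u < nv" "0 \<le> sc s Sinf"
    and s: "sc s Sl = int l" "sc s Sm = int m" "sc s Su = int u"
  shows "tc B add_crossing s 0 (accumulated nodes s (sc s Sinf * crossing l m)
    (crossing_cut (sc s Sinf) l m u))"
proof -
  let ?d = "sc s Sinf * crossing l m"
  let ?W = "upd2 (ar s Wt) (node l u) (node m u) (ar s Wt (node l u) (node m u) + ?d)"
  let ?t = "s\<lparr>ar := (ar s)(Wt := ?W), sc := (sc s)(SZ := sc s SZ + ?d)\<rparr>"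
  have acc: "accumulated nodes s ?d (crossing_cut (sc s Sinf) l m u) ?t"
    unfolding crossing_cut_def [abs_def]
    using node_less assms(4-7) by (intro accumulated_add) (auto simp: crossing_def)
  have N: "ar s Nd l u = int (node l u)" "ar s Nd m u = int (node m u)" "ar s Cr l m = crossing l m"
    using assms(2-6) by (auto simp: nodes_ok_def tables_ok_def)
  have "\<bar>crossing l m\<bar> \<le> 2 ^ B" by (simp add: crossing_def)
  then show ?thesis
    unfolding add_crossing_def using acc node_index[OF assms(1,4,5,6,6)] node_index[OF assms(1,5,4,6,6)]
    by (simp add: s N del: upd2_apply upd2_row)
qed

lemma tc_build_crossings:
  assumes "wide B" "tables_ok s" "nodes_ok s" "sc s Snv = int nv" "0 \<le> sc s Sinf"
  shows "tc B (build_crossings K) s (K * (K * (nv + 1) + 1))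
    (accumulated nodes s (\<Sum>l<K. \<Sum>m<K. \<Sum>u<nv. sc s Sinf * crossing l m)
      (\<lambda>S. \<Sum>l<K. \<Sum>m<K. \<Sum>u<nv. crossing_cut (sc s Sinf) l m u S))"
proof -
  note mods = add_crossing_def
  let ?c1 = "For Su (V Snv) add_crossing"
  let ?c2 = "For Sm (Cst (int K)) ?c1"
  show ?thesis unfolding build_crossings_def
  proof (rule tc_For_accumulate)
    fix l t assume l: "l < K" "sc t Sl = int l" and f: "frame (For Sl (Cst (int K)) ?c2) s t"
    show "tc B ?c2 t (K * (nv + 1)) (accumulated nodes t (\<Sum>m<K. \<Sum>u<nv. sc s Sinf * crossing l m)
      (\<lambda>S. \<Sum>m<K. \<Sum>u<nv. crossing_cut (sc s Sinf) l m u S))"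
    proof (rule tc_For_accumulate)
      fix m t1 assume m: "m < K" "sc t1 Sm = int m" and f1: "frame ?c2 t t1"
      have "tc B ?c1 t1 (nv * (0 + 1)) (accumulated nodes t1 (\<Sum>u<nv. sc s Sinf * crossing l m)
        (\<lambda>S. \<Sum>u<nv. crossing_cut (sc s Sinf) l m u S))"
      proof (rule tc_For_accumulate)
        fix u t2 assume u: "u < nv" "sc t2 Su = int u" and f2: "frame ?c1 t1 t2"
        have s: "sc t2 Sinf = sc s Sinf" "sc t2 Sl = int l" "sc t2 Sm = int m" "tables_ok t2" "nodes_ok t2"
          using f f1 f2 l m assms(2,3) by (auto simp: frame_def mods tables_ok_def nodes_ok_def)
        show "tc B add_crossing t2 0 (accumulated nodes t2 (sc s Sinf * crossing l m)
            (crossing_cut (sc s Sinf) l m u))"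
          using tc_add_crossing[OF assms(1) s(4,5) l(1) m(1) u(1) _ s(2,3) u(2)] assms(5) unfolding s(1) by blast
      qed (use f f1 assms(4) in \<open>simp_all add: frame_def mods\<close>)
      then show "tc B ?c1 t1 nv (accumulated nodes t1 (\<Sum>u<nv. sc s Sinf * crossing l m)
        (\<lambda>S. \<Sum>u<nv. crossing_cut (sc s Sinf) l m u S))"
        by simp
    qed (simp_all add: mods)
  qed (simp_all add: mods)
qed

lemma tc_write_answer:
  assumes "wide B" "tables_ok s" "nodes_ok s" "sc s Snv = int nv" "outp s = []"
    and lab: "boolean nodes (ar s Lab 0)"
  shows "tc B (write_answer c0 K) s (nv * (K + 1)) (\<lambda>t. outp t =
    map (\<lambda>u. int (answer (decode (labelled nodes (ar s Lab 0))) K u)) [0..<nv])"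
proof -
  let ?X = "decode (labelled nodes (ar s Lab 0))"
  let ?body = "Asg Sy (Cst (int c0)) ;; For Sl (Cst (int K)) pick ;; Wr (V Sy)"
  note mods = pick_def
  show ?thesis unfolding write_answer_def
  proof (rule tc_ForI[where k = nv and l = K and I = "\<lambda>u t. outp t = map (\<lambda>u. int (answer ?X K u)) [0..<u]"])
    fix u t assume u: "u < nv" "outp t = map (\<lambda>u. int (answer ?X K u)) [0..<u]" "sc t Su = int u"
      and f: "frame (For Su (V Snv) ?body) s t"
    define t1 where "t1 = set_sc Sy (int c0) t"
    have "tc B (For Sl (Cst (int K)) pick) t1 K (\<lambda>t. sc t Sy = int (answer ?X K u) \<and> outp t = outp t1)"
    proof (rule tc_ForI[where k = K and l = 0 and I = "\<lambda>l t. sc t Sy = int (answer ?X l u)"])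
      fix l t2 assume l: "l < K" "sc t2 Sy = int (answer ?X l u)" "sc t2 Sl = int l"
        and f2: "frame (For Sl (Cst (int K)) pick) t1 t2"
      have s: "sc t2 Su = int u" "ar t2 = ar s"
        using f f2 u by (auto simp: frame_def mods t1_def)
      have N: "ar s Nd l u = int (node l u)" "ar s Ty 0 l = (if ty l then 1 else 0)" "ar s Lf 0 l = int (lf l)"
        using assms(2,3) l u by (auto simp: nodes_ok_def tables_ok_def)
      have "node l u < nodes" using node_less l u by blast
      then have "u \<in> ?X l \<longleftrightarrow> (ar s Lab 0 (node l u) = 1) \<noteq> ty l"
        "ar s Lab 0 (node l u) = 0 \<or> ar s Lab 0 (node l u) = 1"
        using u lab by (auto simp: decode_def labelled_def boolean_def)
      then show "tc B pick t2 0 (\<lambda>t. sc t Sy = int (answer ?X (Suc l) u))"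
        using l s N node_index[OF assms(1) l(1) l(1) u(1) u(1)] by (auto simp: pick_def)
    qed (auto simp: frame_def mods t1_def)
    then have "tc B (For Sl (Cst (int K)) pick ;; Wr (V Sy)) t1 (K + 0) (\<lambda>t. outp t = map (\<lambda>u. int (answer ?X K u)) [0..<Suc u])"
      by (rule tc_Seq) (use u in \<open>simp add: t1_def\<close>)
    then show "tc B ?body t K (\<lambda>t. outp t = map (\<lambda>u. int (answer ?X K u)) [0..<Suc u])"
      by (simp add: t1_def)
  qed (use assms(4,5) in \<open>auto simp: frame_def mods\<close>)
qed

text \<open>The interface between the two halves of the program. No upper bound on \<open>SZ\<close>
  is included, since that bound comes from the machine run of the first half.\<close>

definition ready :: "state \<Rightarrow> bool" where
  "ready s \<longleftrightarrow> tables_ok s \<and> nodes_ok s \<and> sc s Snv = int nv \<and> sc s SN = int nodes \<and> outp s = [] \<and>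
     (\<forall>p q. ar s Res p q = 0) \<and> wt_bounded nodes s \<and> 1 \<le> sc s SZ \<and>
     (\<exists>big>\<Sum>u<nv. \<Sum>v<nv. \<Sum>l<K. (arc_a l + arc_b l) * x u v. \<forall>S. cut_sum nodes (ar s Wt) S = capacity big S)"

definition front_time :: nat where
  "front_time = nv * (nv + 1) + (K * (nv + 1) + (nv * (nv * (K + 1) + 1) + K * (K * (nv + 1) + 1)))"

lemma tc_front:
  assumes "wide B" "nv = n + k"
    and num: "\<And>u v. u < nv \<Longrightarrow> v < nv \<Longrightarrow> \<bar>num u v\<bar> \<le> 2 ^ B"
    and den: "\<And>u v. u < nv \<Longrightarrow> v < nv \<Longrightarrow> \<bar>den u v\<bar> \<le> 2 ^ B"
    and scaled: "\<And>u v. u < nv \<Longrightarrow> v < nv \<Longrightarrow> x u v = (\<Prod>u<nv. \<Prod>v<nv. den u v) div den u v * num u v"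
  shows "tc B (front (table lf arc_a arc_b ty) k K) (init (input n num den)) front_time ready"
proof -
  let ?sum = "\<Sum>u<nv. \<Sum>v<nv. \<Sum>l<K. (arc_a l + arc_b l) * x u v"
  note mods = read_input_def read_entry_def number_nodes_def build_arcs_def add_arcs_def
    build_crossings_def add_crossing_def
  let ?Z = "\<lambda>t. \<forall>p q. ar t Wt p q = 0 \<and> ar t Res p q = 0"
  let ?c3 = "Asg Sinf (V SZ) ;; build_crossings K"
  let ?c2 = "build_arcs K ;; ?c3"
  let ?c1 = "number_nodes k K ;; Asg SZ (Cst 1) ;; ?c2"
  let ?tab = "tabulate (table lf arc_a arc_b ty) (table_keys k K)"
  have sum: "0 \<le> ?sum"
    using x ab by (intro sum_nonneg mult_nonneg_nonneg) (auto simp: nonneg_def arc_a_def arc_b_def)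
  have "tc B (?tab ;; read_input k K ;; ?c1) (init (input n num den)) (0 + front_time) ready"
  proof (rule tc_Seq[OF tc_tables[OF assms(1)]])
    fix t0 assume 0: "tables_ok t0 \<and> ?Z t0 \<and> inp t0 = input n num den \<and> outp t0 = []"
    show "tc B (read_input k K ;; ?c1) t0 front_time ready"
      unfolding front_time_def
    proof (rule tc_Seq[OF tc_frame[OF tc_read_input[OF assms(1,2) _ den]]])
      show "inp t0 = input n num den" using 0 by blast
    next
      fix t1 assume 1: "(sc t1 Sn = int n \<and> sc t1 Snv = int nv \<and> sc t1 SN = int nodes \<and>
        entries_ok n num den nv 0 t1 \<and> inp t1 = []) \<and> frame (read_input k K) t0 t1"
      have t1: "tables_ok t1" "?Z t1" "outp t1 = []"
        using 0 1 by (auto simp: frame_def mods tables_ok_def)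
      have "tc B (number_nodes k K) t1 (K * (n + 1)) nodes_ok"
        using 1 by (intro tc_number_nodes[OF assms(1) t1(1) _ assms(2)]) simp
      then have "tc B (number_nodes k K) t1 (K * (nv + 1)) nodes_ok"
        by (rule tc_conseq) (use assms(2) in simp_all)
      then show "tc B (?c1) t1
          (K * (nv + 1) + (nv * (nv * (K + 1) + 1) + K * (K * (nv + 1) + 1))) ready"
      proof (rule tc_Seq[OF tc_frame])
        fix t2' assume 2: "nodes_ok t2' \<and> frame (number_nodes k K) t1 t2'"
        define t2 where "t2 = set_sc SZ 1 t2'"
        have f2: "\<And>A. A \<noteq> Nd \<Longrightarrow> ar t2' A = ar t1 A" "\<And>y. y \<notin> {Sl, Su} \<Longrightarrow> sc t2' y = sc t1 y"
          "outp t2' = outp t1" using 2 by (simp_all add: frame_def number_nodes_def)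
        have "t < nv" if "t < k" for t using that k by simp
        then have "tables_ok t2'" using t1(1) 2 f2(1) by (simp add: tables_ok_def nodes_ok_def)
        then have t2: "tables_ok t2" "nodes_ok t2" "entries_ok n num den nv 0 t2" "?Z t2" "outp t2 = []"
          "sc t2 Snv = int nv" "sc t2 SN = int nodes" "sc t2 SZ = 1"
          using 1 2 t1(2,3) f2 by (simp_all add: tables_ok_def nodes_ok_def entries_ok_def t2_def)
        have w2: "wt_bounded nodes t2" "\<And>S. cut_sum nodes (ar t2 Wt) S = 0"
          using t2 unfolding wt_bounded_def cut_sum_def by (simp, intro sum.neutral ballI, simp)
        have "tc B (?c2) t2
            (nv * (nv * (K + 1) + 1) + K * (K * (nv + 1) + 1)) ready"
        proof (rule tc_Seq[OF tc_frame[OF tc_build_arcs[OF assms(1) t2(1,2,3,6) num scaled]]])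
          fix t3' assume 3: "accumulated nodes t2 ?sum
            (\<lambda>S. \<Sum>u<nv. \<Sum>v<nv. \<Sum>l<K. arc_cut l u v S) t3' \<and> frame (build_arcs K) t2 t3'"
          define t3 where "t3 = set_sc Sinf (1 + ?sum) t3'"
          have t3: "tables_ok t3" "nodes_ok t3" "sc t3 Snv = int nv" "sc t3 SN = int nodes"
            "\<forall>p q. ar t3 Res p q = 0" "outp t3 = []"
            using 3 t2 by (auto simp: frame_def mods tables_ok_def nodes_ok_def t3_def)
          have Z3: "sc t3' SZ = 1 + ?sum" "wt_bounded nodes t3" "sc t3 Sinf = 1 + ?sum"
            "sc t3 SZ = 1 + ?sum" using 3 t2 w2 by (auto simp: accumulated_def t3_def wt_bounded_def)
          have "0 \<le> sc t3 Sinf" using sum Z3 by simp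
          from tc_frame[OF tc_build_crossings[OF assms(1) t3(1,2,3) this]]
          have "tc B (build_crossings K) t3 (K * (K * (nv + 1) + 1)) ready"
          proof (rule tc_conseq[OF _ order.refl])
            fix t4 assume 4: "accumulated nodes t3 (\<Sum>l<K. \<Sum>m<K. \<Sum>u<nv. sc t3 Sinf * crossing l m)
              (\<lambda>S. \<Sum>l<K. \<Sum>m<K. \<Sum>u<nv. crossing_cut (sc t3 Sinf) l m u S) t4 \<and>
              frame (build_crossings K) t3 t4"
            have t4: "tables_ok t4" "nodes_ok t4" "sc t4 Snv = int nv" "sc t4 SN = int nodes"
              "\<forall>p q. ar t4 Res p q = 0" "outp t4 = []"
              using 4 t3 by (auto simp: frame_def mods tables_ok_def nodes_ok_def)
            have "ar t3 = ar t3'" by (simp add: t3_def)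
            then have "cut_sum nodes (ar t4 Wt) S = capacity (sc t3 Sinf) S" for S
              using 3 4 w2(2) by (simp add: accumulated_def capacity_def)
            then have cap: "cut_sum nodes (ar t4 Wt) S = capacity (1 + ?sum) S" for S
              unfolding Z3(3) .
            have "0 \<le> (\<Sum>l<K. \<Sum>m<K. \<Sum>u<nv. sc t3 Sinf * crossing l m)"
              using \<open>0 \<le> sc t3 Sinf\<close> by (intro sum_nonneg) (auto simp: crossing_def)
            then have "1 \<le> sc t4 SZ" "wt_bounded nodes t4"
              using 4 Z3 sum by (auto simp: accumulated_def)
            then show "ready t4"
              unfolding ready_def using t4 cap by (intro conjI exI[of _ "1 + ?sum"]) auto
          qed
          then show "tc B (?c3) t3' (K * (K * (nv + 1) + 1)) ready"
            by (simp add: t3_def Z3(1))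
        qed
        then show "tc B (Asg SZ (Cst 1) ;; ?c2) t2'
            (nv * (nv * (K + 1) + 1) + K * (K * (nv + 1) + 1)) ready"
          by (simp add: t2_def)
      qed
    qed
  qed
  then show ?thesis by (simp add: front_def)
qed

text \<open>\<open>H\<close> bounds the bit length of all capacities, and thus \<open>H + 1\<close>
  the number of phases. It is a parameter because it is derived from the running time of
  \<open>front\<close>.\<close>

lemma tc_back:
  assumes "wide B" "ready s" "sc s SZ \<le> 2 ^ H"
  shows "tc B (scale ;; min_cut ;; write_answer c0 K) s
    (H + 1 + ((H + 1) * (phase_time nodes + 1) + nv * (K + 1)))
    (\<lambda>t. \<exists>y. outp t = map (\<lambda>u. int (y u)) [0..<nv] \<and> labelling y \<and> (\<forall>y'. labelling y' \<longrightarrow> cost y \<le> cost y'))"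
    (is "tc B _ s _ ?Q")
proof -
  note s = assms(2)[unfolded ready_def]
  note mods = scale_def min_cut_def solver_defs search_def augment_def
  have N: "2 * int nodes \<le> 2 ^ B" using wide_le[OF assms(1)] by linarith
  have N2: "1 < nodes" by (simp add: nodes_def)
  from s have "1 \<le> sc s SZ" by blast
  from tc_frame[OF tc_scale[OF this assms(3)]] show ?thesis
  proof (rule tc_Seq)
    fix t1 assume "(\<exists>P>0. P \<le> H + 1 \<and> sc t1 SP = int P \<and> sc t1 Spow = 2 ^ P \<and> sc s SZ < 2 ^ P) \<and> frame scale s t1"
    then obtain P where P: "P > 0" "P \<le> H + 1" "sc t1 SP = int P" "sc t1 Spow = 2 ^ P" "sc s SZ < 2 ^ P"
      and f1: "frame scale s t1" by blast
    have t1: "tables_ok t1" "nodes_ok t1" "sc t1 Snv = int nv" "sc t1 SN = int nodes" "outp t1 = []"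
      "ar t1 = ar s"
      using f1 s by (auto simp: frame_def mods tables_ok_def nodes_ok_def)
    let ?cut = "\<lambda>t. boolean nodes (ar t Lab 0) \<and> ar t Lab 0 0 = 1 \<and>
      ar t Lab 0 1 = 0 \<and> (\<forall>S. 0 \<in> S \<longrightarrow> 1 \<notin> S \<longrightarrow>
        cut_sum nodes (ar t1 Wt) (labelled nodes (ar t Lab 0)) \<le> cut_sum nodes (ar t1 Wt) S)"
    have "tc B min_cut t1 (P * (phase_time nodes + 1)) ?cut"
    proof (rule tc_min_cut[OF t1(4) P(3,4) N N2 P(1)])
      fix p q assume "p < nodes" "q < nodes"
      then show "0 \<le> ar t1 Wt p q \<and> ar t1 Wt p q < 2 ^ P"
        using s P(5) unfolding t1(6) wt_bounded_def by (meson order_le_less_trans)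
    qed (use s t1(6) in auto)
    then have "tc B min_cut t1 ((H + 1) * (phase_time nodes + 1)) ?cut"
      by (rule tc_conseq[OF _ mult_le_mono1[OF P(2)]])
    from tc_frame[OF this] show "tc B (min_cut ;; write_answer c0 K) t1
        ((H + 1) * (phase_time nodes + 1) + nv * (K + 1)) ?Q"
    proof (rule tc_Seq)
      fix t2 assume 2: "?cut t2 \<and> frame min_cut t1 t2"
      let ?S = "labelled nodes (ar t2 Lab 0)"
      have t2: "tables_ok t2" "nodes_ok t2" "sc t2 Snv = int nv" "outp t2 = []"
        using 2 t1 by (auto simp: frame_def mods tables_ok_def nodes_ok_def)
      obtain big where big: "(\<Sum>u<nv. \<Sum>v<nv. \<Sum>l<K. (arc_a l + arc_b l) * x u v) < big"
        "\<And>S. cut_sum nodes (ar t1 Wt) S = capacity big S" using s t1(6) by auto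
      have S: "0 \<in> ?S" "1 \<notin> ?S" using 2 N2 by (auto simp: labelled_def)
      have "\<And>S'. 0 \<in> S' \<Longrightarrow> 1 \<notin> S' \<Longrightarrow> capacity big ?S \<le> capacity big S'"
        using 2 unfolding big(2) by blast
      note opt = min_cut_optimal[OF S this big(1)]
      show "tc B (write_answer c0 K) t2 (nv * (K + 1)) ?Q"
      proof (rule tc_conseq[OF tc_write_answer[OF assms(1) t2] order.refl])
        show "boolean nodes (ar t2 Lab 0)" using 2 by blast
      next
        fix t :: state assume "outp t = map (\<lambda>u. int (answer (decode ?S) K u)) [0..<nv]"
        then show "?Q t"
          using opt by blast
      qed
    qed
  qed
qed

end

section \<open>Directed metrics whose underlying graph is a star\<close>

text \<open>Two leaves are not adjacent, so some \<open>z\<close> lies between them. If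
  \<open>z\<close> is another leaf, the interval from \<open>x\<close> to \<open>z\<close> is
  contained in that from \<open>x\<close> to \<open>y\<close> and misses \<open>y\<close>; by
  induction it contains the center, which hence lies between \<open>x\<close> and
  \<open>y\<close>.\<close>

lemma star_metric_center:
  assumes "finite T" "directed_metric_on T \<mu>" "s \<in> T"
    and U: "underlying_edges T \<mu> = {{s, x} |x. x \<in> T - {s}}"
    and "x \<in> T" "y \<in> T" "x \<noteq> s" "y \<noteq> s" "x \<noteq> y"
  shows "\<mu> x y = \<mu> x s + \<mu> s y"
  using assms(5-9)
proof (induction "card (metric_interval T \<mu> x y)" arbitrary: x y rule: less_induct)
  case (less x y)
  note m = assms(2)[unfolded directed_metric_on_def]
  have "{x, y} \<notin> underlying_edges T \<mu>" using less.prems unfolding U by (auto simp: doubleton_eq_iff)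
  then have "\<not> (\<forall>z\<in>T - {x, y}. \<mu> x y < \<mu> x z + \<mu> z y)"
    using less.prems unfolding underlying_edges_def by blast
  then obtain z where z: "z \<in> T" "z \<noteq> x" "z \<noteq> y" "\<mu> x y \<ge> \<mu> x z + \<mu> z y" by fastforce
  then have xyz: "\<mu> x y = \<mu> x z + \<mu> z y" using m less.prems by (metis order_antisym)
  show ?case
  proof (cases "z = s")
    case True
    then show ?thesis using xyz by simp
  next
    case False
    have tri: "\<mu> p q \<le> \<mu> p w + \<mu> w q" if "p \<in> T" "q \<in> T" "w \<in> T" for p q w using m that by blast
    have sub: "metric_interval T \<mu> x z \<subseteq> metric_interval T \<mu> x y"
    proof
      fix w assume w: "w \<in> metric_interval T \<mu> x z"
      then have "\<mu> x y = \<mu> x w + (\<mu> w z + \<mu> z y)" "w \<in> T" using xyz by (auto simp: metric_interval_def)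
      with tri[of x y w] tri[of w y z] less.prems z show "w \<in> metric_interval T \<mu> x y"
        by (auto simp: metric_interval_def)
    qed
    have "y \<in> metric_interval T \<mu> x y" using less.prems m by (simp add: metric_interval_def)
    moreover have "y \<notin> metric_interval T \<mu> x z"
    proof
      assume "y \<in> metric_interval T \<mu> x z"
      then have "\<mu> z y + \<mu> y z = 0" using xyz by (simp add: metric_interval_def)
      moreover have "\<mu> z y + \<mu> y z > 0" using m z less.prems by blast
      ultimately show False by simp
    qed
    ultimately have "metric_interval T \<mu> x z \<subset> metric_interval T \<mu> x y" using sub by blast
    moreover have "finite (metric_interval T \<mu> x y)" using assms(1) by (simp add: metric_interval_def)
    ultimately have "card (metric_interval T \<mu> x z) < card (metric_interval T \<mu> x y)" by (rule psubset_card_mono[rotated])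
    from less.hyps[OF this] z False less.prems have "s \<in> metric_interval T \<mu> x z"
      using assms(3) by (simp add: metric_interval_def)
    with sub show ?thesis by (auto simp: metric_interval_def)
  qed
qed

text \<open>Only the center can lie between two leaves, since a route through a third leaf would
  make a detour from the center and back, of positive length. So the failure of both alternatives in
  \<open>biased_pair\<close> is witnessed by the center, and the two ratios agree there.\<close>

lemma unbiased_pair_star:
  assumes metric: "directed_metric_on T \<mu>" and s: "s \<in> T"
    and star: "\<And>x y. x \<in> T - {s} \<Longrightarrow> y \<in> T - {s} \<Longrightarrow> x \<noteq> y \<Longrightarrow> \<mu> x y = \<mu> x s + \<mu> s y"
    and xy: "x \<in> T - {s}" "y \<in> T - {s}" "x \<noteq> y" "\<not> biased_pair T \<mu> x y"
  shows "\<mu> x s * \<mu> y s = \<mu> s x * \<mu> s y"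
proof -
  note m = metric[unfolded directed_metric_on_def]
  have "(metric_interval T \<mu> x y \<inter> metric_interval T \<mu> y x) - {x, y} \<subseteq> {s}"
  proof
    fix z assume z: "z \<in> (metric_interval T \<mu> x y \<inter> metric_interval T \<mu> y x) - {x, y}"
    show "z \<in> {s}"
    proof (rule ccontr)
      assume "z \<notin> {s}"
      then have "\<mu> x z = \<mu> x s + \<mu> s z" "\<mu> z y = \<mu> z s + \<mu> s y" "\<mu> x y = \<mu> x s + \<mu> s y"
        "\<mu> x y = \<mu> x z + \<mu> z y"
        using star xy z by (auto simp: metric_interval_def)
      moreover have "\<mu> z s + \<mu> s z > 0" using m z s \<open>z \<notin> {s}\<close> by (auto simp: metric_interval_def)
      ultimately show False by simp
    qed
  qed
  then have "metric_ratio \<mu> x s = metric_ratio \<mu> s y"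
    using xy(3,4) unfolding biased_pair_def by (metis linorder_cases singletonD subsetD)
  then show ?thesis
    by (auto simp: metric_ratio_def divide_simps split: if_splits)
qed

text \<open>No leaf lies between two others, by the same detour argument, so three distinct leaves
  are non-collinear and cannot be biased pairwise.\<close>

lemma unbiased_in_triple:
  assumes metric: "directed_metric_on T \<mu>" and s: "s \<in> T"
    and star: "\<And>x y. x \<in> T - {s} \<Longrightarrow> y \<in> T - {s} \<Longrightarrow> x \<noteq> y \<Longrightarrow> \<mu> x y = \<mu> x s + \<mu> s y"
    and no: "\<not> (\<exists>s0 s1 s2. biased_non_collinear_triple T \<mu> s0 s1 s2)"
    and x: "x \<in> T - {s}" "y \<in> T - {s}" "z \<in> T - {s}" "x \<noteq> y" "y \<noteq> z" "x \<noteq> z"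
  defines "nb \<equiv> \<lambda>x y. \<mu> x s * \<mu> y s = \<mu> s x * \<mu> s y"
  shows "nb x y \<or> nb y z \<or> nb x z"
proof (rule ccontr)
  assume neg: "\<not> ?thesis"
  note m = metric[unfolded directed_metric_on_def]
  have nb_sym: "nb y x \<longleftrightarrow> nb x y" for x y by (auto simp: nb_def mult.commute)
  have biased: "biased_pair T \<mu> p q" if "p \<in> T - {s}" "q \<in> T - {s}" "p \<noteq> q" "\<not> nb p q" for p q
    using unbiased_pair_star[OF metric s star that(1-3)] that(4) unfolding nb_def by blast
  have notin: "p \<notin> metric_interval T \<mu> q r" if "p \<in> T - {s}" "q \<in> T - {s}" "r \<in> T - {s}" "p \<noteq> q" "q \<noteq> r" "p \<noteq> r" for p q r
  proof
    assume "p \<in> metric_interval T \<mu> q r"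
    then have "\<mu> q r = \<mu> q p + \<mu> p r" by (simp add: metric_interval_def)
    moreover have "\<mu> q r = \<mu> q s + \<mu> s r" "\<mu> q p = \<mu> q s + \<mu> s p" "\<mu> p r = \<mu> p s + \<mu> s r"
      using star that by auto
    moreover have "\<mu> p s + \<mu> s p > 0" using m that(1) s by auto
    ultimately show False by simp
  qed
  have "non_collinear T \<mu> x y z" using notin x by (simp add: non_collinear_def)
  then have "biased_non_collinear_triple T \<mu> x y z"
    using biased x neg nb_sym unfolding biased_non_collinear_triple_def by auto
  with no show False by blast
qed

text \<open>For leaves of a star, \<open>r x + r y = 1\<close> says that the pair \<open>(x, y)\<close> is not biased.\<close>

lemma two_sides:
  fixes r :: "'a \<Rightarrow> real"
  assumes triple: "\<And>x y z. x \<in> L \<Longrightarrow> y \<in> L \<Longrightarrow> z \<in> L \<Longrightarrow> x \<noteq> y \<Longrightarrow> y \<noteq> z \<Longrightarrow> x \<noteq> z \<Longrightarrow>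
    r x + r y = 1 \<or> r y + r z = 1 \<or> r x + r z = 1"
  shows "\<exists>A. \<forall>x\<in>L. \<forall>y\<in>L. x \<noteq> y \<longrightarrow> (x \<in> A \<longleftrightarrow> y \<in> A) \<longrightarrow> r x + r y = 1"
proof (cases "\<exists>e\<in>L. r e = 1 / 2")
  case True
  then obtain e where e: "e \<in> L" "r e = 1 / 2" by blast
  \<comment> \<open>The value 1/2 forms a side by itself. Any two elements off this value sum to 1,
    because neither does so with \<open>e\<close>.\<close>
  have "r x + r y = 1" if "x \<in> L" "y \<in> L" "x \<noteq> y" "r x = 1 / 2 \<longleftrightarrow> r y = 1 / 2" for x y
  proof (cases "r x = 1 / 2")
    case False
    with that e show ?thesis using triple[of e x y] by auto
  qed (use that in simp)
  then show ?thesis by (intro exI[of _ "{x. r x = 1 / 2}"]) simp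
next
  case no_half: False
  show ?thesis
  proof (cases "L = {}")
    case False
    then obtain p where p: "p \<in> L" by blast
    \<comment> \<open>From here on equal values never sum to 1.\<close>
    have two: "r x + r y \<noteq> 1" if "x \<in> L" "r x = r y" for x y using no_half that by auto
    show ?thesis
    proof (cases "\<exists>q\<in>L. r q \<noteq> r p \<and> r p + r q \<noteq> 1")
      case True
      then obtain q where q: "q \<in> L" "r q \<noteq> r p" "r p + r q \<noteq> 1" by blast
      \<comment> \<open>Values equal or complementary to \<open>r p\<close> form one side. Two equal
        ones would form a forbidden triple with \<open>q\<close>; two elements off this side must
        sum to 1 by the triple with \<open>p\<close>.\<close>
      let ?A = "{x. r x = r p \<or> r p + r x = 1}"
      have "r x + r y = 1" if xy: "x \<in> L" "y \<in> L" "x \<noteq> y" "x \<in> ?A \<longleftrightarrow> y \<in> ?A" for x y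
      proof (cases "x \<in> ?A")
        case True
        then have A: "x \<in> ?A" "y \<in> ?A" using xy(4) by blast+
        show ?thesis
        proof (cases "r x = r y")
          case True
          have "x \<noteq> q" "y \<noteq> q" using A q by auto
          then show ?thesis using True triple[of x y q] two[of x y] xy A q by auto
        qed (use A in auto)
      next
        case False
        then show ?thesis using triple[of p x y] xy p by auto
      qed
      then show ?thesis by (intro exI[of _ ?A]) blast
    next
      case False
      then have dich: "r x = r p \<or> r p + r x = 1" if "x \<in> L" for x using that by blast
      \<comment> \<open>All values are now \<open>r p\<close> or \<open>1 - r p\<close>, each taken
        at most twice because of \<open>triple\<close>. One side receives one element of each value;
        if the second value does not occur, \<open>p'\<close> is arbitrary and the comprehension in
        \<open>?A\<close> is empty.\<close>
      define p' where "p' = (SOME x. x \<in> L \<and> r p + r x = 1)"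
      have p': "p' \<in> L" "r p + r p' = 1" if "x \<in> L" "r p + r x = 1" for x
        using someI[of "\<lambda>x. x \<in> L \<and> r p + r x = 1" x] that unfolding p'_def by auto
      let ?A = "insert p {x \<in> L. r p + r x = 1 \<and> x = p'}"
      have "r x + r y = 1" if xy: "x \<in> L" "y \<in> L" "x \<noteq> y" "x \<in> ?A \<longleftrightarrow> y \<in> ?A" for x y
      proof (cases "r x = r y")
        case eq: True
        show ?thesis
        proof (cases "r x = r p")
          case True
          then have "x \<noteq> p" "y \<noteq> p" using xy eq two[OF p refl] by auto
          then show ?thesis using triple[of p x y] two[OF p] p xy eq True by auto
        next
          case False
          then have x: "r p + r x = 1" "r p + r y = 1" using dich xy eq by auto
          note q = p'[OF xy(1) x(1)]
          have "x \<noteq> p'" "y \<noteq> p'" using xy x False eq by auto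
          then show ?thesis
            using triple[of p' x y] two[OF q(1)] q xy eq x by auto
        qed
      next
        case False
        then show ?thesis using dich[OF xy(1)] dich[OF xy(2)] by auto
      qed
      then show ?thesis by (intro exI[of _ ?A]) blast
    qed
  qed simp
qed

lemma unbiased_iff:
  fixes a b a' b' :: real
  assumes "0 < a + b" "0 < a' + b'"
  shows "a / (a + b) + a' / (a' + b') = 1 \<longleftrightarrow> a * a' = b * b'"
proof -
  have "a / (a + b) + a' / (a' + b') = 1 \<longleftrightarrow> a * (a' + b') + a' * (a + b) = (a + b) * (a' + b')"
    using assms by (auto simp: add_frac_eq)
  then show ?thesis by (simp add: algebra_simps)
qed

lemma common_denominator:
  assumes "finite S" "S \<subseteq> \<rat>"
  shows "\<exists>d>0. \<forall>r\<in>S. of_int d * r \<in> (\<int> :: real set)"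
  using assms
proof (induction S rule: finite_induct)
  case empty
  show ?case by (intro exI[of _ 1]) simp
next
  case (insert r S)
  then obtain d where d: "d > 0" "\<forall>r\<in>S. of_int d * r \<in> \<int>" by auto
  obtain m n where mn: "r = of_int m / of_int n" "n > 0"
    using insert.prems by (metis Rats_cases' insert_subset)
  have "of_int (d * n) * r' \<in> \<int>" if "r' \<in> S" for r'
  proof -
    have "of_int (d * n) * r' = of_int n * (of_int d * r')" by simp
    also have "\<dots> \<in> \<int>" by (rule Ints_mult) (use d that in auto)
    finally show ?thesis .
  qed
  moreover have "of_int (d * n) * r \<in> \<int>"
  proof -
    have "of_int (d * n) * r = of_int (d * m)" using mn by simp
    then show ?thesis by (metis Ints_of_int)
  qed
  ultimately show ?case using d(1) mn(2) by (intro exI[of _ "d * n"]) auto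
qed

section \<open>Polynomial running time\<close>

definition polynomial_fun :: "(nat \<Rightarrow> nat) \<Rightarrow> bool" where
  "polynomial_fun f \<longleftrightarrow> (\<exists>p. \<forall>z. f z = poly p z)"

lemma polynomial_fun_const: "polynomial_fun (\<lambda>_. c)"
  unfolding polynomial_fun_def by (intro exI[of _ "[:c:]"]) simp

lemma polynomial_fun_id: "polynomial_fun (\<lambda>z. z)"
  unfolding polynomial_fun_def by (intro exI[of _ "[:0, 1:]"]) simp

lemma polynomial_fun_add:
  "polynomial_fun f \<Longrightarrow> polynomial_fun g \<Longrightarrow> polynomial_fun (\<lambda>z. f z + g z)"
  unfolding polynomial_fun_def by (metis poly_add)

lemma polynomial_fun_mult:
  "polynomial_fun f \<Longrightarrow> polynomial_fun g \<Longrightarrow> polynomial_fun (\<lambda>z. f z * g z)"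
  unfolding polynomial_fun_def by (metis poly_mult)

lemma polynomial_fun_Suc: "polynomial_fun f \<Longrightarrow> polynomial_fun (\<lambda>z. Suc (f z))"
  using polynomial_fun_add[OF _ polynomial_fun_const, of f 1] by simp

definition bit_bound :: "nat \<Rightarrow> nat \<Rightarrow> nat \<Rightarrow> nat" where
  "bit_bound B len t = B + (Suc t * len) * B"

definition ram_time :: "nat \<Rightarrow> nat \<Rightarrow> nat \<Rightarrow> nat" where
  "ram_time B len t = (Suc t * len) * (4 * (B + (Suc t * len) * B + 1)) + 1"

definition front_bound :: "nat \<Rightarrow> nat \<Rightarrow> nat" where
  "front_bound K z = z * (z + 1) + (K * (z + 1) + (z * (z * (K + 1) + 1) + K * (K * (z + 1) + 1)))"

text \<open>Here \<open>z\<close> is the input size, which also bounds the number of vertices. The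
  bit length \<open>H\<close> is taken from the run of \<open>front\<close> alone and then enters
  the time of the remaining program as a polynomial.\<close>

definition total_bound :: "nat \<Rightarrow> nat \<Rightarrow> nat \<Rightarrow> nat \<Rightarrow> nat" where
  "total_bound K \<beta> len z = (let H = bit_bound (z + \<beta>) len (front_bound K z) in
     front_bound K z + (H + 1 + ((H + 1) * (phase_time (2 + K * z) + 1) + z * (K + 1))))"

lemma polynomial_time_bound:
  "\<exists>p. \<forall>z. ram_time (z + \<beta>) len' (total_bound K \<beta> len z) = poly p z"
  unfolding polynomial_fun_def [symmetric] ram_time_def total_bound_def front_bound_def bit_bound_def
    phase_time_def search_time_def Let_def by (intro polynomial_fun_add polynomial_fun_mult
      polynomial_fun_Suc polynomial_fun_const polynomial_fun_id)

lemma phase_time_mono: "m \<le> n \<Longrightarrow> phase_time m \<le> phase_time n"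
  unfolding phase_time_def search_time_def by (intro add_mono mult_le_mono) auto

lemma vertex_list_nth:
  "u < length ts \<Longrightarrow> vertex_list ts n ! u = Inl (ts ! u)"
  "i < n \<Longrightarrow> vertex_list ts n ! (length ts + i) = Inr i"
  by (simp_all add: vertex_list_def nth_append)

lemma length_vertex_list [simp]: "length (vertex_list ts n) = n + length ts"
  by (simp add: vertex_list_def)

lemma set_vertex_list: "set (vertex_list ts n) = vertex_set (set ts) n"
  by (auto simp: vertex_list_def vertex_set_def)

lemma distinct_vertex_list: "distinct ts \<Longrightarrow> distinct (vertex_list ts n)"
  by (auto simp: vertex_list_def distinct_map)

lemma sum_vertex_set:
  assumes "distinct ts"
  shows "(\<Sum>v\<in>vertex_set (set ts) n. f v) = (\<Sum>u<n + length ts. f (vertex_list ts n ! u))"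
  using sum.reindex_bij_betw[OF bij_betw_nth[OF distinct_vertex_list[OF assms] refl refl], of f n]
  by (simp add: set_vertex_list)

lemma map_as_nth: "map f xs = map (\<lambda>i. f (xs ! i)) [0..<length xs]"
  by (rule nth_equalityI) simp_all

lemma encode_instance_input:
  fixes c :: "'a cost_fun" and ts :: "'a list" and n :: nat
  defines "vl \<equiv> vertex_list ts n"
  shows "encode_instance ts (n, c) = int n # concat (map (\<lambda>u. concat (map (\<lambda>v.
    [fst (quotient_of (c (vl ! u) (vl ! v))), snd (quotient_of (c (vl ! u) (vl ! v)))])
      [0..<n + length ts])) [0..<n + length ts])"
proof -
  have prod: "concat (map f (List.product xs ys)) = concat (map (\<lambda>x. concat (map (\<lambda>y. f (x, y)) ys)) xs)"
    for f :: "'b \<times> 'c \<Rightarrow> 'd list" and xs ys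
    by (induction xs) (simp_all add: comp_def)
  show ?thesis
    unfolding encode_instance_def prod vl_def
    by (simp add: prod encode_rat_def)
      (subst map_as_nth, subst (2) map_as_nth, simp)
qed

lemma int_len_le_input_size: "x \<in> set xs \<Longrightarrow> int_len x \<le> input_size xs"
  unfolding input_size_def using member_le_sum_list[of "int_len x" "map int_len xs"] by simp

lemma length_le_input_size: "length xs \<le> input_size xs"
proof -
  have "1 \<le> int_len x" for x by (simp add: int_len_def)
  then show ?thesis unfolding input_size_def
    by (induction xs) (simp_all add: Suc_le_eq add_less_le_mono add_strict_increasing)
qed

text \<open>All data of the metric are integers indexed by positions in \<open>ts\<close>. Scaling
  the metric by \<open>d\<close> and the costs by the product of their denominators multiplies the
  objective by a positive constant, so optimal maps stay optimal.\<close>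

lemma zero_ext_solvable:
  fixes ts :: "'a list" and \<mu> :: "'a \<Rightarrow> 'a \<Rightarrow> real" and a b :: "nat \<Rightarrow> int" and d :: int
    and K c0 :: nat and lf :: "nat \<Rightarrow> nat" and ty :: "nat \<Rightarrow> bool"
  assumes ts: "distinct ts" and c0: "c0 < length ts" "a c0 = 0" "b c0 = 0"
    and lf: "bij_betw lf {..<K} ({..<length ts} - {c0})"
    and ab: "\<And>l. l < K \<Longrightarrow> 0 \<le> a (lf l)" "\<And>l. l < K \<Longrightarrow> 0 \<le> b (lf l)" "\<And>l. l < K \<Longrightarrow> 0 < a (lf l) + b (lf l)"
    and side: "\<And>l m. l < K \<Longrightarrow> m < K \<Longrightarrow> l \<noteq> m \<Longrightarrow> ty l = ty m \<Longrightarrow> a (lf l) * a (lf m) = b (lf l) * b (lf m)"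
    and d: "0 < d" "\<And>i j. i < length ts \<Longrightarrow> j < length ts \<Longrightarrow>
      of_int d * \<mu> (ts ! i) (ts ! j) = of_int (if i = j then 0 else a i + b j)"
  shows "poly_time_solvable (zero_ext_instances (set ts)) (encode_instance ts)
    (\<lambda>I ys. \<exists>\<gamma>. zero_ext_optimal (set ts) \<mu> I \<gamma> \<and> encodes_map ts (fst I) \<gamma> ys)"
proof -
  define k where "k = length ts"
  define f where "f = table lf (star_instance.arc_a lf a b ty) (star_instance.arc_b lf a b ty) ty"
  define P where "P = program (solve f k K c0)"
  \<comment> \<open>The constants that depend only on the metric; the last summand is the constant
    factor in the bound on the indices needed for \<open>wide\<close>.\<close>
  define \<alpha> where "\<alpha> = (\<Sum>l<K. \<bar>star_instance.arc_a lf a b ty l\<bar> + \<bar>star_instance.arc_b lf a b ty l\<bar>) + 4 * (int K + 3)"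
  obtain b1 where b1: "\<And>b. b \<ge> b1 \<Longrightarrow> \<forall>i\<in>set P. fits b i" using ex_program_fits by metis
  \<comment> \<open>\<open>front\<close> is also compiled separately, because its own run bounds
    \<open>SZ\<close>.\<close>
  obtain b2 where b2: "\<And>b. b \<ge> b2 \<Longrightarrow> \<forall>i\<in>set (program (front f k K)). fits b i" using ex_program_fits by metis
  obtain b3 where b3: "\<And>b. b \<ge> b3 \<Longrightarrow> \<alpha> \<le> 2 ^ b" using ex_pow2_ge by metis
  define \<beta> where "\<beta> = max 4 (max b1 (max b2 b3))"
  obtain p where p: "\<And>z. ram_time (z + \<beta>) (clen (solve f k K c0))
      (total_bound K \<beta> (clen (front f k K)) z) = poly p z"
    using polynomial_time_bound by metis
  have "\<exists>t ys. ram_run P (0, \<lambda>_. 0, encode_instance ts I, []) t ys \<and> t \<le> poly p (input_size (encode_instance ts I)) \<and>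
      (\<exists>\<gamma>. zero_ext_optimal (set ts) \<mu> I \<gamma> \<and> encodes_map ts (fst I) \<gamma> ys)"
    if I: "I \<in> zero_ext_instances (set ts)" for I
  proof -
    obtain n c where nc: "I = (n, c)" by (cases I)
    define nv where "nv = n + k"
    define vl where "vl = vertex_list ts n"
    define num where "num u v = fst (quotient_of (c (vl ! u) (vl ! v)))" for u v
    define den where "den u v = snd (quotient_of (c (vl ! u) (vl ! v)))" for u v
    define D where "D = (\<Prod>u<nv. \<Prod>v<nv. den u v)"
    define x where "x u v = D div den u v * num u v" for u v
    have vl: "vl ! u \<in> vertex_set (set ts) n" if "u < nv" for u
      using that nth_mem[of u vl] by (simp add: vl_def set_vertex_list nv_def k_def)
    have den_pos: "0 < den u v" for u v by (simp add: den_def quotient_of_denom_pos')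
    then have D: "0 < D" by (simp add: D_def prod_pos)
    have num: "0 \<le> num u v" if "u < nv" "v < nv" for u v
    proof -
      have "0 \<le> c (vl ! u) (vl ! v)" using I vl that by (auto simp: zero_ext_instances_def nc)
      also have "c (vl ! u) (vl ! v) = of_int (num u v) / of_int (den u v)"
        by (intro quotient_of_div) (simp add: num_def den_def)
      finally show ?thesis using den_pos[of u v] by (auto simp: zero_le_divide_iff)
    qed
    have x_eq: "of_int (x u v) = real_of_int D * of_rat (c (vl ! u) (vl ! v))" if "u < nv" "v < nv" for u v
    proof -
      \<comment> \<open>The integer division in the definition of \<open>x\<close> is exact.\<close>
      have "den u v dvd (\<Prod>v<nv. den u v)" using that by (intro dvd_prodI) auto
      also have "\<dots> dvd D" unfolding D_def using that by (intro dvd_prodI) auto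
      finally have "real_of_int (D div den u v) = of_int D / of_int (den u v)"
        by (simp add: real_of_int_div)
      moreover have "c (vl ! u) (vl ! v) = of_int (num u v) / of_int (den u v)"
        by (intro quotient_of_div) (simp add: num_def den_def)
      then have "(of_rat (c (vl ! u) (vl ! v)) :: real) = of_int (num u v) / of_int (den u v)"
        by (simp add: of_rat_divide)
      ultimately show ?thesis by (simp add: x_def)
    qed
    have x_nonneg: "nonneg nv x"
      unfolding nonneg_def x_def
    proof (intro allI impI mult_nonneg_nonneg num)
      fix u v
      show "0 \<le> D div den u v" using D den_pos[of u v] by (simp add: pos_imp_zdiv_nonneg_iff)
    qed
    interpret star_instance nv k K c0 lf a b ty x
      by unfold_locales (use c0 lf ab side x_nonneg in \<open>auto simp: k_def nv_def\<close>)
    define z where "z = input_size (encode_instance ts I)"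
    define B where "B = z + \<beta>"
    have inp: "encode_instance ts I = input n num den"
      unfolding input_def unfolding nc encode_instance_input num_def den_def vl_def k_def ..
    have "length (encode_instance ts I) = 1 + 2 * (nv * nv)"
      by (simp add: inp input_def length_concat comp_def nv_def sum_list_triv)
    then have "1 + 2 * (nv * nv) \<le> z" using length_le_input_size[of "encode_instance ts I"] by (simp add: z_def)
    moreover have "nv \<le> nv * nv" by (cases nv) auto
    ultimately have nvz: "nv \<le> z" by linarith
    have "K * (nv - k) \<le> K * z" using nvz by (intro mult_le_mono2) simp
    then have nodes_le: "nodes \<le> 2 + K * z" by (simp add: nodes_def)
    have entries: "\<bar>w\<bar> \<le> 2 ^ B" if "w \<in> set (encode_instance ts I)" for w
    proof -
      have "int_len w \<le> B" using int_len_le_input_size[OF that] by (simp add: B_def z_def)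
      then show ?thesis using abs_pow_mono[OF abs_le_int_len] by blast
    qed
    have \<alpha>: "\<alpha> \<le> 2 ^ \<beta>" using b3 by (simp add: \<beta>_def)
    have "wide B"
      unfolding wide_def
    proof (intro conjI allI impI)
      have "int z + 1 \<le> 2 ^ z" using of_nat_less_two_power[of z, where 'a = int] by linarith
      \<comment> \<open>The bound is a constant, absorbed by \<open>2 ^ \<beta>\<close>, times
        \<open>z + 1\<close>, which is at most \<open>2 ^ z\<close>.\<close>
      have "nv + K + nodes \<le> (K + 3) * (z + 1)"
        using nvz nodes_le by (simp add: algebra_simps)
      then have "int (nv + K + nodes) \<le> int ((K + 3) * (z + 1))" by (simp only: of_nat_le_iff)
      then have "4 * int (nv + K + nodes) \<le> 4 * int ((K + 3) * (z + 1))" by (rule mult_left_mono) simp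
      also have "\<dots> = (4 * (int K + 3)) * (int z + 1)" by (simp add: algebra_simps)
      also have "\<dots> \<le> 2 ^ \<beta> * 2 ^ z"
      proof (rule mult_mono)
        have "0 \<le> (\<Sum>l<K. \<bar>arc_a l\<bar> + \<bar>arc_b l\<bar>)" by (intro sum_nonneg) auto
        then show "4 * (int K + 3) \<le> 2 ^ \<beta>" using \<alpha> unfolding \<alpha>_def by linarith
      qed (use \<open>int z + 1 \<le> 2 ^ z\<close> in auto)
      finally show "4 * int (nv + K + nodes) \<le> 2 ^ B" by (simp add: B_def power_add mult.commute)
    next
      fix l assume l: "l < K"
      have "\<bar>arc_a l\<bar> + \<bar>arc_b l\<bar> \<le> (\<Sum>l<K. \<bar>arc_a l\<bar> + \<bar>arc_b l\<bar>)"
        using l by (intro member_le_sum) auto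
      also have "\<dots> \<le> \<alpha>" by (simp add: \<alpha>_def)
      also note \<alpha>
      finally have *: "\<bar>arc_a l\<bar> + \<bar>arc_b l\<bar> \<le> 2 ^ \<beta>" .
      have "\<bar>arc_a l\<bar> \<le> 2 ^ \<beta>" "\<bar>arc_b l\<bar> \<le> 2 ^ \<beta>" by (rule order.trans[OF _ *], simp)+
      then show "\<bar>arc_a l\<bar> \<le> 2 ^ B" "\<bar>arc_b l\<bar> \<le> 2 ^ B"
        by (auto intro: abs_pow_mono simp: B_def)
    qed
    have mem: "num u v \<in> set (encode_instance ts I)" "den u v \<in> set (encode_instance ts I)"
      if "u < nv" "v < nv" for u v
      using that unfolding inp input_def by (auto simp: nv_def) (metis atLeastLessThan_iff le0)+
    have "tc B (front f k K) (init (encode_instance ts I)) front_time ready"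
      unfolding inp f_def
      by (rule tc_front[OF \<open>wide B\<close> nv_def])
        (use entries mem in \<open>auto simp: x_def D_def\<close>)
    then obtain m1 s1 where 1: "m1 \<le> front_time" "exec B (front f k K) (init (encode_instance ts I)) m1 s1" "ready s1"
      unfolding tc_def by blast
    have ft: "front_time \<le> front_bound K z"
      unfolding front_time_def front_bound_def using nvz by (intro add_mono mult_le_mono) auto
    define H where "H = bit_bound B (clen (front f k K)) (front_bound K z)"
    have B4: "4 \<le> B" "b1 \<le> B" "b2 \<le> B" by (auto simp: B_def \<beta>_def)
    \<comment> \<open>The machine run of \<open>front\<close> alone bounds the capacities before any
      phase is counted.\<close>
    have "\<bar>sc s1 SZ\<bar> \<le> 2 ^ (B + Suc m1 * clen (front f k K) * B)"
      by (rule exec_ram_run(2)[OF 1(2) b2[OF B4(3)] B4(1) _ refl]) (use entries in blast)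
    moreover have "B + Suc m1 * clen (front f k K) * B \<le> H"
      unfolding H_def bit_bound_def using 1(1) ft by (intro add_mono mult_le_mono) auto
    ultimately have "\<bar>sc s1 SZ\<bar> \<le> 2 ^ H" by (rule abs_pow_mono)
    then have "sc s1 SZ \<le> 2 ^ H" by linarith
    from tc_back[OF \<open>wide B\<close> 1(3) this] obtain m2 s2 y where
      2: "m2 \<le> H + 1 + ((H + 1) * (phase_time nodes + 1) + nv * (K + 1))"
        "exec B (scale ;; min_cut ;; write_answer c0 K) s1 m2 s2"
        "outp s2 = map (\<lambda>u. int (y u)) [0..<nv]" "labelling y" "\<And>y'. labelling y' \<Longrightarrow> cost y \<le> cost y'"
      unfolding tc_def by blast
    have "exec B (solve f k K c0) (init (encode_instance ts I)) (m1 + m2) s2"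
      unfolding solve_def by (rule exec.Seq[OF 1(2) 2(2)])
    from exec_ram_run(1)[OF this _ B4(1) _ refl] b1[OF B4(2)] entries obtain t where
      t: "t \<le> ram_time B (clen (solve f k K c0)) (m1 + m2)" "ram_run P (0, \<lambda>_. 0, encode_instance ts I, []) t (outp s2)"
      unfolding P_def ram_time_def by blast
    have "m1 + m2 \<le> total_bound K \<beta> (clen (front f k K)) z"
    proof -
      have "m2 \<le> H + 1 + ((H + 1) * (phase_time (2 + K * z) + 1) + z * (K + 1))"
        by (rule order.trans[OF 2(1)], intro add_mono mult_le_mono order.refl phase_time_mono nodes_le nvz)
      with 1(1) ft show ?thesis
        unfolding total_bound_def Let_def B_def [symmetric] H_def [symmetric] by linarith
    qed
    then have "ram_time B (clen (solve f k K c0)) (m1 + m2) \<le> poly p z"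
      unfolding p [symmetric] ram_time_def B_def [symmetric]
      by (intro add_mono mult_le_mono) auto
    with t(1) have time: "t \<le> poly p z" by linarith
    define \<gamma> where "\<gamma> v = (case v of Inl t \<Rightarrow> t | Inr i \<Rightarrow> ts ! (y (k + i)))" for v
    have y: "y u < k" if "u < nv" for u using 2(4) that by (simp add: labelling_def)
    have \<gamma>: "\<gamma> (vl ! u) = ts ! y u" if "u < nv" for u
    proof (cases "u < k")
      case True
      moreover from this have "y u = u" using 2(4) by (simp add: labelling_def)
      ultimately show ?thesis using vertex_list_nth(1)[of u ts n]
        by (simp add: \<gamma>_def vl_def k_def)
    next
      case False
      then obtain i where "u = k + i" using le_Suc_ex[of k u] by auto
      moreover from this have "i < n" using that by (simp add: nv_def)
      ultimately show ?thesis using vertex_list_nth(2)[of i n ts] by (simp add: \<gamma>_def vl_def k_def)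
    qed
    have cost_eq: "of_int d * of_int D * zero_ext_cost (set ts) \<mu> I \<gamma>' = of_int (cost y')"
      if "labelling y'" "\<And>u. u < nv \<Longrightarrow> \<gamma>' (vl ! u) = ts ! y' u" for \<gamma>' y'
    proof -
      have "zero_ext_cost (set ts) \<mu> I \<gamma>' =
          (\<Sum>u<nv. \<Sum>v<nv. of_rat (c (vl ! u) (vl ! v)) * \<mu> (\<gamma>' (vl ! u)) (\<gamma>' (vl ! v)))"
        unfolding zero_ext_cost_def nc prod.case sum.cartesian_product [symmetric]
        by (simp add: sum_vertex_set[OF ts] vl_def nv_def k_def)
      then have "of_int d * of_int D * zero_ext_cost (set ts) \<mu> I \<gamma>' =
          (\<Sum>u<nv. \<Sum>v<nv. (of_int D * of_rat (c (vl ! u) (vl ! v))) * (of_int d * \<mu> (\<gamma>' (vl ! u)) (\<gamma>' (vl ! v))))"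
        by (simp add: sum_distrib_left mult_ac)
      also have "\<dots> = (\<Sum>u<nv. \<Sum>v<nv. of_int (x u v * (if y' u = y' v then 0 else a (y' u) + b (y' v))))"
      proof (intro sum.cong refl)
        fix u v assume uv: "u \<in> {..<nv}" "v \<in> {..<nv}"
        then have "y' u < length ts" "y' v < length ts" using that(1) unfolding labelling_def by (auto simp: k_def)
        from d(2)[OF this] show "of_int D * of_rat (c (vl ! u) (vl ! v)) * (of_int d * \<mu> (\<gamma>' (vl ! u)) (\<gamma>' (vl ! v))) =
            of_int (x u v * (if y' u = y' v then 0 else a (y' u) + b (y' v)))"
          using uv x_eq[of u v] that(2) by simp
      qed
      also have "\<dots> = of_int (cost y')" by (simp add: cost_def)
      finally show ?thesis .
    qed
    have "zero_ext_optimal (set ts) \<mu> I \<gamma>"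
      unfolding zero_ext_optimal_def
    proof (intro conjI allI impI)
      have "\<gamma> v \<in> set ts" if "v \<in> vertex_set (set ts) n" for v
      proof -
        have "v \<in> set vl" using that by (simp add: vl_def set_vertex_list)
        then obtain u where u: "u < nv" "v = vl ! u" by (auto simp: in_set_conv_nth vl_def nv_def k_def)
        then show ?thesis using \<gamma>[OF u(1)] y[OF u(1)] by (simp add: k_def)
      qed
      then show "zero_ext_feasible (set ts) (fst I) \<gamma>"
        by (simp add: zero_ext_feasible_def nc \<gamma>_def)
    next
      fix \<gamma>' assume feas: "zero_ext_feasible (set ts) (fst I) \<gamma>'"
      have "\<exists>i<k. \<gamma>' (vl ! u) = ts ! i" if "u < nv" for u
        using feas vl[OF that] by (auto simp: zero_ext_feasible_def nc in_set_conv_nth k_def) metis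
      then obtain y' where y': "\<And>u. u < nv \<Longrightarrow> y' u < k \<and> \<gamma>' (vl ! u) = ts ! y' u" by metis
      have "labelling y'"
        unfolding labelling_def
      proof (intro conjI allI impI)
        fix u assume u: "u < k"
        then have "ts ! y' u = ts ! u" "y' u < k"
          using y'[of u] feas vertex_list_nth(1)[of u ts n]
          by (auto simp: zero_ext_feasible_def nc vl_def k_def nv_def)
        then show "y' u = u" using ts u by (simp add: nth_eq_iff_index_eq k_def)
      qed (use y' in blast)
      then have "of_int d * of_int D * zero_ext_cost (set ts) \<mu> I \<gamma> \<le> of_int d * of_int D * zero_ext_cost (set ts) \<mu> I \<gamma>'"
        using cost_eq[OF 2(4) \<gamma>] cost_eq[of y' \<gamma>'] y' 2(5) by simp
      then show "zero_ext_cost (set ts) \<mu> I \<gamma> \<le> zero_ext_cost (set ts) \<mu> I \<gamma>'"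
        using d(1) D by (simp add: mult_le_cancel_left_pos)
    qed
    moreover have "encodes_map ts (fst I) \<gamma> (outp s2)"
      unfolding encodes_map_def nc fst_conv vl_def [symmetric] 2(3)
      using y \<gamma> by (auto simp: list_all2_conv_all_nth vl_def nv_def k_def)
    ultimately show ?thesis using t(2) time unfolding z_def by blast
  qed
  then show ?thesis unfolding poly_time_solvable_def by blast
qed

theorem theorem1p6:
  fixes T :: "'a set" and \<mu> :: "'a \<Rightarrow> 'a \<Rightarrow> real"
  assumes "finite T"
    and "directed_metric_on T \<mu>"
    and "rational_valued_on T \<mu>"
    and "star_graph T (underlying_edges T \<mu>)"
    and "\<not> (\<exists>s0 s1 s2. biased_non_collinear_triple T \<mu> s0 s1 s2)"
  shows "zero_ext_poly_time T \<mu>"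
  unfolding zero_ext_poly_time_def
proof (intro allI impI)
  fix ts assume ts: "distinct ts \<and> set ts = T"
  obtain s where s: "s \<in> T" "underlying_edges T \<mu> = {{s, x} |x. x \<in> T - {s}}"
    using assms(4) by (auto simp: star_graph_def)
  note m = assms(2)[unfolded directed_metric_on_def]
  have star: "\<mu> x y = \<mu> x s + \<mu> s y" if "x \<in> T - {s}" "y \<in> T - {s}" "x \<noteq> y" for x y
    using star_metric_center[OF assms(1,2) s] that by blast
  have pos: "0 < \<mu> x s + \<mu> s x" if "x \<in> T - {s}" for x using m s that by auto
  \<comment> \<open>This substitution turns the product condition for unbiased pairs into a sum, as
    \<open>two_sides\<close> expects.\<close>
  define r where "r x = \<mu> x s / (\<mu> x s + \<mu> s x)" for x
  have r: "r x + r y = 1 \<longleftrightarrow> \<mu> x s * \<mu> y s = \<mu> s x * \<mu> s y" if "x \<in> T - {s}" "y \<in> T - {s}" for x y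
    unfolding r_def by (rule unbiased_iff[OF pos pos]) (use that in auto)
  have "\<exists>A. \<forall>x\<in>T - {s}. \<forall>y\<in>T - {s}. x \<noteq> y \<longrightarrow> (x \<in> A \<longleftrightarrow> y \<in> A) \<longrightarrow> r x + r y = 1"
  proof (rule two_sides)
    fix x y z assume xyz: "x \<in> T - {s}" "y \<in> T - {s}" "z \<in> T - {s}" "x \<noteq> y" "y \<noteq> z" "x \<noteq> z"
    from unbiased_in_triple[OF assms(2) s(1) star assms(5) this]
    show "r x + r y = 1 \<or> r y + r z = 1 \<or> r x + r z = 1"
      unfolding r[OF xyz(1,2)] r[OF xyz(2,3)] r[OF xyz(1,3)] .
  qed
  then obtain A where A: "\<forall>x\<in>T - {s}. \<forall>y\<in>T - {s}. x \<noteq> y \<longrightarrow> (x \<in> A \<longleftrightarrow> y \<in> A) \<longrightarrow> r x + r y = 1" ..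
  have "finite ((\<lambda>(x, y). \<mu> x y) ` (T \<times> T))" "(\<lambda>(x, y). \<mu> x y) ` (T \<times> T) \<subseteq> \<rat>"
    using assms(1,3) by (auto simp: rational_valued_on_def)
  from common_denominator[OF this] obtain d :: int where d: "d > 0"
    "\<And>x y. x \<in> T \<Longrightarrow> y \<in> T \<Longrightarrow> of_int d * \<mu> x y \<in> \<int>" by auto
  \<comment> \<open>The arguments of the floors are integers by the choice of
    \<open>d\<close>.\<close>
  define a where "a i = \<lfloor>of_int d * \<mu> (ts ! i) s\<rfloor>" for i
  define b where "b i = \<lfloor>of_int d * \<mu> s (ts ! i)\<rfloor>" for i
  have tsT: "ts ! i \<in> T" if "i < length ts" for i using ts that nth_mem by blast
  have ab: "of_int (a i) = of_int d * \<mu> (ts ! i) s" "of_int (b i) = of_int d * \<mu> s (ts ! i)" if "i < length ts" for i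
    unfolding a_def b_def using d(2)[OF tsT[OF that] s(1)] d(2)[OF s(1) tsT[OF that]]
    by (metis Ints_cases floor_of_int)+
  obtain c0 where c0: "c0 < length ts" "ts ! c0 = s" using ts s(1) by (metis in_set_conv_nth)
  define ls where "ls = filter (\<lambda>i. i \<noteq> c0) [0..<length ts]"
  have lf: "bij_betw ((!) ls) {..<length ls} ({..<length ts} - {c0})"
    by (rule bij_betw_nth) (auto simp: ls_def)
  have leaf: "ls ! l < length ts" "ts ! (ls ! l) \<in> T - {s}" if "l < length ls" for l
  proof -
    have "ls ! l \<in> {..<length ts} - {c0}" using lf that by (auto simp: bij_betw_def)
    then show "ls ! l < length ts" "ts ! (ls ! l) \<in> T - {s}"
      using ts c0 tsT by (auto simp: nth_eq_iff_index_eq)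
  qed
  have sT: "\<mu> s s = 0" using m s(1) by blast
  have d0: "0 < real_of_int d" using d(1) by simp
  have "poly_time_solvable (zero_ext_instances (set ts)) (encode_instance ts)
    (\<lambda>I ys. \<exists>\<gamma>. zero_ext_optimal (set ts) \<mu> I \<gamma> \<and> encodes_map ts (fst I) \<gamma> ys)"
  proof (rule zero_ext_solvable[where a = a and b = b and lf = "(!) ls" and K = "length ls" and ty = "\<lambda>l. ts ! (ls ! l) \<in> A"])
    show "a c0 = 0" "b c0 = 0" by (simp_all add: a_def b_def c0(2) sT)
  next
    fix l assume l: "l < length ls"
    have "0 \<le> real_of_int (a (ls ! l))" "0 \<le> real_of_int (b (ls ! l))"
      unfolding ab[OF leaf(1)[OF l]] using d0 m leaf(2)[OF l] s(1) by (auto intro!: mult_nonneg_nonneg)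
    then show "0 \<le> a (ls ! l)" "0 \<le> b (ls ! l)" by simp_all
    have "real_of_int (a (ls ! l) + b (ls ! l)) = d * (\<mu> (ts ! (ls ! l)) s + \<mu> s (ts ! (ls ! l)))"
      using ab[OF leaf(1)[OF l]] by (simp add: distrib_left)
    also have "\<dots> > 0" using d0 pos[OF leaf(2)[OF l]] by simp
    finally show "0 < a (ls ! l) + b (ls ! l)" by linarith
  next
    fix l m assume lm: "l < length ls" "m < length ls" "l \<noteq> m" "(ts ! (ls ! l) \<in> A) = (ts ! (ls ! m) \<in> A)"
    have "ls ! l \<noteq> ls ! m" using lm by (simp add: nth_eq_iff_index_eq ls_def)
    then have "ts ! (ls ! l) \<noteq> ts ! (ls ! m)" using ts leaf(1) lm by (simp add: nth_eq_iff_index_eq)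
    from A[rule_format, OF leaf(2)[OF lm(1)] leaf(2)[OF lm(2)] this lm(4), unfolded r[OF leaf(2)[OF lm(1)] leaf(2)[OF lm(2)]]]
    have "real_of_int (a (ls ! l) * a (ls ! m)) = real_of_int (b (ls ! l) * b (ls ! m))"
      using ab leaf(1) lm by (simp add: mult_ac)
    then show "a (ls ! l) * a (ls ! m) = b (ls ! l) * b (ls ! m)" by (simp only: of_int_eq_iff)
  next
    fix i j assume ij: "i < length ts" "j < length ts"
    show "of_int d * \<mu> (ts ! i) (ts ! j) = of_int (if i = j then 0 else a i + b j)"
    proof (cases "i = j")
      case True
      then show ?thesis using m tsT[OF ij(1)] by simp
    next
      case False
      then have "ts ! i \<noteq> ts ! j" using ts ij by (simp add: nth_eq_iff_index_eq)
      \<comment> \<open>If one of the two terminals is the center, the formula holds because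
        \<open>\<mu> s s = 0\<close>.\<close>
      then have "\<mu> (ts ! i) (ts ! j) = \<mu> (ts ! i) s + \<mu> s (ts ! j)"
        using star[of "ts ! i" "ts ! j"] tsT[OF ij(1)] tsT[OF ij(2)] sT
        by (cases "ts ! i = s"; cases "ts ! j = s") auto
      then show ?thesis using False ab(1)[OF ij(1)] ab(2)[OF ij(2)] by (simp add: distrib_left)
    qed
  qed (use ts c0 lf d in auto)
  then show "poly_time_solvable (zero_ext_instances T) (encode_instance ts)
    (\<lambda>I ys. \<exists>\<gamma>. zero_ext_optimal T \<mu> I \<gamma> \<and> encodes_map ts (fst I) \<gamma> ys)"
    using ts by simp
qed

end
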